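(* The equivalence $\mathbf{OUS}\simeq\mathbf{AEMod}$, $(V,u)\mapsto[0,u]\subseteq V$, between order unit spaces and Archimedean effect modules restricts further to an equivalence $\mathbf{BOUS}\simeq\mathbf{BEMod}$ between the full subcategory $\mathbf{BOUS}\hookrightarrow\mathbf{OUS}$ of those order unit spaces that are also Banach spaces and the full subcategory $\mathbf{BEMod}\hookrightarrow\mathbf{AEMod}$ of Banach effect modules.
   Context: Effect algebra: a set $E$ with a partial commutative associative operation $\oplus$ with neutral element $0$ and a map $(-)^\perp$ such that, with $1:=0^\perp$, $x^\perp$ is the unique element with $x\oplus x^\perp=1$, and $x\oplus 1$ is defined only if $x=0$; order: $x\le y$ iff $x\oplus z=y$ for some $z$. Effect module: an effect algebra with scalar multiplication $[0,1]\times E\to E$ with $1x=x$, $(rs)x=r(sx)$, $(r+s)x=rx\oplus sx$ if $r+s\le1$, and $r(x\oplus y)=rx\oplus ry$ if $x\oplus y$ is defined. Category $\mathbf{EMod}$: maps preserve $1$, defined sums $\oplus$, and scalar multiplication. Order unit space: a partially ordered real vector space $V$ with a positive element $u$ that is a strong unit (for each $x$ there is $n\in\mathbb{N}$ with $x\le nu$) and Archimedean ($x\le ru$ for all $r>0$ implies $x\le0$). It is normed by $\|x\|=\inf\{r\ge0\mid-ru\le x\le ru\}$. $\mathbf{OUS}$: order unit spaces with linear maps preserving order and unit. The interval $[0,u]=\{x\in V\mid 0\le x\le u\}$ is an effect module with $x\oplus y=x+y$ defined iff $x+y\le u$ and $x^\perp=u-x$. An effect module is Archimedean if $x\le y$ whenever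 $\frac12x\le\frac12y\oplus\frac r21$ for all $r\in(0,1]$; $\mathbf{AEMod}\hookrightarrow\mathbf{EMod}$ is the full subcategory of these. An Archimedean effect module has the metric $d(x,y)=\max\big(\inf\{r\in(0,1]\mid\frac12x\le\frac12y\oplus\frac r21\},\inf\{r\in(0,1]\mid\frac12y\le\frac12x\oplus\frac r21\}\big)$; it is a Banach effect module if it is complete in this metric. *)

theory Defs
  imports "HOL-Analysis.Analysis" "HOL-Algebra.Module"
begin

section \<open>Categories, functors and equivalences\<close>

text \<open>Hom-sets need not be disjoint: identities, composition and the morphism part of a functor
  receive the objects as explicit arguments. \<open>Comp C a b c g f\<close> is the composite of
  \<open>f : a \<rightarrow> b\<close> and \<open>g : b \<rightarrow> c\<close>.\<close>

record ('o, 'm) category =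
  Obj :: "'o set"
  Hom :: "'o \<Rightarrow> 'o \<Rightarrow> 'm set"
  Ident :: "'o \<Rightarrow> 'm"
  Comp :: "'o \<Rightarrow> 'o \<Rightarrow> 'o \<Rightarrow> 'm \<Rightarrow> 'm \<Rightarrow> 'm"

definition is_category :: "('o, 'm) category \<Rightarrow> bool" where
  "is_category C \<longleftrightarrow>
     (\<forall>a \<in> Obj C. Ident C a \<in> Hom C a a) \<and>
     (\<forall>a \<in> Obj C. \<forall>b \<in> Obj C. \<forall>c \<in> Obj C. \<forall>f \<in> Hom C a b. \<forall>g \<in> Hom C b c.
        Comp C a b c g f \<in> Hom C a c) \<and>
     (\<forall>a \<in> Obj C. \<forall>b \<in> Obj C. \<forall>f \<in> Hom C a b.
        Comp C a a b f (Ident C a) = f \<and> Comp C a b b (Ident C b) f = f) \<and>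
     (\<forall>a \<in> Obj C. \<forall>b \<in> Obj C. \<forall>c \<in> Obj C. \<forall>d \<in> Obj C.
        \<forall>f \<in> Hom C a b. \<forall>g \<in> Hom C b c. \<forall>h \<in> Hom C c d.
        Comp C a c d h (Comp C a b c g f) = Comp C a b d (Comp C b c d h g) f)"

definition full_subcategory :: "('o, 'm) category \<Rightarrow> ('o \<Rightarrow> bool) \<Rightarrow> ('o, 'm) category" where
  "full_subcategory C P = C\<lparr>Obj := {a \<in> Obj C. P a}\<rparr>"

definition is_iso :: "('o, 'm) category \<Rightarrow> 'o \<Rightarrow> 'o \<Rightarrow> 'm \<Rightarrow> bool" where
  "is_iso C a b f \<longleftrightarrow> f \<in> Hom C a b \<and>
     (\<exists>g \<in> Hom C b a. Comp C a b a g f = Ident C a \<and> Comp C b a b f g = Ident C b)"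

record ('o, 'm, 'p, 'n) functor_data =
  OMap :: "'o \<Rightarrow> 'p"
  MMap :: "'o \<Rightarrow> 'o \<Rightarrow> 'm \<Rightarrow> 'n"

definition is_functor ::
  "('o, 'm) category \<Rightarrow> ('p, 'n) category \<Rightarrow> ('o, 'm, 'p, 'n) functor_data \<Rightarrow> bool" where
  "is_functor C D F \<longleftrightarrow> is_category C \<and> is_category D \<and>
     (\<forall>a \<in> Obj C. OMap F a \<in> Obj D) \<and>
     (\<forall>a \<in> Obj C. \<forall>b \<in> Obj C. \<forall>f \<in> Hom C a b. MMap F a b f \<in> Hom D (OMap F a) (OMap F b)) \<and>
     (\<forall>a \<in> Obj C. MMap F a a (Ident C a) = Ident D (OMap F a)) \<and>
     (\<forall>a \<in> Obj C. \<forall>b \<in> Obj C. \<forall>c \<in> Obj C. \<forall>f \<in> Hom C a b. \<forall>g \<in> Hom C b c.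
        MMap F a c (Comp C a b c g f) =
        Comp D (OMap F a) (OMap F b) (OMap F c) (MMap F b c g) (MMap F a b f))"

definition id_functor :: "('o, 'm, 'o, 'm) functor_data" where
  "id_functor = \<lparr>OMap = (\<lambda>a. a), MMap = (\<lambda>a b f. f)\<rparr>"

definition comp_functor ::
  "('p, 'n, 'q, 'l) functor_data \<Rightarrow> ('o, 'm, 'p, 'n) functor_data \<Rightarrow> ('o, 'm, 'q, 'l) functor_data" where
  "comp_functor G F =
     \<lparr>OMap = (\<lambda>a. OMap G (OMap F a)),
      MMap = (\<lambda>a b f. MMap G (OMap F a) (OMap F b) (MMap F a b f))\<rparr>"

definition is_natural_iso ::
  "('o, 'm) category \<Rightarrow> ('p, 'n) category \<Rightarrow> ('o, 'm, 'p, 'n) functor_data \<Rightarrow>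
   ('o, 'm, 'p, 'n) functor_data \<Rightarrow> ('o \<Rightarrow> 'n) \<Rightarrow> bool" where
  "is_natural_iso C D F G \<tau> \<longleftrightarrow> is_functor C D F \<and> is_functor C D G \<and>
     (\<forall>a \<in> Obj C. is_iso D (OMap F a) (OMap G a) (\<tau> a)) \<and>
     (\<forall>a \<in> Obj C. \<forall>b \<in> Obj C. \<forall>f \<in> Hom C a b.
        Comp D (OMap F a) (OMap F b) (OMap G b) (\<tau> b) (MMap F a b f) =
        Comp D (OMap F a) (OMap G a) (OMap G b) (MMap G a b f) (\<tau> a))"

definition is_equivalence ::
  "('o, 'm) category \<Rightarrow> ('p, 'n) category \<Rightarrow> ('o, 'm, 'p, 'n) functor_data \<Rightarrow>
   ('p, 'n, 'o, 'm) functor_data \<Rightarrow> ('o \<Rightarrow> 'm) \<Rightarrow> ('p \<Rightarrow> 'n) \<Rightarrow> bool" where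
  "is_equivalence C D F G \<eta> \<epsilon> \<longleftrightarrow> is_functor C D F \<and> is_functor D C G \<and>
     is_natural_iso C C id_functor (comp_functor G F) \<eta> \<and>
     is_natural_iso D D (comp_functor F G) id_functor \<epsilon>"


section \<open>Order unit spaces\<close>

definition real_scalars :: "real ring" where
  "real_scalars = \<lparr>carrier = UNIV, mult = (*), one = 1, zero = 0, add = (+)\<rparr>"

text \<open>The fields \<open>mult\<close> and \<open>one\<close> that every module record inherits from rings carry no
  meaning here.\<close>

record 'a ordered_space = "(real, 'a) module" +
  leq :: "'a \<Rightarrow> 'a \<Rightarrow> bool"
  unit :: 'a

definition order_unit_space :: "'a ordered_space \<Rightarrow> bool" where
  "order_unit_space V \<longleftrightarrow>
     Module.module real_scalars V \<and>
     (\<forall>x \<in> carrier V. leq V x x) \<and>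
     (\<forall>x \<in> carrier V. \<forall>y \<in> carrier V. leq V x y \<longrightarrow> leq V y x \<longrightarrow> x = y) \<and>
     (\<forall>x \<in> carrier V. \<forall>y \<in> carrier V. \<forall>z \<in> carrier V. leq V x y \<longrightarrow> leq V y z \<longrightarrow> leq V x z) \<and>
     (\<forall>x \<in> carrier V. \<forall>y \<in> carrier V. \<forall>z \<in> carrier V.
        leq V x y \<longrightarrow> leq V (x \<oplus>\<^bsub>V\<^esub> z) (y \<oplus>\<^bsub>V\<^esub> z)) \<and>
     (\<forall>r \<ge> 0. \<forall>x \<in> carrier V. \<forall>y \<in> carrier V.
        leq V x y \<longrightarrow> leq V (r \<odot>\<^bsub>V\<^esub> x) (r \<odot>\<^bsub>V\<^esub> y)) \<and>
     unit V \<in> carrier V \<and> leq V \<zero>\<^bsub>V\<^esub> (unit V) \<and>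
     (\<forall>x \<in> carrier V. \<exists>n::nat. leq V x (real n \<odot>\<^bsub>V\<^esub> unit V)) \<and>
     (\<forall>x \<in> carrier V. (\<forall>r > 0. leq V x (r \<odot>\<^bsub>V\<^esub> unit V)) \<longrightarrow> leq V x \<zero>\<^bsub>V\<^esub>)"

definition unit_norm :: "'a ordered_space \<Rightarrow> 'a \<Rightarrow> real" where
  "unit_norm V x =
     Inf {r. 0 \<le> r \<and> leq V (\<ominus>\<^bsub>V\<^esub> (r \<odot>\<^bsub>V\<^esub> unit V)) x \<and> leq V x (r \<odot>\<^bsub>V\<^esub> unit V)}"

text \<open>\<^locale>\<open>Metric_space\<close> demands a symmetric nonnegative distance on the whole type, hence the
  value 0 outside the carrier, here and in the metric of an effect module.\<close>

definition unit_dist :: "'a ordered_space \<Rightarrow> 'a \<Rightarrow> 'a \<Rightarrow> real" where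
  "unit_dist V x y =
     (if x \<in> carrier V \<and> y \<in> carrier V then unit_norm V (x \<ominus>\<^bsub>V\<^esub> y) else 0)"

definition banach_space :: "'a ordered_space \<Rightarrow> bool" where
  "banach_space V \<longleftrightarrow> Metric_space.mcomplete (carrier V) (unit_dist V)"

text \<open>Morphisms are extensional functions, so that equality of morphisms is equality on the
  carrier.\<close>

definition ous_hom :: "'a ordered_space \<Rightarrow> 'a ordered_space \<Rightarrow> ('a \<Rightarrow> 'a) set" where
  "ous_hom V W = {f \<in> carrier V \<rightarrow>\<^sub>E carrier W.
     (\<forall>x \<in> carrier V. \<forall>y \<in> carrier V. f (x \<oplus>\<^bsub>V\<^esub> y) = f x \<oplus>\<^bsub>W\<^esub> f y) \<and>
     (\<forall>r. \<forall>x \<in> carrier V. f (r \<odot>\<^bsub>V\<^esub> x) = r \<odot>\<^bsub>W\<^esub> f x) \<and>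
     (\<forall>x \<in> carrier V. \<forall>y \<in> carrier V. leq V x y \<longrightarrow> leq W (f x) (f y)) \<and>
     f (unit V) = unit W}"

definition OUS :: "('a ordered_space, 'a \<Rightarrow> 'a) category" where
  "OUS = \<lparr>Obj = {V. order_unit_space V}, Hom = ous_hom,
          Ident = (\<lambda>V. restrict (\<lambda>x. x) (carrier V)),
          Comp = (\<lambda>U V W g f. compose (carrier U) g f)\<rparr>"

definition BOUS :: "('a ordered_space, 'a \<Rightarrow> 'a) category" where
  "BOUS = full_subcategory OUS banach_space"


section \<open>Effect modules\<close>

record 'a effect_structure = "'a partial_object" +
  osum :: "'a \<Rightarrow> 'a \<Rightarrow> 'a option"
  ezero :: 'a
  ortho :: "'a \<Rightarrow> 'a"
  escale :: "real \<Rightarrow> 'a \<Rightarrow> 'a"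

definition eone :: "'a effect_structure \<Rightarrow> 'a" where
  "eone E = ortho E (ezero E)"

definition effect_algebra :: "'a effect_structure \<Rightarrow> bool" where
  "effect_algebra E \<longleftrightarrow>
     (\<forall>x \<in> carrier E. \<forall>y \<in> carrier E. \<forall>z. osum E x y = Some z \<longrightarrow> z \<in> carrier E) \<and>
     (\<forall>x \<in> carrier E. \<forall>y \<in> carrier E. osum E x y = osum E y x) \<and>
     (\<forall>x \<in> carrier E. \<forall>y \<in> carrier E. \<forall>z \<in> carrier E.
        Option.bind (osum E x y) (\<lambda>s. osum E s z) = Option.bind (osum E y z) (\<lambda>s. osum E x s)) \<and>
     ezero E \<in> carrier E \<and> (\<forall>x \<in> carrier E. osum E (ezero E) x = Some x) \<and>
     (\<forall>x \<in> carrier E. ortho E x \<in> carrier E \<and>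
        (\<forall>y \<in> carrier E. osum E x y = Some (eone E) \<longleftrightarrow> y = ortho E x)) \<and>
     (\<forall>x \<in> carrier E. osum E x (eone E) \<noteq> None \<longrightarrow> x = ezero E)"

definition ele :: "'a effect_structure \<Rightarrow> 'a \<Rightarrow> 'a \<Rightarrow> bool" where
  "ele E x y \<longleftrightarrow> (\<exists>z \<in> carrier E. osum E x z = Some y)"

definition effect_module :: "'a effect_structure \<Rightarrow> bool" where
  "effect_module E \<longleftrightarrow> effect_algebra E \<and>
     (\<forall>r \<in> {0..1}. \<forall>x \<in> carrier E. escale E r x \<in> carrier E) \<and>
     (\<forall>x \<in> carrier E. escale E 1 x = x) \<and>
     (\<forall>r \<in> {0..1}. \<forall>s \<in> {0..1}. \<forall>x \<in> carrier E.
        escale E (r * s) x = escale E r (escale E s x)) \<and>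
     (\<forall>r \<in> {0..1}. \<forall>s \<in> {0..1}. \<forall>x \<in> carrier E. r + s \<le> 1 \<longrightarrow>
        osum E (escale E r x) (escale E s x) = Some (escale E (r + s) x)) \<and>
     (\<forall>r \<in> {0..1}. \<forall>x \<in> carrier E. \<forall>y \<in> carrier E. \<forall>z. osum E x y = Some z \<longrightarrow>
        osum E (escale E r x) (escale E r y) = Some (escale E r z))"

text \<open>\<open>half_le E r x y\<close> is $\frac12 x \le \frac12 y \oplus \frac r2 1$; in an effect module the
  sum on the right is defined for every r in [0,1].\<close>

definition half_le :: "'a effect_structure \<Rightarrow> real \<Rightarrow> 'a \<Rightarrow> 'a \<Rightarrow> bool" where
  "half_le E r x y \<longleftrightarrow>
     (\<exists>w. osum E (escale E (1/2) y) (escale E (r/2) (eone E)) = Some w \<and>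
          ele E (escale E (1/2) x) w)"

definition archimedean :: "'a effect_structure \<Rightarrow> bool" where
  "archimedean E \<longleftrightarrow>
     (\<forall>x \<in> carrier E. \<forall>y \<in> carrier E. (\<forall>r \<in> {0<..1}. half_le E r x y) \<longrightarrow> ele E x y)"

definition edist :: "'a effect_structure \<Rightarrow> 'a \<Rightarrow> 'a \<Rightarrow> real" where
  "edist E x y =
     (if x \<in> carrier E \<and> y \<in> carrier E
      then max (Inf {r \<in> {0<..1}. half_le E r x y}) (Inf {r \<in> {0<..1}. half_le E r y x})
      else 0)"

definition banach_effect_module :: "'a effect_structure \<Rightarrow> bool" where
  "banach_effect_module E \<longleftrightarrow> Metric_space.mcomplete (carrier E) (edist E)"

definition emod_hom :: "'a effect_structure \<Rightarrow> 'a effect_structure \<Rightarrow> ('a \<Rightarrow> 'a) set" where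
  "emod_hom E F = {f \<in> carrier E \<rightarrow>\<^sub>E carrier F.
     f (eone E) = eone F \<and>
     (\<forall>x \<in> carrier E. \<forall>y \<in> carrier E. \<forall>z. osum E x y = Some z \<longrightarrow>
        osum F (f x) (f y) = Some (f z)) \<and>
     (\<forall>r \<in> {0..1}. \<forall>x \<in> carrier E. f (escale E r x) = escale F r (f x))}"

definition EMod :: "('a effect_structure, 'a \<Rightarrow> 'a) category" where
  "EMod = \<lparr>Obj = {E. effect_module E}, Hom = emod_hom,
           Ident = (\<lambda>E. restrict (\<lambda>x. x) (carrier E)),
           Comp = (\<lambda>D E F g f. compose (carrier D) g f)\<rparr>"

definition AEMod :: "('a effect_structure, 'a \<Rightarrow> 'a) category" where
  "AEMod = full_subcategory EMod archimedean"

definition BEMod :: "('a effect_structure, 'a \<Rightarrow> 'a) category" where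
  "BEMod = full_subcategory AEMod banach_effect_module"


section \<open>The unit interval functor\<close>

definition unit_interval :: "'a ordered_space \<Rightarrow> 'a effect_structure" where
  "unit_interval V =
     \<lparr>carrier = {x \<in> carrier V. leq V \<zero>\<^bsub>V\<^esub> x \<and> leq V x (unit V)},
      osum = (\<lambda>x y. if leq V (x \<oplus>\<^bsub>V\<^esub> y) (unit V) then Some (x \<oplus>\<^bsub>V\<^esub> y) else None),
      ezero = \<zero>\<^bsub>V\<^esub>,
      ortho = (\<lambda>x. unit V \<ominus>\<^bsub>V\<^esub> x),
      escale = (\<lambda>r x. r \<odot>\<^bsub>V\<^esub> x)\<rparr>"

definition unit_interval_functor ::
  "('a ordered_space, 'a \<Rightarrow> 'a, 'a effect_structure, 'a \<Rightarrow> 'a) functor_data" where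
  "unit_interval_functor =
     \<lparr>OMap = unit_interval,
      MMap = (\<lambda>V W f. restrict f (carrier (unit_interval V)))\<rparr>"

end

theory Submission
  imports Defs
begin

text \<open>The unit interval functor is fully faithful: vectors near half the unit lie in the interval up
  to translation and scaling, so a morphism of intervals extends uniquely. It is essentially
  surjective: an Archimedean effect module \<open>E\<close> is the interval of the space of formal vectors
  \<open>(x - centre) / t\<close> with \<open>x\<close> in \<open>E\<close> and \<open>0 < t \<le> 1\<close>, where \<open>centre\<close> is half the unit; these are
  compared after contracting \<open>E\<close> towards its centre. On an interval the effect module metric
  agrees with the order unit norm. The interval is closed, and translation and scaling carry a tail
  of any Cauchy sequence into it, so the space and its interval are complete simultaneously.\<close>

section \<open>Equivalences from fully faithful functors\<close>

text \<open>Two total operations replace them: midpoints, and homotheties about the centre, whose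
  ratio may be negative because the orthocomplement is the reflection in the centre. Adding formal
  vectors means taking a midpoint and halving the denominator, and the module axioms turn into
  identities between midpoints and homotheties. Comparing formal vectors is transitive because a
  positive factor can be cancelled in an inequality, although effect modules have no division. The
  Archimedean condition on \<open>E\<close> is what makes the space Archimedean. One quasi-inverse
  serves both equivalences: the subcategories are full, so only completeness of objects has to be
  passed on. The metric of an effect module is written in its own operations, hence isomorphisms are
  isometries; completeness of \<open>E\<close> passes to the isomorphic interval and from there to
  the space.\<close>

lemma category_ident: "is_category C \<Longrightarrow> a \<in> Obj C \<Longrightarrow> Ident C a \<in> Hom C a a"
  unfolding is_category_def by blast

lemma category_comp:
  "is_category C \<Longrightarrow> a \<in> Obj C \<Longrightarrow> b \<in> Obj C \<Longrightarrow> c \<in> Obj C \<Longrightarrow> f \<in> Hom C a b \<Longrightarrow> g \<in> Hom C b c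
   \<Longrightarrow> Comp C a b c g f \<in> Hom C a c"
  unfolding is_category_def by blast

lemma category_ident_right:
  "is_category C \<Longrightarrow> a \<in> Obj C \<Longrightarrow> b \<in> Obj C \<Longrightarrow> f \<in> Hom C a b \<Longrightarrow> Comp C a a b f (Ident C a) = f"
  unfolding is_category_def by blast

lemma category_ident_left:
  "is_category C \<Longrightarrow> a \<in> Obj C \<Longrightarrow> b \<in> Obj C \<Longrightarrow> f \<in> Hom C a b \<Longrightarrow> Comp C a b b (Ident C b) f = f"
  unfolding is_category_def by blast

lemma category_assoc:
  "is_category C \<Longrightarrow> a \<in> Obj C \<Longrightarrow> b \<in> Obj C \<Longrightarrow> c \<in> Obj C \<Longrightarrow> d \<in> Obj C
   \<Longrightarrow> f \<in> Hom C a b \<Longrightarrow> g \<in> Hom C b c \<Longrightarrow> h \<in> Hom C c d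
   \<Longrightarrow> Comp C a c d h (Comp C a b c g f) = Comp C a b d (Comp C b c d h g) f"
  unfolding is_category_def by blast

text \<open>The morphism part of the quasi-inverse is determined by naturality of \<open>e\<close>: since each
  \<open>e b\<close> is invertible and \<open>F\<close> is fully faithful, a morphism \<open>g\<close> into \<open>G b\<close> is
  determined by \<open>e b \<circ> F g\<close>, and all required equations are checked after this embedding.\<close>

lemma fully_faithful_imp_equivalence:
  fixes C :: "('o, 'm) category" and D :: "('p, 'n) category"
  assumes F: "is_functor C D F"
    and ff: "\<And>a b. a \<in> Obj C \<Longrightarrow> b \<in> Obj C \<Longrightarrow>
      bij_betw (MMap F a b) (Hom C a b) (Hom D (OMap F a) (OMap F b))"
    and G0: "\<And>b. b \<in> Obj D \<Longrightarrow> G0 b \<in> Obj C"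
    and e: "\<And>b. b \<in> Obj D \<Longrightarrow> is_iso D (OMap F (G0 b)) b (e b)"
  shows "\<exists>G \<eta>. OMap G = G0 \<and> is_equivalence C D F G \<eta> e"
proof -
  have C: "is_category C" and D: "is_category D" using F by (auto simp: is_functor_def)
  note cC = category_comp[OF C] and cD = category_comp[OF D]
  note iC = category_ident[OF C] and iD = category_ident[OF D]
  have Fo: "OMap F a \<in> Obj D" if "a \<in> Obj C" for a
    using F that by (auto simp: is_functor_def)
  have Fm: "MMap F a b f \<in> Hom D (OMap F a) (OMap F b)"
    if "a \<in> Obj C" "b \<in> Obj C" "f \<in> Hom C a b" for a b f
    using F that by (auto simp: is_functor_def)
  have Fi: "MMap F a a (Ident C a) = Ident D (OMap F a)" if "a \<in> Obj C" for a
    using F that by (auto simp: is_functor_def)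
  have Fc: "MMap F a c (Comp C a b c g f) =
        Comp D (OMap F a) (OMap F b) (OMap F c) (MMap F b c g) (MMap F a b f)"
    if "a \<in> Obj C" "b \<in> Obj C" "c \<in> Obj C" "f \<in> Hom C a b" "g \<in> Hom C b c" for a b c f g
    using F that by (auto simp: is_functor_def)
  have inj: "f = g"
    if "a \<in> Obj C" "b \<in> Obj C" "f \<in> Hom C a b" "g \<in> Hom C a b" "MMap F a b f = MMap F a b g" for a b f g
    using ff[OF that(1,2)] that by (auto simp: bij_betw_def inj_on_def)
  have surj: "\<exists>f \<in> Hom C a b. MMap F a b f = h"
    if "a \<in> Obj C" "b \<in> Obj C" "h \<in> Hom D (OMap F a) (OMap F b)" for a b h
    using ff[OF that(1,2)] that(3) by (metis bij_betw_def imageE)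
  define \<Phi> where "\<Phi> b = OMap F (G0 b)" for b
  have \<Phi>: "\<Phi> b \<in> Obj D" if "b \<in> Obj D" for b unfolding \<Phi>_def using that G0 Fo by blast
  have "\<exists>e'. \<forall>b \<in> Obj D. e' b \<in> Hom D b (\<Phi> b) \<and> Comp D (\<Phi> b) b (\<Phi> b) (e' b) (e b) = Ident D (\<Phi> b)
          \<and> Comp D b (\<Phi> b) b (e b) (e' b) = Ident D b"
    using e unfolding is_iso_def \<Phi>_def by metis
  then obtain e' where e': "\<And>b. b \<in> Obj D \<Longrightarrow> e' b \<in> Hom D b (\<Phi> b)"
    and e'e: "\<And>b. b \<in> Obj D \<Longrightarrow> Comp D (\<Phi> b) b (\<Phi> b) (e' b) (e b) = Ident D (\<Phi> b)"
    and ee': "\<And>b. b \<in> Obj D \<Longrightarrow> Comp D b (\<Phi> b) b (e b) (e' b) = Ident D b"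
    by blast
  have eh: "e b \<in> Hom D (\<Phi> b) b" if "b \<in> Obj D" for b
    using e[OF that] unfolding is_iso_def \<Phi>_def by blast
  \<comment> \<open>\<open>K a b\<close> is the adjunction transpose from
    \<open>Hom C a (G0 b)\<close> to \<open>Hom D (OMap F a) b\<close>; it is bijective by
    \<open>Kinj\<close> and \<open>Ksurj\<close>, and natural in \<open>a\<close> by
    \<open>Kcomp\<close>.\<close>
  define K where "K a b g = Comp D (OMap F a) (\<Phi> b) b (e b) (MMap F a (G0 b) g)" for a b g
  have Kinj: "g = g'"
    if a: "a \<in> Obj C" and b: "b \<in> Obj D" and g: "g \<in> Hom C a (G0 b)" "g' \<in> Hom C a (G0 b)"
      and eq: "K a b g = K a b g'" for a b g g'
  proof (rule inj[OF a G0[OF b] g])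
    have "Comp D (OMap F a) b (\<Phi> b) (e' b) (K a b h) = MMap F a (G0 b) h" if "h \<in> Hom C a (G0 b)" for h
    proof -
      have h: "MMap F a (G0 b) h \<in> Hom D (OMap F a) (\<Phi> b)"
        using Fm[OF a G0[OF b] that] by (simp add: \<Phi>_def)
      show ?thesis unfolding K_def
        by (simp add: category_assoc[OF D Fo[OF a] \<Phi>[OF b] b \<Phi>[OF b] h eh[OF b] e'[OF b]]
            e'e[OF b] category_ident_left[OF D Fo[OF a] \<Phi>[OF b] h])
    qed
    then show "MMap F a (G0 b) g = MMap F a (G0 b) g'" using g eq by metis
  qed
  have Ksurj: "\<exists>g \<in> Hom C a (G0 b). K a b g = h"
    if a: "a \<in> Obj C" and b: "b \<in> Obj D" and h: "h \<in> Hom D (OMap F a) b" for a b h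
  proof -
    obtain g where g: "g \<in> Hom C a (G0 b)"
      "MMap F a (G0 b) g = Comp D (OMap F a) b (\<Phi> b) (e' b) h"
      using surj[OF a G0[OF b], of "Comp D (OMap F a) b (\<Phi> b) (e' b) h"]
        cD[OF Fo[OF a] b \<Phi>[OF b] h e'[OF b]] unfolding \<Phi>_def by blast
    then have "K a b g = h" unfolding K_def
      by (simp add: category_assoc[OF D Fo[OF a] b \<Phi>[OF b] b h e'[OF b] eh[OF b]]
            ee'[OF b] category_ident_left[OF D Fo[OF a] b h])
    then show ?thesis using g by blast
  qed
  have Kcomp: "K a c (Comp C a b (G0 c) g f) = Comp D (OMap F a) (OMap F b) c (K b c g) (MMap F a b f)"
    if a: "a \<in> Obj C" and b: "b \<in> Obj C" and c: "c \<in> Obj D" and f: "f \<in> Hom C a b"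
      and g: "g \<in> Hom C b (G0 c)" for a b c f g
  proof -
    have g': "MMap F b (G0 c) g \<in> Hom D (OMap F b) (\<Phi> c)"
      using Fm[OF b G0[OF c] g] by (simp add: \<Phi>_def)
    show ?thesis unfolding K_def
      by (simp add: Fc[OF a b G0[OF c] f g] \<Phi>_def[symmetric]
        category_assoc[OF D Fo[OF a] Fo[OF b] \<Phi>[OF c] c Fm[OF a b f] g' eh[OF c]])
  qed
  define Gm where "Gm b c f = (SOME g. g \<in> Hom C (G0 b) (G0 c) \<and> K (G0 b) c g = Comp D (\<Phi> b) b c f (e b))"
    for b c f
  have Gm: "Gm b c f \<in> Hom C (G0 b) (G0 c)" "K (G0 b) c (Gm b c f) = Comp D (\<Phi> b) b c f (e b)"
    if "b \<in> Obj D" "c \<in> Obj D" "f \<in> Hom D b c" for b c f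
  proof -
    have "\<exists>g. g \<in> Hom C (G0 b) (G0 c) \<and> K (G0 b) c g = Comp D (\<Phi> b) b c f (e b)"
      using Ksurj[OF G0[OF that(1)] that(2), of "Comp D (\<Phi> b) b c f (e b)"]
        cD[OF \<Phi>[OF that(1)] that(1,2) eh[OF that(1)] that(3)] unfolding \<Phi>_def by blast
    from someI_ex[OF this] show "Gm b c f \<in> Hom C (G0 b) (G0 c)"
      "K (G0 b) c (Gm b c f) = Comp D (\<Phi> b) b c f (e b)"
      unfolding Gm_def by blast+
  qed
  define G where "G = \<lparr>OMap = G0, MMap = Gm\<rparr>"
  have GF: "is_functor D C G"
    unfolding is_functor_def
  proof (intro conjI ballI)
    fix a assume a: "a \<in> Obj D"
    have 1: "K (G0 a) a (Ident C (G0 a)) = e a" unfolding K_def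
      using category_ident_right[OF D \<Phi>[OF a] a eh[OF a]] Fi[OF G0[OF a]] by (simp add: \<Phi>_def)
    have 2: "K (G0 a) a (Gm a a (Ident D a)) = e a"
      using Gm(2)[OF a a iD[OF a]] category_ident_left[OF D \<Phi>[OF a] a eh[OF a]] by simp
    show "MMap G a a (Ident D a) = Ident C (OMap G a)"
      using Kinj[OF G0[OF a] a Gm(1)[OF a a iD[OF a]] iC[OF G0[OF a]]] 1 2 by (simp add: G_def)
  next
    fix a b c f g
    assume o: "a \<in> Obj D" "b \<in> Obj D" "c \<in> Obj D" and f: "f \<in> Hom D a b" and g: "g \<in> Hom D b c"
    note gf = cD[OF o f g]
    note m = Gm(1)[OF o(1,2) f] Gm(1)[OF o(2,3) g]
    have m': "MMap F (G0 a) (G0 b) (Gm a b f) \<in> Hom D (\<Phi> a) (\<Phi> b)"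
      using Fm[OF G0[OF o(1)] G0[OF o(2)] m(1)] by (simp add: \<Phi>_def)
    have "K (G0 a) c (Comp C (G0 a) (G0 b) (G0 c) (Gm b c g) (Gm a b f))
        = Comp D (\<Phi> a) (\<Phi> b) c (Comp D (\<Phi> b) b c g (e b)) (MMap F (G0 a) (G0 b) (Gm a b f))"
      by (simp add: Kcomp[OF G0[OF o(1)] G0[OF o(2)] o(3) m] Gm(2)[OF o(2,3) g] \<Phi>_def[symmetric])
    also have "\<dots> = Comp D (\<Phi> a) b c g (K (G0 a) b (Gm a b f))"
      by (simp add: K_def \<Phi>_def[symmetric]
        category_assoc[OF D \<Phi>[OF o(1)] \<Phi>[OF o(2)] o(2,3) m' eh[OF o(2)] g])
    also have "\<dots> = Comp D (\<Phi> a) a c (Comp D a b c g f) (e a)"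
      by (simp add: Gm(2)[OF o(1,2) f] category_assoc[OF D \<Phi>[OF o(1)] o eh[OF o(1)] f g])
    also have "\<dots> = K (G0 a) c (Gm a c (Comp D a b c g f))"
      by (simp add: Gm(2)[OF o(1,3) gf])
    finally show "MMap G a c (Comp D a b c g f) =
        Comp C (OMap G a) (OMap G b) (OMap G c) (MMap G b c g) (MMap G a b f)"
      using Kinj[OF G0[OF o(1)] o(3) Gm(1)[OF o(1,3) gf]
        cC[OF G0[OF o(1)] G0[OF o(2)] G0[OF o(3)] m]] by (simp add: G_def)
  qed (use C D G0 Gm(1) in \<open>auto simp: G_def\<close>)
  \<comment> \<open>The preimage of the inverse of \<open>e (OMap F a)\<close> is the morphism whose
    transpose is the identity, that is, the unit of the adjunction.\<close>
  define \<eta> where "\<eta> a = (SOME g. g \<in> Hom C a (G0 (OMap F a)) \<and> MMap F a (G0 (OMap F a)) g = e' (OMap F a))"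
    for a
  have \<eta>: "\<eta> a \<in> Hom C a (G0 (OMap F a))" "MMap F a (G0 (OMap F a)) (\<eta> a) = e' (OMap F a)"
    if "a \<in> Obj C" for a
  proof -
    have "\<exists>g. g \<in> Hom C a (G0 (OMap F a)) \<and> MMap F a (G0 (OMap F a)) g = e' (OMap F a)"
      using surj[OF that G0[OF Fo[OF that]], of "e' (OMap F a)"] e'[OF Fo[OF that]] unfolding \<Phi>_def by blast
    from someI_ex[OF this] show "\<eta> a \<in> Hom C a (G0 (OMap F a))"
      "MMap F a (G0 (OMap F a)) (\<eta> a) = e' (OMap F a)"
      unfolding \<eta>_def by blast+
  qed
  have idC: "is_functor C C id_functor" and idD: "is_functor D D id_functor"
    using C D by (auto simp: is_functor_def id_functor_def)
  have comp: "is_functor A A (comp_functor S R)" if "is_functor A B R" "is_functor B A S"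
    for A :: "('x, 'y) category" and B :: "('z, 'w) category" and R S
    using that by (auto simp: is_functor_def comp_functor_def)
  have nat\<eta>: "is_natural_iso C C id_functor (comp_functor G F) \<eta>"
    unfolding is_natural_iso_def
  proof (intro conjI ballI idC comp[OF F GF])
    fix a assume a: "a \<in> Obj C"
    note fa = Fo[OF a]
    note ga = G0[OF fa]
    \<comment> \<open>The inverse of \<open>\<eta> a\<close> is the preimage of
      \<open>e (OMap F a)\<close>; both composites are identities after applying \<open>F\<close>,
      which is injective on hom-sets.\<close>
    obtain \<theta> where \<theta>: "\<theta> \<in> Hom C (G0 (OMap F a)) a" "MMap F (G0 (OMap F a)) a \<theta> = e (OMap F a)"
      using surj[OF ga a, of "e (OMap F a)"] eh[OF fa] unfolding \<Phi>_def by blast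
    have "Comp C a (G0 (OMap F a)) a \<theta> (\<eta> a) = Ident C a"
      by (rule inj[OF a a cC[OF a ga a \<eta>(1)[OF a] \<theta>(1)] iC[OF a]])
        (simp add: Fc[OF a ga a \<eta>(1)[OF a] \<theta>(1)] \<theta>(2) \<eta>(2)[OF a] \<Phi>_def[symmetric] ee'[OF fa] Fi[OF a])
    moreover have "Comp C (G0 (OMap F a)) a (G0 (OMap F a)) (\<eta> a) \<theta> = Ident C (G0 (OMap F a))"
      by (rule inj[OF ga ga cC[OF ga a ga \<theta>(1) \<eta>(1)[OF a]] iC[OF ga]])
        (simp add: Fc[OF ga a ga \<theta>(1) \<eta>(1)[OF a]] \<theta>(2) \<eta>(2)[OF a] \<Phi>_def[symmetric] e'e[OF fa]
          Fi[OF ga])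
    ultimately show "is_iso C (OMap id_functor a) (OMap (comp_functor G F) a) (\<eta> a)"
      using \<eta>(1)[OF a] \<theta>(1) unfolding is_iso_def id_functor_def comp_functor_def G_def by auto
  next
    fix a b f assume a: "a \<in> Obj C" and b: "b \<in> Obj C" and f: "f \<in> Hom C a b"
    note fa = Fo[OF a] and fb = Fo[OF b] and ff' = Fm[OF a b f]
    note ga = G0[OF fa] and gb = G0[OF fb]
    note gf = Gm[OF fa fb ff']
    have K\<eta>: "K c (OMap F c) (\<eta> c) = Ident D (OMap F c)" if "c \<in> Obj C" for c
      unfolding K_def using \<eta>(2)[OF that] ee'[OF Fo[OF that]] by simp
    have "K a (OMap F b) (Comp C a b (G0 (OMap F b)) (\<eta> b) f) = MMap F a b f"
      by (simp add: Kcomp[OF a b fb f \<eta>(1)[OF b]] K\<eta>[OF b] category_ident_left[OF D fa fb ff'])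
    moreover have "K a (OMap F b) (Comp C a (G0 (OMap F a)) (G0 (OMap F b))
        (Gm (OMap F a) (OMap F b) (MMap F a b f)) (\<eta> a)) = MMap F a b f"
      by (simp add: Kcomp[OF a ga fb \<eta>(1)[OF a] gf(1)] gf(2) \<eta>(2)[OF a] \<Phi>_def[symmetric]
        category_assoc[OF D fa \<Phi>[OF fa] fa fb e'[OF fa] eh[OF fa] ff', symmetric]
        ee'[OF fa] category_ident_right[OF D fa fb ff'])
    ultimately have "Comp C a b (G0 (OMap F b)) (\<eta> b) f = Comp C a (G0 (OMap F a)) (G0 (OMap F b))
        (Gm (OMap F a) (OMap F b) (MMap F a b f)) (\<eta> a)"
      using Kinj[OF a fb cC[OF a b gb f \<eta>(1)[OF b]] cC[OF a ga gb \<eta>(1)[OF a] gf(1)]] by simp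
    then show "Comp C (OMap id_functor a) (OMap id_functor b) (OMap (comp_functor G F) b) (\<eta> b)
        (MMap id_functor a b f) =
      Comp C (OMap id_functor a) (OMap (comp_functor G F) a) (OMap (comp_functor G F) b)
        (MMap (comp_functor G F) a b f) (\<eta> a)"
      by (simp add: id_functor_def comp_functor_def G_def)
  qed
  have "is_natural_iso D D (comp_functor F G) id_functor e"
    unfolding is_natural_iso_def
  proof (intro conjI ballI idD comp[OF GF F])
    fix a b f assume "a \<in> Obj D" "b \<in> Obj D" "f \<in> Hom D a b"
    from Gm(2)[OF this] show "Comp D (OMap (comp_functor F G) a) (OMap (comp_functor F G) b) (OMap id_functor b)
        (e b) (MMap (comp_functor F G) a b f) =
      Comp D (OMap (comp_functor F G) a) (OMap id_functor a) (OMap id_functor b)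
        (MMap id_functor a b f) (e a)"
      by (simp add: id_functor_def comp_functor_def G_def K_def \<Phi>_def)
  qed (use e in \<open>auto simp: id_functor_def comp_functor_def G_def\<close>)
  with F GF nat\<eta> have "is_equivalence C D F G \<eta> e" by (simp add: is_equivalence_def)
  then show ?thesis by (intro exI[of _ G] exI[of _ \<eta>]) (simp add: G_def)
qed

lemma is_category_full_subcategory: "is_category C \<Longrightarrow> is_category (full_subcategory C P)"
  unfolding is_category_def full_subcategory_def by simp

lemma is_functor_full_subcategory:
  assumes "is_functor C D F" "\<And>a. a \<in> Obj C \<Longrightarrow> P a \<Longrightarrow> Q (OMap F a)"
  shows "is_functor (full_subcategory C P) (full_subcategory D Q) F"
  using assms is_category_full_subcategory[of C P] is_category_full_subcategory[of D Q]
  unfolding is_functor_def by (auto simp: full_subcategory_def)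

lemma is_natural_iso_full_subcategory:
  assumes "is_natural_iso C D F G \<tau>" "\<And>a. a \<in> Obj C \<Longrightarrow> P a \<Longrightarrow> Q (OMap F a)"
    "\<And>a. a \<in> Obj C \<Longrightarrow> P a \<Longrightarrow> Q (OMap G a)"
  shows "is_natural_iso (full_subcategory C P) (full_subcategory D Q) F G \<tau>"
  using assms is_functor_full_subcategory[of C D F P Q] is_functor_full_subcategory[of C D G P Q]
  unfolding is_natural_iso_def by (auto simp: full_subcategory_def is_iso_def)

text \<open>Fullness keeps all hom-sets, so the components of the natural isomorphisms and their
  inverses survive; the object maps only have to respect the two predicates.\<close>

lemma is_equivalence_full_subcategory:
  assumes eq: "is_equivalence C D F G \<eta> \<epsilon>"
    and P: "\<And>a. a \<in> Obj C \<Longrightarrow> P a \<Longrightarrow> Q (OMap F a)"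
    and Q: "\<And>b. b \<in> Obj D \<Longrightarrow> Q b \<Longrightarrow> P (OMap G b)"
  shows "is_equivalence (full_subcategory C P) (full_subcategory D Q) F G \<eta> \<epsilon>"
proof -
  have "OMap F a \<in> Obj D" if "a \<in> Obj C" for a
    using eq that by (auto simp: is_equivalence_def is_functor_def)
  moreover have "OMap G b \<in> Obj C" if "b \<in> Obj D" for b
    using eq that by (auto simp: is_equivalence_def is_functor_def)
  ultimately show ?thesis
    using eq P Q unfolding is_equivalence_def
    by (auto intro!: is_functor_full_subcategory is_natural_iso_full_subcategory
        simp: id_functor_def comp_functor_def)
qed

section \<open>Order unit spaces and their unit intervals\<close>

lemma cring_real_scalars: "cring real_scalars"
proof (rule cringI)
  show "abelian_group real_scalars"
  proof (rule abelian_groupI)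
    fix x :: real
    show "\<exists>y \<in> carrier real_scalars. y \<oplus>\<^bsub>real_scalars\<^esub> x = \<zero>\<^bsub>real_scalars\<^esub>"
      by (rule bexI[of _ "- x"]) (simp_all add: real_scalars_def)
  qed (simp_all add: real_scalars_def)
  show "comm_monoid real_scalars"
    by (rule comm_monoidI) (auto simp: real_scalars_def)
qed (simp add: real_scalars_def distrib_right)

locale ous =
  fixes V :: "'a ordered_space" (structure)
  assumes ous: "order_unit_space V"
begin

sublocale module real_scalars V
  using ous unfolding order_unit_space_def by (elim conjE)

notation leq (infix \<open>\<preceq>\<index>\<close> 50)

abbreviation u where "u \<equiv> unit V"

lemma leq_refl [simp]:
  "x \<in> carrier V \<Longrightarrow> x \<preceq> x"
  by (rule ous[unfolded order_unit_space_def, THEN conjunct2, THEN conjunct1, rule_format])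

lemma leq_antisym:
  "x \<preceq> y \<Longrightarrow> y \<preceq> x \<Longrightarrow> x \<in> carrier V \<Longrightarrow> y \<in> carrier V \<Longrightarrow> x = y"
  by (rule ous[unfolded order_unit_space_def, THEN conjunct2, THEN conjunct2, THEN conjunct1, rule_format])

lemma leq_trans:
  "x \<preceq> y \<Longrightarrow> y \<preceq> z \<Longrightarrow> x \<in> carrier V \<Longrightarrow> y \<in> carrier V \<Longrightarrow> z \<in> carrier V \<Longrightarrow> x \<preceq> z"
  by (rule ous[unfolded order_unit_space_def, THEN conjunct2, THEN conjunct2, THEN conjunct2, THEN conjunct1, rule_format])

lemma add_mono_left:
  "x \<preceq> y \<Longrightarrow> x \<in> carrier V \<Longrightarrow> y \<in> carrier V \<Longrightarrow> z \<in> carrier V \<Longrightarrow> x \<oplus> z \<preceq> y \<oplus> z"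
  by (rule ous[unfolded order_unit_space_def, THEN conjunct2, THEN conjunct2, THEN conjunct2, THEN conjunct2, THEN conjunct1, rule_format])

lemma smult_mono:
  "x \<preceq> y \<Longrightarrow> 0 \<le> r \<Longrightarrow> x \<in> carrier V \<Longrightarrow> y \<in> carrier V \<Longrightarrow> r \<odot> x \<preceq> r \<odot> y"
  by (rule ous[unfolded order_unit_space_def, THEN conjunct2, THEN conjunct2, THEN conjunct2, THEN conjunct2, THEN conjunct2, THEN conjunct1, rule_format])

lemma unit_closed [simp, intro]:
  "u \<in> carrier V"
  by (rule ous[unfolded order_unit_space_def, THEN conjunct2, THEN conjunct2, THEN conjunct2, THEN conjunct2, THEN conjunct2, THEN conjunct2, THEN conjunct1, rule_format])

lemma unit_pos:
  "\<zero> \<preceq> u"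
  by (rule ous[unfolded order_unit_space_def, THEN conjunct2, THEN conjunct2, THEN conjunct2, THEN conjunct2, THEN conjunct2, THEN conjunct2, THEN conjunct2, THEN conjunct1, rule_format])

lemma strong_unit:
  "x \<in> carrier V \<Longrightarrow> \<exists>n::nat. x \<preceq> real n \<odot> u"
  by (rule ous[unfolded order_unit_space_def, THEN conjunct2, THEN conjunct2, THEN conjunct2, THEN conjunct2, THEN conjunct2, THEN conjunct2, THEN conjunct2, THEN conjunct2, THEN conjunct1, rule_format])

lemma archimedean:
  "x \<in> carrier V \<Longrightarrow> (\<And>r. r > 0 \<Longrightarrow> x \<preceq> r \<odot> u) \<Longrightarrow> x \<preceq> \<zero>"
  by (rule ous[unfolded order_unit_space_def, THEN conjunct2, THEN conjunct2, THEN conjunct2, THEN conjunct2, THEN conjunct2, THEN conjunct2, THEN conjunct2, THEN conjunct2, THEN conjunct2, rule_format])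

lemma scale_closed [simp, intro]: "x \<in> carrier V \<Longrightarrow> r \<odot> x \<in> carrier V"
  by (simp add: real_scalars_def)

end

text \<open>Writing vectors through an opaque coordinate map \<open>K\<close> lets the simplifier reduce linear
  identities and inequalities to arithmetic of real coefficients.\<close>

locale coords = ous +
  fixes v w z :: 'a and K :: "real \<Rightarrow> real \<Rightarrow> real \<Rightarrow> real \<Rightarrow> 'a"
  assumes K: "v = K 1 0 0 0" "w = K 0 1 0 0" "z = K 0 0 1 0" "u = K 0 0 0 1" "\<zero> = K 0 0 0 0"
    "K a b c d \<in> carrier V"
    "K a b c d \<oplus> K a' b' c' d' = K (a + a') (b + b') (c + c') (d + d')"
    "K a b c d \<ominus> K a' b' c' d' = K (a - a') (b - b') (c - c') (d - d')"
    "\<ominus> (K a b c d) = K (- a) (- b) (- c) (- d)"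
    "r \<odot> K a b c d = K (r * a) (r * b) (r * c) (r * d)"

context ous
begin

text \<open>\<open>K a b c d\<close> is the combination of \<open>v\<close>, \<open>w\<close>,
  \<open>z\<close> and \<open>u\<close>. The vectors may be dependent, since only the passage from
  equal coefficients to equal vectors is used. A caller with fewer vectors repeats one and drops the
  corresponding equations, lest one vector be rewritten to two different coordinate forms.\<close>

lemma ex_coords:
  assumes v: "v \<in> carrier V" and w: "w \<in> carrier V" and z: "z \<in> carrier V"
  obtains K where "coords V v w z K"
proof -
  define K where "K a b c d = a \<odot> v \<oplus> (b \<odot> w \<oplus> (c \<odot> z \<oplus> d \<odot> u))" for a b c d
  have d: "(a + b) \<odot> x = a \<odot> x \<oplus> b \<odot> x" if "x \<in> carrier V" for a b x
    using smult_l_distr[of a b x] that by (simp add: real_scalars_def)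
  have m: "a \<odot> (b \<odot> x) = (a * b) \<odot> x" if "x \<in> carrier V" for a b x
    using smult_assoc1[of a b x] that by (simp add: real_scalars_def)
  have r: "a \<odot> (x \<oplus> y) = a \<odot> x \<oplus> a \<odot> y" if "x \<in> carrier V" "y \<in> carrier V" for a x y
    using smult_r_distr[of a x y] that by (simp add: real_scalars_def)
  have one: "1 \<odot> x = x" if "x \<in> carrier V" for x
    using smult_one[of x] that by (simp add: real_scalars_def)
  have null: "0 \<odot> x = \<zero>" if "x \<in> carrier V" for x
    using smult_l_null[of x] that by (simp add: real_scalars_def)
  have cl: "K a b c d \<in> carrier V" for a b c d
    unfolding K_def using v w z by simp
  have add: "K a b c d \<oplus> K a' b' c' d' = K (a + a') (b + b') (c + c') (d + d')" for a b c d a' b' c' d'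
    unfolding K_def using v w z by (simp add: d a_ac)
  have sm: "r' \<odot> K a b c d = K (r' * a) (r' * b) (r' * c) (r' * d)" for r' a b c d
    unfolding K_def using v w z by (simp add: m r)
  have K0: "\<zero> = K 0 0 0 0" unfolding K_def using v w z by (simp add: null)
  have neg: "\<ominus> (K a b c d) = K (- a) (- b) (- c) (- d)" for a b c d
    by (rule minus_equality) (use cl in \<open>simp_all add: add K0\<close>)
  have sub: "K a b c d \<ominus> K a' b' c' d' = K (a - a') (b - b') (c - c') (d - d')" for a b c d a' b' c' d'
    by (simp add: a_minus_def neg add)
  have "v = K 1 0 0 0" "w = K 0 1 0 0" "z = K 0 0 1 0" "u = K 0 0 0 1"
    unfolding K_def using v w z by (simp_all add: one null)
  then have "coords V v w z K" 
    by unfold_locales (assumption | rule K0 cl add sub neg sm)+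
  then show ?thesis by (rule that)
qed

lemma leq_iff_diff: 
  assumes v: "v \<in> carrier V" and w: "w \<in> carrier V"
  shows "v \<preceq> w \<longleftrightarrow> \<zero> \<preceq> w \<ominus> v"
proof
  obtain K where "coords V v w u K" by (rule ex_coords[OF v w unit_closed])
  note K = coords.K[OF this]
  show "\<zero> \<preceq> w \<ominus> v" if "v \<preceq> w"
    using add_mono_left[OF that v w, of "\<ominus> v"] by (simp add: K(1,2,4-10))
  show "v \<preceq> w" if "\<zero> \<preceq> w \<ominus> v"
    using add_mono_left[OF that, of v] by (simp add: K(1,2,4-10))
qed

text \<open>The order is determined by the positive cone, which is stable under \<open>r\<close> and
  under \<open>1 / r\<close>. Later translations and rescalings of inequalities are instances, with
  the two differences compared in coordinates.\<close>

lemma leq_iff_scaled_diff: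
  assumes c: "x \<in> carrier V" "y \<in> carrier V" "x' \<in> carrier V" "y' \<in> carrier V"
    and r: "0 < r" "y' \<ominus> x' = r \<odot> (y \<ominus> x)"
  shows "x' \<preceq> y' \<longleftrightarrow> x \<preceq> y"
proof -
  obtain K where "coords V x y u K" by (rule ex_coords[OF c(1,2) unit_closed])
  note K = coords.K[OF this]
  have inv: "(1 / r) \<odot> (y' \<ominus> x') = y \<ominus> x" "r \<odot> \<zero> = \<zero>" "(1 / r) \<odot> \<zero> = \<zero>"
    using r(1) by (simp_all add: r(2) K(1,2,5-10))
  have "\<zero> \<preceq> y' \<ominus> x' \<longleftrightarrow> \<zero> \<preceq> y \<ominus> x"
  proof
    assume "\<zero> \<preceq> y \<ominus> x"
    from smult_mono[OF this, of r] c r inv show "\<zero> \<preceq> y' \<ominus> x'" by simp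
  next
    assume "\<zero> \<preceq> y' \<ominus> x'"
    from smult_mono[OF this, of "1/r"] c r(1) inv show "\<zero> \<preceq> y \<ominus> x" by simp
  qed
  with leq_iff_diff c show ?thesis by simp
qed

lemma leq_iff_same_diff:
  assumes c: "x \<in> carrier V" "y \<in> carrier V" "x' \<in> carrier V" "y' \<in> carrier V"
    and eq: "y' \<ominus> x' = y \<ominus> x"
  shows "x' \<preceq> y' \<longleftrightarrow> x \<preceq> y"
proof (rule leq_iff_scaled_diff[OF c])
  show "y' \<ominus> x' = 1 \<odot> (y \<ominus> x)"
    using assms smult_one[of "y \<ominus> x"] by (simp add: real_scalars_def)
qed simp

lemma add_mono:
  assumes "x \<preceq> y" "x' \<preceq> y'"
    and c: "x \<in> carrier V" "y \<in> carrier V" "x' \<in> carrier V" "y' \<in> carrier V"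
  shows "x \<oplus> x' \<preceq> y \<oplus> y'"
proof (rule leq_trans)
  show "x \<oplus> x' \<preceq> y \<oplus> x'" using assms by (simp add: add_mono_left)
  show "y \<oplus> x' \<preceq> y \<oplus> y'"
    using add_mono_left[OF assms(2) c(3,4,2)] c by (simp add: a_comm)
qed (use c in auto)

lemma scaled_unit_mono: "r \<le> s \<Longrightarrow> r \<odot> u \<preceq> s \<odot> u"
proof -
  assume rs: "r \<le> s"
  obtain K where "coords V u u u K" by (rule ex_coords[of u u u]) auto
  note K = coords.K[OF this]
  have "\<zero> \<preceq> (s - r) \<odot> u"
    using smult_mono[OF unit_pos, of "s - r"] rs by (simp add: K(4-10))
  then show ?thesis
    by (subst leq_iff_diff) (auto simp: K(4-10))
qed

section \<open>The unit interval as an Archimedean effect module\<close>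

lemma carrier_unit_interval:
  "x \<in> carrier (unit_interval V) \<longleftrightarrow> x \<in> carrier V \<and> \<zero> \<preceq> x \<and> x \<preceq> u"
  by (auto simp: unit_interval_def)

lemma osum_unit_interval:
  "osum (unit_interval V) x y = (if x \<oplus> y \<preceq> u then Some (x \<oplus> y) else None)"
  and escale_unit_interval: "escale (unit_interval V) r x = r \<odot> x"
  and ezero_unit_interval: "ezero (unit_interval V) = \<zero>"
  and ortho_unit_interval: "ortho (unit_interval V) x = u \<ominus> x"
  by (simp_all add: unit_interval_def)

lemma eone_unit_interval: "eone (unit_interval V) = u"
  by (simp add: eone_def unit_interval_def a_minus_def)

lemmas unit_interval_simps =
  carrier_unit_interval osum_unit_interval escale_unit_interval ezero_unit_interval
  ortho_unit_interval eone_unit_interval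

lemma add_leqD: "a \<oplus> z \<preceq> b \<Longrightarrow> \<zero> \<preceq> z \<Longrightarrow> a \<in> carrier V \<Longrightarrow> z \<in> carrier V \<Longrightarrow> b \<in> carrier V \<Longrightarrow> a \<preceq> b"
  using add_mono[of a a \<zero> z] leq_trans[of a "a \<oplus> z" b] by simp

text \<open>The upper bound passes through \<open>x\<close> itself: \<open>x\<close> minus its
  \<open>r\<close>-multiple is the positive vector \<open>(1 - r) \<odot> x\<close>.\<close>

lemma unit_interval_scale:
  assumes "x \<in> carrier (unit_interval V)" "0 \<le> r" "r \<le> 1"
  shows "r \<odot> x \<in> carrier (unit_interval V)"
proof -
  have x: "x \<in> carrier V" "\<zero> \<preceq> x" "x \<preceq> u" using assms by (auto simp: carrier_unit_interval)
  obtain K where "coords V x x x K" by (rule ex_coords[of x x x]) (use x in auto)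
  note K = coords.K[OF this]
  have "\<zero> \<preceq> r \<odot> x" "\<zero> \<preceq> (1 - r) \<odot> x"
    using smult_mono[OF x(2), of r] smult_mono[OF x(2), of "1 - r"] x assms
    by (simp_all add: K(1,5-10))
  then have "r \<odot> x \<preceq> x" using x by (subst leq_iff_diff) (auto simp: K(1,5-10))
  then have "r \<odot> x \<preceq> u" using leq_trans[OF _ x(3)] x by auto
  with \<open>\<zero> \<preceq> r \<odot> x\<close> x show ?thesis by (auto simp: carrier_unit_interval)
qed

lemma unit_interval_ele:
  assumes "x \<in> carrier (unit_interval V)" "y \<in> carrier (unit_interval V)"
  shows "ele (unit_interval V) x y \<longleftrightarrow> x \<preceq> y"
proof -
  have x: "x \<in> carrier V" "\<zero> \<preceq> x" "x \<preceq> u" and y: "y \<in> carrier V" "\<zero> \<preceq> y" "y \<preceq> u"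
    using assms by (auto simp: carrier_unit_interval)
  obtain K where "coords V x y u K" by (rule ex_coords[of x y u]) (use x y in auto)
  note K = coords.K[OF this]
  show ?thesis
  proof
    assume "ele (unit_interval V) x y"
    then obtain z where "z \<in> carrier V" "\<zero> \<preceq> z" "x \<oplus> z = y"
      by (auto simp: ele_def unit_interval_simps split: if_splits)
    then show "x \<preceq> y" using add_mono[of x x \<zero> z] x by simp
  next
    assume "x \<preceq> y"
    then have "\<zero> \<preceq> y \<ominus> x" using leq_iff_diff x y by simp
    moreover have "x \<oplus> (y \<ominus> x) = y" by (simp add: K(1,2,5-10))
    \<comment> \<open>The witness stays in the interval: as \<open>x\<close> is positive, the
      difference is at most \<open>y\<close>.\<close>
    moreover have "y \<ominus> x \<preceq> u"
      using add_leqD[of "y \<ominus> x" x u] x y calculation by (simp add: a_comm)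
    ultimately show "ele (unit_interval V) x y" unfolding ele_def
      using x y by (intro bexI[of _ "y \<ominus> x"]) (auto simp: unit_interval_simps)
  qed
qed

lemma effect_algebra_unit_interval: "effect_algebra (unit_interval V)"
  unfolding effect_algebra_def
proof (intro conjI ballI allI impI)
  fix x y z assume x: "x \<in> carrier (unit_interval V)" and y: "y \<in> carrier (unit_interval V)"
    and z: "z \<in> carrier (unit_interval V)"
  \<comment> \<open>A partial sum of positive vectors is below the full sum, so either bracketing is
    defined exactly when the sum of all three is at most \<open>u\<close>.\<close>
  have *: "a \<oplus> b \<preceq> u" if "a \<oplus> b \<oplus> c \<preceq> u" "a \<in> carrier V" "b \<in> carrier V" "c \<in> carrier V" "\<zero> \<preceq> c" for a b c
    using add_leqD[of "a \<oplus> b" c u] that by simp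
  show "Option.bind (osum (unit_interval V) x y) (\<lambda>s. osum (unit_interval V) s z) =
      Option.bind (osum (unit_interval V) y z) (osum (unit_interval V) x)"
    using x y z *[of x y z] *[of y z x] by (auto simp: unit_interval_simps a_ac)
next
  fix x y z assume x: "x \<in> carrier (unit_interval V)" and y: "y \<in> carrier (unit_interval V)"
    and "osum (unit_interval V) x y = Some z"
  then show "z \<in> carrier (unit_interval V)"
    using add_mono[of \<zero> x \<zero> y] by (auto simp: unit_interval_simps split: if_splits)
next
  fix x assume "x \<in> carrier (unit_interval V)"
  then have x: "x \<in> carrier V" "\<zero> \<preceq> x" "x \<preceq> u" by (auto simp: carrier_unit_interval)
  obtain K where "coords V x x u K" by (rule ex_coords[of x x u]) (use x in auto)
  note K = coords.K[OF this]
  have d: "\<zero> \<preceq> u \<ominus> x" using leq_iff_diff x by simp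
  moreover have "u \<ominus> x \<preceq> u"
    using x leq_iff_same_diff[of \<zero> x "u \<ominus> x" u] by (simp add: K(1,4-10))
  ultimately show "ortho (unit_interval V) x \<in> carrier (unit_interval V)"
    using x by (auto simp: unit_interval_simps)
  fix y assume "y \<in> carrier (unit_interval V)"
  then have y: "y \<in> carrier V" by (auto simp: carrier_unit_interval)
  have "x \<oplus> y = u \<longleftrightarrow> y = u \<ominus> x"
  proof
    obtain K where "coords V x y u K" by (rule ex_coords[of x y u]) (use x y in auto)
    note K = coords.K[OF this]
    assume "x \<oplus> y = u"
    then have "u \<ominus> x = (x \<oplus> y) \<ominus> x" by simp
    also have "\<dots> = y" by (simp add: K(1,2,5-10))
    finally show "y = u \<ominus> x" ..
  qed (simp add: K(1,4-10))
  then show "(osum (unit_interval V) x y = Some (eone (unit_interval V))) = (y = ortho (unit_interval V) x)"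
    by (auto simp: unit_interval_simps)
next
  fix x assume "x \<in> carrier (unit_interval V)"
  then have x: "x \<in> carrier V" "\<zero> \<preceq> x" "x \<preceq> u" by (auto simp: carrier_unit_interval)
  obtain K where "coords V x x u K" by (rule ex_coords[of x x u]) (use x in auto)
  note K = coords.K[OF this]
  assume "osum (unit_interval V) x (eone (unit_interval V)) \<noteq> None"
  then have "x \<oplus> u \<preceq> u" by (auto simp: unit_interval_simps split: if_splits)
  then have "x \<preceq> \<zero>" using leq_iff_same_diff[of x \<zero> "x \<oplus> u" u] x by (simp add: K(1,4-10))
  then show "x = ezero (unit_interval V)"
    using leq_antisym x by (simp add: unit_interval_simps)
qed (auto simp: unit_interval_simps a_comm unit_pos)

lemma effect_module_unit_interval: "effect_module (unit_interval V)"
  unfolding effect_module_def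
proof (intro conjI ballI allI impI effect_algebra_unit_interval)
  fix r s x assume r: "r \<in> {0..1::real}" "s \<in> {0..1::real}" and "x \<in> carrier (unit_interval V)"
  then have x: "x \<in> carrier V" "\<zero> \<preceq> x" "x \<preceq> u" by (auto simp: carrier_unit_interval)
  obtain K where "coords V x x x K" by (rule ex_coords[of x x x]) (use x in auto)
  note K = coords.K[OF this]
  show "escale (unit_interval V) (r * s) x = escale (unit_interval V) r (escale (unit_interval V) s x)"
    by (simp add: unit_interval_simps K(1,5-10))
  assume "r + s \<le> 1"
  then have "(r + s) \<odot> x \<in> carrier (unit_interval V)"
    using unit_interval_scale[of x "r + s"] \<open>x \<in> carrier (unit_interval V)\<close> r by simp
  moreover have "r \<odot> x \<oplus> s \<odot> x = (r + s) \<odot> x" by (simp add: K(1,5-10))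
  ultimately show "osum (unit_interval V) (escale (unit_interval V) r x) (escale (unit_interval V) s x) =
      Some (escale (unit_interval V) (r + s) x)"
    by (simp add: unit_interval_simps)
next
  fix r x y z assume r: "r \<in> {0..1::real}" and x: "x \<in> carrier (unit_interval V)"
    and y: "y \<in> carrier (unit_interval V)" and z: "osum (unit_interval V) x y = Some z"
  have "z \<in> carrier (unit_interval V)"
    using effect_algebra_unit_interval x y z unfolding effect_algebra_def by blast
  then have "r \<odot> z \<in> carrier (unit_interval V)" using unit_interval_scale r by simp
  moreover have "z = x \<oplus> y" using z by (simp add: unit_interval_simps split: if_splits)
  moreover have "r \<odot> (x \<oplus> y) = r \<odot> x \<oplus> r \<odot> y"
    using smult_r_distr[of r x y] x y by (simp add: real_scalars_def carrier_unit_interval)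
  ultimately show "osum (unit_interval V) (escale (unit_interval V) r x) (escale (unit_interval V) r y) =
      Some (escale (unit_interval V) r z)"
    by (auto simp: unit_interval_simps)
next
  fix x assume "x \<in> carrier (unit_interval V)"
  then show "escale (unit_interval V) 1 x = x"
    using smult_one[of x] by (simp add: real_scalars_def unit_interval_simps)
qed (use unit_interval_scale escale_unit_interval in auto)

text \<open>Both summands on the right of \<open>half_le\<close> are at most half the unit, so their
  sum is always defined; the common factor 1/2 then cancels in the vector space.\<close>

lemma half_le_unit_interval:
  assumes "x \<in> carrier (unit_interval V)" "y \<in> carrier (unit_interval V)" "0 \<le> r" "r \<le> 1"
  shows "half_le (unit_interval V) r x y \<longleftrightarrow> x \<preceq> y \<oplus> r \<odot> u"
proof -
  have x: "x \<in> carrier V" "\<zero> \<preceq> x" "x \<preceq> u" and y: "y \<in> carrier V" "\<zero> \<preceq> y" "y \<preceq> u"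
    using assms by (auto simp: carrier_unit_interval)
  obtain K where "coords V x y u K" by (rule ex_coords[of x y u]) (use x y in auto)
  note K = coords.K[OF this]
  let ?w = "(1/2) \<odot> y \<oplus> (r/2) \<odot> u"
  have hx: "(1/2) \<odot> x \<in> carrier (unit_interval V)" using assms unit_interval_scale by simp
  have hy: "(1/2) \<odot> y \<in> carrier (unit_interval V)" using assms unit_interval_scale by simp
  have "(1/2) \<odot> y \<preceq> (1/2) \<odot> u" using smult_mono y by simp
  moreover have "(r/2) \<odot> u \<preceq> (1/2) \<odot> u" using assms by (intro scaled_unit_mono) simp
  ultimately have "?w \<preceq> (1/2) \<odot> u \<oplus> (1/2) \<odot> u" using y by (intro add_mono) auto
  also have "(1/2) \<odot> u \<oplus> (1/2) \<odot> u = u" by (simp add: K(4-10))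
  finally have w: "?w \<preceq> u" .
  have "\<zero> \<preceq> (r/2) \<odot> u" using scaled_unit_mono[of 0 "r/2"] assms by (simp add: K(4-10))
  then have "\<zero> \<preceq> ?w" using add_mono[of \<zero> "(1/2) \<odot> y" \<zero> "(r/2) \<odot> u"] hy
    by (simp add: carrier_unit_interval)
  then have wc: "?w \<in> carrier (unit_interval V)" using w y by (simp add: carrier_unit_interval)
  have "half_le (unit_interval V) r x y \<longleftrightarrow> (1/2) \<odot> x \<preceq> ?w"
    using w unit_interval_ele[OF hx wc] by (simp add: half_le_def unit_interval_simps)
  also have "\<dots> \<longleftrightarrow> x \<preceq> y \<oplus> r \<odot> u"
    by (rule leq_iff_scaled_diff[where r = "1/2"]) (use x y in \<open>auto simp: K(1,2,4-10)\<close>)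
  finally show ?thesis .
qed

lemma archimedean_unit_interval: "Defs.archimedean (unit_interval V)"
  unfolding archimedean_def
proof (intro ballI impI)
  fix x y assume xy: "x \<in> carrier (unit_interval V)" "y \<in> carrier (unit_interval V)"
    and h: "\<forall>r \<in> {0<..1}. half_le (unit_interval V) r x y"
  then have x: "x \<in> carrier V" "\<zero> \<preceq> x" "x \<preceq> u" and y: "y \<in> carrier V" "\<zero> \<preceq> y" "y \<preceq> u"
    using xy by (auto simp: carrier_unit_interval)
  obtain K where "coords V x y u K" by (rule ex_coords[of x y u]) (use x y in auto)
  note K = coords.K[OF this]
  have *: "x \<ominus> y \<preceq> r \<odot> u" if "0 < r" "r \<le> 1" for r
  proof -
    have "x \<preceq> y \<oplus> r \<odot> u" using h half_le_unit_interval[OF xy, of r] that by auto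
    then show ?thesis using x y leq_iff_same_diff[of x "y \<oplus> r \<odot> u" "x \<ominus> y" "r \<odot> u"]
      by (simp add: K(1,2,4-10))
  qed
  have "x \<ominus> y \<preceq> \<zero>"
  proof (rule archimedean)
    fix r :: real assume "0 < r"
    show "x \<ominus> y \<preceq> r \<odot> u"
      \<comment> \<open>The effect module condition only covers \<open>r\<close> up to 1; larger
        \<open>r\<close> follow by monotonicity of the multiples of \<open>u\<close>.\<close>
      by (rule leq_trans[OF *[of "min r 1"] scaled_unit_mono]) (use \<open>0 < r\<close> x y in auto)
  qed (use x y in auto)
  then have "x \<preceq> y" using x y leq_iff_same_diff[of x y "x \<ominus> y" \<zero>] by (simp add: K(1,2,4-10))
  then show "ele (unit_interval V) x y" using unit_interval_ele xy by simp
qed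

end

section \<open>The metrics\<close>

text \<open>Distances from an order unit are known through the bounds \<open>d x y \<le> r\<close>,
  which are vector inequalities. Halving \<epsilon> passes between strict and weak bounds.\<close>

lemma (in Metric_space) mcomplete_iff_le:
  "mcomplete \<longleftrightarrow>
    (\<forall>\<sigma> :: nat \<Rightarrow> 'a. range \<sigma> \<subseteq> M \<longrightarrow> (\<forall>\<epsilon>>0. \<exists>N. \<forall>n\<ge>N. \<forall>m\<ge>N. d (\<sigma> n) (\<sigma> m) \<le> \<epsilon>) \<longrightarrow>
      (\<exists>x \<in> M. \<forall>\<epsilon>>0. \<exists>N. \<forall>n\<ge>N. d (\<sigma> n) x \<le> \<epsilon>))"
proof -
  have strict: "(\<forall>\<epsilon>>0. \<exists>N. P N \<epsilon>) \<longleftrightarrow> (\<forall>\<epsilon>>0. \<exists>N. Q N \<epsilon>)"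
    if "\<And>N \<epsilon>. P N \<epsilon> \<Longrightarrow> Q N \<epsilon>" "\<And>N \<epsilon>. 0 < \<epsilon> \<Longrightarrow> Q N (\<epsilon> / 2) \<Longrightarrow> P N \<epsilon>" for P Q :: "nat \<Rightarrow> real \<Rightarrow> bool"
    using that half_gt_zero by metis
  have lim: "limitin mtopology \<sigma> x sequentially \<longleftrightarrow>
      x \<in> M \<and> (\<forall>\<epsilon>>0. \<exists>N. \<forall>n\<ge>N. d (\<sigma> n) x \<le> \<epsilon>)"
    if "range \<sigma> \<subseteq> M" for \<sigma> x
  proof -
    have "limitin mtopology \<sigma> x sequentially \<longleftrightarrow> x \<in> M \<and> (\<forall>\<epsilon>>0. \<exists>N. \<forall>n\<ge>N. d (\<sigma> n) x < \<epsilon>)"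
      using that by (simp add: limitin_metric eventually_sequentially range_subsetD)
    also have "(\<forall>\<epsilon>>0. \<exists>N. \<forall>n\<ge>N. d (\<sigma> n) x < \<epsilon>) \<longleftrightarrow> (\<forall>\<epsilon>>0. \<exists>N. \<forall>n\<ge>N. d (\<sigma> n) x \<le> \<epsilon>)"
      by (rule strict) force+
    finally show ?thesis .
  qed
  have cauchy: "MCauchy \<sigma> \<longleftrightarrow> range \<sigma> \<subseteq> M \<and> (\<forall>\<epsilon>>0. \<exists>N. \<forall>n\<ge>N. \<forall>m\<ge>N. d (\<sigma> n) (\<sigma> m) \<le> \<epsilon>)" for \<sigma>
  proof -
    have "(\<forall>\<epsilon>>0. \<exists>N. \<forall>n m. N \<le> n \<longrightarrow> N \<le> m \<longrightarrow> d (\<sigma> n) (\<sigma> m) < \<epsilon>) \<longleftrightarrow>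
        (\<forall>\<epsilon>>0. \<exists>N. \<forall>n\<ge>N. \<forall>m\<ge>N. d (\<sigma> n) (\<sigma> m) \<le> \<epsilon>)"
      by (rule strict) force+
    then show ?thesis unfolding MCauchy_def by simp
  qed
  show ?thesis
    unfolding mcomplete_def cauchy
  proof (intro iffI allI impI)
    fix \<sigma> :: "nat \<Rightarrow> 'a"
    assume "\<forall>\<sigma>. range \<sigma> \<subseteq> M \<and> (\<forall>\<epsilon>>0. \<exists>N. \<forall>n\<ge>N. \<forall>m\<ge>N. d (\<sigma> n) (\<sigma> m) \<le> \<epsilon>) \<longrightarrow>
          (\<exists>x. limitin mtopology \<sigma> x sequentially)"
      and "range \<sigma> \<subseteq> M" "\<forall>\<epsilon>>0. \<exists>N. \<forall>n\<ge>N. \<forall>m\<ge>N. d (\<sigma> n) (\<sigma> m) \<le> \<epsilon>"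
    then obtain x where "limitin mtopology \<sigma> x sequentially" by blast
    then show "\<exists>x \<in> M. \<forall>\<epsilon>>0. \<exists>N. \<forall>n\<ge>N. d (\<sigma> n) x \<le> \<epsilon>"
      using lim[OF \<open>range \<sigma> \<subseteq> M\<close>] by blast
  next
    fix \<sigma> :: "nat \<Rightarrow> 'a"
    assume complete: "\<forall>\<sigma> :: nat \<Rightarrow> 'a. range \<sigma> \<subseteq> M \<longrightarrow>
        (\<forall>\<epsilon>>0. \<exists>N. \<forall>n\<ge>N. \<forall>m\<ge>N. d (\<sigma> n) (\<sigma> m) \<le> \<epsilon>) \<longrightarrow>
        (\<exists>x \<in> M. \<forall>\<epsilon>>0. \<exists>N. \<forall>n\<ge>N. d (\<sigma> n) x \<le> \<epsilon>)"
      and \<sigma>: "range \<sigma> \<subseteq> M \<and> (\<forall>\<epsilon>>0. \<exists>N. \<forall>n\<ge>N. \<forall>m\<ge>N. d (\<sigma> n) (\<sigma> m) \<le> \<epsilon>)"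
    from complete[rule_format, OF conjunct1[OF \<sigma>] conjunct2[OF \<sigma>, rule_format]]
    obtain x where "x \<in> M" "\<forall>\<epsilon>>0. \<exists>N. \<forall>n\<ge>N. d (\<sigma> n) x \<le> \<epsilon>" by blast
    then show "\<exists>x. limitin mtopology \<sigma> x sequentially"
      using lim[OF conjunct1[OF \<sigma>]] by blast
  qed
qed

text \<open>The metric axioms are pulled back along \<open>\<phi>\<close>, with injectivity giving
  separation. The map is the inclusion of the interval into its space in one use, a module
  isomorphism in another.\<close>

lemma Metric_space_isometric:
  assumes "Metric_space M d" "inj_on \<phi> M'" "\<phi> ` M' \<subseteq> M"
    "\<And>x y. x \<in> M' \<Longrightarrow> y \<in> M' \<Longrightarrow> d' x y = d (\<phi> x) (\<phi> y)"
    "\<And>x y. \<not> (x \<in> M' \<and> y \<in> M') \<Longrightarrow> d' x y = 0"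
  shows "Metric_space M' d'"
proof -
  interpret Metric_space M d by fact
  show ?thesis
  proof
    show "0 \<le> d' x y" for x y using assms(4,5) by (cases "x \<in> M' \<and> y \<in> M'") auto
    show "d' x y = d' y x" for x y using assms(4,5) commute by (cases "x \<in> M' \<and> y \<in> M'") auto
    show "d' x y = 0 \<longleftrightarrow> x = y" if "x \<in> M'" "y \<in> M'" for x y
      using that assms(4) inj_on_eq_iff[OF assms(2) that] zero[of "\<phi> x" "\<phi> y"] subsetD[OF assms(3)]
      by simp
    show "d' x z \<le> d' x y + d' y z" if "x \<in> M'" "y \<in> M'" "z \<in> M'" for x y z
      using that assms(3,4) triangle[of "\<phi> x" "\<phi> y" "\<phi> z"] by auto
  qed
qed

text \<open>A Cauchy sequence is pushed forward along \<open>\<phi>\<close>, and its limit pulled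
  back by surjectivity.\<close>

lemma mcomplete_isometric:
  assumes "Metric_space M d" and \<phi>: "bij_betw \<phi> M' M"
    and iso: "\<And>x y. x \<in> M' \<Longrightarrow> y \<in> M' \<Longrightarrow> d' x y = d (\<phi> x) (\<phi> y)"
    and "\<And>x y. \<not> (x \<in> M' \<and> y \<in> M') \<Longrightarrow> d' x y = 0"
    and complete: "Metric_space.mcomplete M d"
  shows "Metric_space.mcomplete M' d'"
proof -
  interpret Metric_space M d by fact
  interpret M': Metric_space M' d'
    by (rule Metric_space_isometric[OF assms(1) bij_betw_imp_inj_on[OF \<phi>] _ iso assms(4)])
      (simp add: bij_betw_imp_surj_on[OF \<phi>])
  show ?thesis
    unfolding M'.mcomplete_iff_le
  proof (intro allI impI)
    fix \<sigma> :: "nat \<Rightarrow> _" assume \<sigma>: "range \<sigma> \<subseteq> M'"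
      and cauchy: "\<forall>\<epsilon>>0. \<exists>N. \<forall>n\<ge>N. \<forall>m\<ge>N. d' (\<sigma> n) (\<sigma> m) \<le> \<epsilon>"
    have \<sigma>': "\<sigma> n \<in> M'" for n using \<sigma> by auto
    have r: "range (\<phi> \<circ> \<sigma>) \<subseteq> M" using \<sigma> \<phi> by (auto simp: bij_betw_def)
    have c: "\<forall>\<epsilon>>0. \<exists>N. \<forall>n\<ge>N. \<forall>m\<ge>N. d ((\<phi> \<circ> \<sigma>) n) ((\<phi> \<circ> \<sigma>) m) \<le> \<epsilon>"
      using cauchy \<sigma>' by (simp add: iso)
    obtain y where y: "y \<in> M" "\<forall>\<epsilon>>0. \<exists>N. \<forall>n\<ge>N. d ((\<phi> \<circ> \<sigma>) n) y \<le> \<epsilon>"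
      using complete[unfolded mcomplete_iff_le, THEN spec, THEN mp, OF r, THEN mp, OF c] by blast
    from y(1) \<phi> obtain x where "x \<in> M'" "y = \<phi> x" by (auto simp: bij_betw_def)
    with y \<sigma>' show "\<exists>x \<in> M'. \<forall>\<epsilon>>0. \<exists>N. \<forall>n\<ge>N. d' (\<sigma> n) x \<le> \<epsilon>"
      by (intro bexI[of _ x]) (auto simp: iso)
  qed
qed

section \<open>Norm and distance of an order unit space, and completeness\<close>

context ous
begin

lemma smult_unit_add: "r \<odot> u \<oplus> s \<odot> u = (r + s) \<odot> u"
  using smult_l_distr[of r s u] by (simp add: real_scalars_def)

text \<open>A strong unit bounds from above only, so it is applied to \<open>x\<close> and to its
  negative, and the larger of the two numbers is taken.\<close>

lemma order_bounded:
  assumes x: "x \<in> carrier V"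
  obtains n :: nat where "\<ominus> (real n \<odot> u) \<preceq> x" "x \<preceq> real n \<odot> u"
proof -
  obtain n m where n: "x \<preceq> real n \<odot> u" and m: "\<ominus> x \<preceq> real m \<odot> u"
    using strong_unit[of x] strong_unit[of "\<ominus> x"] x by auto
  obtain K where "coords V x x u K" by (rule ex_coords[of x x u]) (use x in auto)
  note K = coords.K[OF this]
  let ?k = "max n m"
  have "x \<preceq> real ?k \<odot> u"
    using leq_trans[OF n scaled_unit_mono[of n ?k]] x by auto
  moreover have "\<ominus> x \<preceq> real ?k \<odot> u"
    using leq_trans[OF m scaled_unit_mono[of m ?k]] x by auto
  then have "\<ominus> (real ?k \<odot> u) \<preceq> x"
    using leq_iff_same_diff[of "\<ominus> x" "real ?k \<odot> u" "\<ominus> (real ?k \<odot> u)" x] x by (simp add: K(1,4-10))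
  ultimately show ?thesis by (rule that[rotated])
qed

lemma leq_archimedean:
  assumes "x \<in> carrier V" "y \<in> carrier V" and "\<And>r. 0 < r \<Longrightarrow> x \<preceq> y \<oplus> r \<odot> u"
  shows "x \<preceq> y"
proof -
  obtain K where "coords V x y u K" by (rule ex_coords[of x y u]) (use assms in auto)
  note K = coords.K[OF this]
  have "x \<ominus> y \<preceq> \<zero>"
  proof (rule archimedean)
    fix r :: real assume "0 < r"
    show "x \<ominus> y \<preceq> r \<odot> u"
      using assms(3)[OF \<open>0 < r\<close>] assms leq_iff_same_diff[of x "y \<oplus> r \<odot> u" "x \<ominus> y" "r \<odot> u"]
      by (simp add: K(1,2,4-10))
  qed (use assms in auto)
  then show ?thesis using assms leq_iff_same_diff[of x y "x \<ominus> y" \<zero>] by (simp add: K(1,2,4-10))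
qed

lemma leq_add_mono_unit:
  "x \<preceq> y \<oplus> r \<odot> u \<Longrightarrow> r \<le> s \<Longrightarrow> x \<in> carrier V \<Longrightarrow> y \<in> carrier V \<Longrightarrow> x \<preceq> y \<oplus> s \<odot> u"
  by (rule leq_trans[of _ "y \<oplus> r \<odot> u"]) (auto intro: add_mono scaled_unit_mono)

text \<open>The infimum defining the norm is attained. If it is at most \<open>r\<close>, the bounds
  hold with \<open>r + e\<close> for every positive \<open>e\<close>, and the Archimedean axiom
  removes \<open>e\<close>.\<close>

lemma
  assumes x: "x \<in> carrier V"
  shows unit_norm_le_iff: "0 \<le> r \<Longrightarrow>
      unit_norm V x \<le> r \<longleftrightarrow> \<ominus> (r \<odot> u) \<preceq> x \<and> x \<preceq> r \<odot> u"
    and unit_norm_nonneg: "0 \<le> unit_norm V x"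
proof -
  let ?S = "{r. 0 \<le> r \<and> \<ominus> (r \<odot> u) \<preceq> x \<and> x \<preceq> r \<odot> u}"
  obtain K where "coords V x x u K" by (rule ex_coords[of x x u]) (use x in auto)
  note K = coords.K[OF this]
  \<comment> \<open>Both bounds are brought to the form
    \<open>a \<preceq> b \<oplus> r \<odot> u\<close>, to which \<open>leq_archimedean\<close>
    applies.\<close>
  have alt: "\<ominus> (r \<odot> u) \<preceq> x \<longleftrightarrow> \<zero> \<preceq> x \<oplus> r \<odot> u" "x \<preceq> r \<odot> u \<longleftrightarrow> x \<preceq> \<zero> \<oplus> r \<odot> u" for r
    using x leq_iff_same_diff[of "\<ominus> (r \<odot> u)" x \<zero> "x \<oplus> r \<odot> u"] by (simp_all add: K(1,4-10))
  obtain n :: nat where n: "\<ominus> (real n \<odot> u) \<preceq> x" "x \<preceq> real n \<odot> u"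
    by (rule order_bounded[OF x])
  have ne: "?S \<noteq> {}" using n of_nat_0_le_iff[of n] by blast
  have bdd: "bdd_below ?S" by (rule bdd_belowI[of _ 0]) auto
  show "0 \<le> unit_norm V x" unfolding unit_norm_def by (rule cInf_greatest[OF ne]) auto
  assume r: "0 \<le> r"
  show "unit_norm V x \<le> r \<longleftrightarrow> \<ominus> (r \<odot> u) \<preceq> x \<and> x \<preceq> r \<odot> u"
  proof
    assume "unit_norm V x \<le> r"
    have *: "\<zero> \<preceq> x \<oplus> (r + e) \<odot> u \<and> x \<preceq> \<zero> \<oplus> (r + e) \<odot> u" if "0 < e" for e
    proof -
      have "Inf ?S < r + e" using \<open>unit_norm V x \<le> r\<close> \<open>0 < e\<close> by (simp add: unit_norm_def)
      then obtain s where "s \<in> ?S" "s < r + e" using cInf_lessD[OF ne] by blast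
      then show ?thesis using x leq_add_mono_unit[of \<zero> x s "r + e"] leq_add_mono_unit[of x \<zero> s "r + e"] 
        unfolding mem_Collect_eq alt by auto
    qed
    have "\<zero> \<preceq> x \<oplus> r \<odot> u"
      by (rule leq_archimedean) (use * x in \<open>simp_all add: a_assoc smult_unit_add\<close>)
    moreover have "x \<preceq> \<zero> \<oplus> r \<odot> u"
      by (rule leq_archimedean) (use * x in \<open>simp_all add: smult_unit_add\<close>)
    ultimately show "\<ominus> (r \<odot> u) \<preceq> x \<and> x \<preceq> r \<odot> u" unfolding alt ..
  next
    assume "\<ominus> (r \<odot> u) \<preceq> x \<and> x \<preceq> r \<odot> u"
    then show "unit_norm V x \<le> r" unfolding unit_norm_def using r bdd by (intro cInf_lower) auto
  qed
qed

lemma unit_dist_le_iff: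
  assumes "x \<in> carrier V" "y \<in> carrier V" "0 \<le> r"
  shows "unit_dist V x y \<le> r \<longleftrightarrow> x \<preceq> y \<oplus> r \<odot> u \<and> y \<preceq> x \<oplus> r \<odot> u"
proof -
  obtain K where "coords V x y u K" by (rule ex_coords[of x y u]) (use assms in auto)
  note K = coords.K[OF this]
  have "x \<ominus> y \<preceq> r \<odot> u \<longleftrightarrow> x \<preceq> y \<oplus> r \<odot> u"
    by (rule leq_iff_same_diff) (use assms in \<open>auto simp: K(1,2,4-10)\<close>)
  moreover have "\<ominus> (r \<odot> u) \<preceq> x \<ominus> y \<longleftrightarrow> y \<preceq> x \<oplus> r \<odot> u"
    by (rule leq_iff_same_diff) (use assms in \<open>auto simp: K(1,2,4-10)\<close>)
  ultimately show ?thesis using unit_norm_le_iff[of "x \<ominus> y" r] assms by (auto simp: unit_dist_def)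
qed

lemma unit_dist_nonneg: "0 \<le> unit_dist V x y"
  by (auto simp: unit_dist_def unit_norm_nonneg)

text \<open>Through \<open>unit_dist_le_iff\<close> the metric axioms become order axioms:
  separation is antisymmetry, and the triangle inequality is transitivity.\<close>

lemma Metric_space_unit_dist: "Metric_space (carrier V) (unit_dist V)"
proof
  show "unit_dist V x y = unit_dist V y x" for x y
  proof (cases "x \<in> carrier V \<and> y \<in> carrier V")
    case True
    then have "unit_dist V x y \<le> r \<longleftrightarrow> unit_dist V y x \<le> r" if "0 \<le> r" for r
      using that by (auto simp: unit_dist_le_iff)
    then show ?thesis using unit_dist_nonneg by (meson order_antisym order_refl)
  qed (auto simp: unit_dist_def)
next
  fix x y assume c: "x \<in> carrier V" "y \<in> carrier V"
  have "unit_dist V x y = 0 \<longleftrightarrow> unit_dist V x y \<le> 0" using unit_dist_nonneg[of x y] by linarith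
  also have "\<dots> \<longleftrightarrow> x = y"
    using c leq_antisym[of x y] smult_l_null[of u] by (auto simp: unit_dist_le_iff real_scalars_def)
  finally show "unit_dist V x y = 0 \<longleftrightarrow> x = y" .
next
  have *: "x \<preceq> z \<oplus> (r + s) \<odot> u" if "x \<preceq> y \<oplus> r \<odot> u" "y \<preceq> z \<oplus> s \<odot> u"
    "x \<in> carrier V" "y \<in> carrier V" "z \<in> carrier V" for x y z r s
  proof -
    have "y \<oplus> r \<odot> u \<preceq> (z \<oplus> s \<odot> u) \<oplus> r \<odot> u" using that by (intro add_mono) auto
    from leq_trans[OF that(1) this] show ?thesis
      using that by (simp add: a_assoc smult_unit_add add.commute)
  qed
  fix x y z assume c: "x \<in> carrier V" "y \<in> carrier V" "z \<in> carrier V"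
  have "x \<preceq> y \<oplus> unit_dist V x y \<odot> u \<and> y \<preceq> x \<oplus> unit_dist V x y \<odot> u"
    using unit_dist_le_iff[of x y "unit_dist V x y"] c unit_dist_nonneg by simp
  moreover have "y \<preceq> z \<oplus> unit_dist V y z \<odot> u \<and> z \<preceq> y \<oplus> unit_dist V y z \<odot> u"
    using unit_dist_le_iff[of y z "unit_dist V y z"] c unit_dist_nonneg by simp
  ultimately have "x \<preceq> z \<oplus> (unit_dist V x y + unit_dist V y z) \<odot> u \<and>
      z \<preceq> x \<oplus> (unit_dist V y z + unit_dist V x y) \<odot> u"
    using c *[of x y _ z] *[of z y _ x] by blast
  then show "unit_dist V x z \<le> unit_dist V x y + unit_dist V y z"
    using c unit_dist_nonneg by (subst unit_dist_le_iff) (auto simp: add.commute)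
qed (rule unit_dist_nonneg)

text \<open>The norm is one infimum of two-sided bounds, \<open>edist\<close> a maximum of two
  one-sided infima. They agree because the admissible radii are closed upwards within (0,1], so
  beyond the larger infimum both bounds hold. The cap at 1 is harmless, as points of the interval
  are at most 1 apart.\<close>

lemma edist_unit_interval:
  assumes xy: "x \<in> carrier (unit_interval V)" "y \<in> carrier (unit_interval V)"
  shows "edist (unit_interval V) x y = unit_dist V x y"
proof -
  define A where "A x y = {r \<in> {0<..1}. half_le (unit_interval V) r x y}" for x y
  let ?D = "unit_dist V x y"
  have c: "x \<in> carrier V" "y \<in> carrier V" using xy by (auto simp: carrier_unit_interval)
  have A_iff: "r \<in> A a b \<longleftrightarrow> 0 < r \<and> r \<le> 1 \<and> a \<preceq> b \<oplus> r \<odot> u"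
    if "a \<in> carrier (unit_interval V)" "b \<in> carrier (unit_interval V)" for r a b
    using half_le_unit_interval[OF that, of r] by (auto simp: A_def)
  have one: "1 \<in> A a b" if "a \<in> carrier (unit_interval V)" "b \<in> carrier (unit_interval V)" for a b
  proof -
    have ab: "a \<in> carrier V" "a \<preceq> u" "b \<in> carrier V" "\<zero> \<preceq> b"
      using that by (auto simp: carrier_unit_interval)
    have "\<zero> \<oplus> a \<preceq> b \<oplus> u" using ab by (intro add_mono) auto
    then show ?thesis using ab smult_one[of u] A_iff[OF that, of 1] by (simp add: real_scalars_def)
  qed
  have bdd: "bdd_below (A a b)" for a b by (rule bdd_belowI[of _ 0]) (auto simp: A_def)
  have D1: "?D \<le> 1" using one xy A_iff c by (simp add: unit_dist_le_iff)
  have up: "s \<in> A a b" if "a \<in> carrier (unit_interval V)" "b \<in> carrier (unit_interval V)"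
    "r \<in> A a b" "r \<le> s" "s \<le> 1" for a b r s
    using that A_iff[OF that(1,2)] leq_add_mono_unit[of a b r s] by (auto simp: carrier_unit_interval)
  have inf_up: "s \<in> A a b" if ab: "a \<in> carrier (unit_interval V)" "b \<in> carrier (unit_interval V)"
    and s: "Inf (A a b) < s" "s \<le> 1" for a b s
  proof -
    obtain r where "r \<in> A a b" "r < s" using cInf_lessD[OF _ s(1)] one[OF ab] by blast
    then show ?thesis using up[OF ab _ _ s(2)] by auto
  qed
  have inf_le: "Inf (A a b) \<le> ?D" if "a = x \<and> b = y \<or> a = y \<and> b = x" for a b
  proof (rule field_le_epsilon)
    fix e :: real assume e: "0 < e"
    \<comment> \<open>Adding \<open>e\<close> makes the radius positive even at distance 0, and the
      minimum keeps it in (0,1].\<close>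
    let ?r = "min (?D + e) 1"
    have "0 < ?r" "?D \<le> ?r" using e D1 unit_dist_nonneg[of x y] by auto
    then have "?r \<in> A a b" using that unit_dist_le_iff[of x y ?r] c A_iff xy by auto
    from cInf_lower[OF this bdd] show "Inf (A a b) \<le> ?D + e" by simp
  qed
  let ?m = "max (Inf (A x y)) (Inf (A y x))"
  have "?D \<le> ?m"
  proof (rule field_le_epsilon)
    fix e :: real assume e: "0 < e"
    show "?D \<le> ?m + e"
    \<comment> \<open>A radius above 1 is outside the range of \<open>edist\<close>, but there the
      bound \<open>D1\<close> already suffices.\<close>
    proof (cases "?m + e \<le> 1")
      case True
      then have "?m + e \<in> A x y" "?m + e \<in> A y x" using inf_up xy e by auto
      then show ?thesis using A_iff xy c unit_dist_le_iff[of x y "?m + e"] by auto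
    qed (use D1 in auto)
  qed
  moreover have "?m \<le> ?D" using inf_le by simp
  ultimately have "?m = ?D" by (rule order_antisym[rotated])
  then show ?thesis using xy by (simp only: edist_def A_def simp_thms if_True)
qed

lemma Metric_space_edist_unit_interval: "Metric_space (carrier (unit_interval V)) (edist (unit_interval V))"
  by (rule Metric_space_isometric[OF Metric_space_unit_dist, of "\<lambda>x. x"])
    (auto simp: edist_unit_interval, auto simp: edist_def carrier_unit_interval)

lemma banach_iff: "banach_space V \<longleftrightarrow> banach_effect_module (unit_interval V)"
proof -
  interpret M: Metric_space "carrier V" "unit_dist V" by (rule Metric_space_unit_dist)
  interpret U: Metric_space "carrier (unit_interval V)" "edist (unit_interval V)"
    by (rule Metric_space_edist_unit_interval)
  show ?thesis unfolding banach_space_def banach_effect_module_def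
  proof
    assume complete: "M.mcomplete"
    show "U.mcomplete" unfolding U.mcomplete_iff_le
    proof (intro allI impI)
      fix \<sigma> :: "nat \<Rightarrow> 'a" assume \<sigma>: "range \<sigma> \<subseteq> carrier (unit_interval V)"
        and cauchy: "\<forall>\<epsilon>>0. \<exists>N. \<forall>n\<ge>N. \<forall>m\<ge>N. edist (unit_interval V) (\<sigma> n) (\<sigma> m) \<le> \<epsilon>"
      have \<sigma>': "\<sigma> n \<in> carrier (unit_interval V)" for n using \<sigma> by auto
      then have \<sigma>'': "\<sigma> n \<in> carrier V" "\<zero> \<preceq> \<sigma> n" "\<sigma> n \<preceq> u" for n
        by (auto simp: carrier_unit_interval)
      have r: "range \<sigma> \<subseteq> carrier V" using \<sigma>'' by auto
      have c: "\<forall>\<epsilon>>0. \<exists>N. \<forall>n\<ge>N. \<forall>m\<ge>N. unit_dist V (\<sigma> n) (\<sigma> m) \<le> \<epsilon>"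
        using cauchy \<sigma>' by (simp add: edist_unit_interval)
      obtain x where x: "x \<in> carrier V" "\<forall>\<epsilon>>0. \<exists>N. \<forall>n\<ge>N. unit_dist V (\<sigma> n) x \<le> \<epsilon>"
        using complete[unfolded M.mcomplete_iff_le, THEN spec, THEN mp, OF r, THEN mp, OF c] by blast
      \<comment> \<open>Some member of the sequence is within \<open>e\<close> of the limit on both
        sides, so the limit satisfies the interval bounds up to every positive multiple of
        \<open>u\<close>, hence exactly.\<close>
      have near: "\<exists>n. \<sigma> n \<preceq> x \<oplus> e \<odot> u \<and> x \<preceq> \<sigma> n \<oplus> e \<odot> u" if e: "0 < e" for e
      proof -
        obtain N where "unit_dist V (\<sigma> N) x \<le> e" using x(2) e by blast
        then show ?thesis using unit_dist_le_iff[of "\<sigma> N" x e] e x(1) \<sigma>'' by auto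
      qed
      have "\<zero> \<preceq> x"
      proof (rule leq_archimedean)
        fix r :: real assume "0 < r"
        then obtain n where "\<sigma> n \<preceq> x \<oplus> r \<odot> u" using near by blast
        then show "\<zero> \<preceq> x \<oplus> r \<odot> u" using leq_trans[OF \<sigma>''(2)] x(1) \<sigma>''(1) by auto
      qed (use x in auto)
      moreover have "x \<preceq> u"
      proof (rule leq_archimedean)
        fix r :: real assume "0 < r"
        then obtain n where "x \<preceq> \<sigma> n \<oplus> r \<odot> u" using near by blast
        then show "x \<preceq> u \<oplus> r \<odot> u"
          using leq_trans[OF _ add_mono_left[OF \<sigma>''(3)[of n]]] x(1) \<sigma>''(1) by auto
      qed (use x in auto)
      ultimately have "x \<in> carrier (unit_interval V)" using x(1) by (simp add: carrier_unit_interval)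
      then show "\<exists>x \<in> carrier (unit_interval V). \<forall>\<epsilon>>0. \<exists>N. \<forall>n\<ge>N. edist (unit_interval V) (\<sigma> n) x \<le> \<epsilon>"
        using x(2) \<sigma>' by (intro bexI[of _ x]) (simp_all add: edist_unit_interval)
    qed
  next
    assume complete: "U.mcomplete"
    show "M.mcomplete" unfolding M.mcomplete_iff_le
    proof (intro allI impI)
      fix \<sigma> :: "nat \<Rightarrow> 'a" assume \<sigma>: "range \<sigma> \<subseteq> carrier V"
        and cauchy: "\<forall>\<epsilon>>0. \<exists>N. \<forall>n\<ge>N. \<forall>m\<ge>N. unit_dist V (\<sigma> n) (\<sigma> m) \<le> \<epsilon>"
      have \<sigma>': "\<sigma> n \<in> carrier V" for n using \<sigma> by auto
      obtain N where N: "\<And>n m. n \<ge> N \<Longrightarrow> m \<ge> N \<Longrightarrow> unit_dist V (\<sigma> n) (\<sigma> m) \<le> 1"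
        using cauchy[rule_format, of 1] by auto
      obtain k :: nat where k: "\<ominus> (real k \<odot> u) \<preceq> \<sigma> N" "\<sigma> N \<preceq> real k \<odot> u"
        by (rule order_bounded[OF \<sigma>'])
      \<comment> \<open>From index \<open>N\<close> on, the terms lie between the multiples of
        \<open>u\<close> by \<open>k + 1\<close> and its negative. Division by \<open>c\<close>
        brings them within half the unit of 0, and translation by half the unit brings them into the
        interval.\<close>
      define c where "c = 2 * (real k + 1)"
      have c: "0 < c" and kc: "real k = c / 2 - 1" by (simp_all add: c_def field_simps)
      define \<rho> where "\<rho> n = (1/2) \<odot> u \<oplus> (1/c) \<odot> \<sigma> (n + N)" for n
      have \<rho>: "\<rho> n \<in> carrier (unit_interval V)" for n
      proof -
        define v where "v = \<sigma> (n + N)"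
        have v: "v \<in> carrier V" using \<sigma>' by (simp add: v_def)
        obtain K where "coords V v (\<sigma> N) u K"
          by (rule ex_coords[of "v" "\<sigma> N" u]) (use \<sigma>' v in auto)
        note K = coords.K[OF this]
        note K = K(1,2,4-10)
        have "unit_dist V v (\<sigma> N) \<le> 1" using N by (simp add: v_def)
        then have d: "v \<preceq> \<sigma> N \<oplus> 1 \<odot> u" "\<sigma> N \<preceq> v \<oplus> 1 \<odot> u"
          using unit_dist_le_iff[of "v" "\<sigma> N" 1] \<sigma>' v by auto
        have "\<sigma> N \<oplus> 1 \<odot> u \<preceq> real k \<odot> u \<oplus> 1 \<odot> u" using k \<sigma>' by (intro add_mono_left) auto
        from leq_trans[OF d(1) this] have up: "v \<preceq> real k \<odot> u \<oplus> 1 \<odot> u" using \<sigma>' v by auto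
        have lo: "\<ominus> (real k \<odot> u) \<preceq> v \<oplus> 1 \<odot> u" using leq_trans[OF k(1) d(2)] \<sigma>' v by auto
        have "\<rho> n \<preceq> u \<longleftrightarrow> v \<preceq> real k \<odot> u \<oplus> 1 \<odot> u" unfolding \<rho>_def v_def[symmetric]
          by (rule leq_iff_scaled_diff[where r = "1/c"])
            (use c \<sigma>' v in \<open>auto simp: K kc field_simps\<close>)
        moreover have "\<zero> \<preceq> \<rho> n \<longleftrightarrow> \<ominus> (real k \<odot> u) \<preceq> v \<oplus> 1 \<odot> u" unfolding \<rho>_def v_def[symmetric]
          by (rule leq_iff_scaled_diff[where r = "1/c"])
            (use c \<sigma>' v in \<open>auto simp: K kc field_simps\<close>)
        ultimately show ?thesis using up lo v by (auto simp: carrier_unit_interval \<rho>_def v_def[symmetric])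
      qed
      \<comment> \<open>This affine map divides all distances by \<open>c\<close>, so Cauchy
        sequences and limits correspond under it.\<close>
      have scale: "unit_dist V ((1/2) \<odot> u \<oplus> (1/c) \<odot> x) ((1/2) \<odot> u \<oplus> (1/c) \<odot> y) \<le> r \<longleftrightarrow> unit_dist V x y \<le> c * r"
        if xy: "x \<in> carrier V" "y \<in> carrier V" and r: "0 \<le> r" for x y r
      proof -
        obtain K where "coords V x y u K" by (rule ex_coords[of x y u]) (use xy in auto)
        note K = coords.K[OF this]
        note K = K(1,2,4-10)
        have "(1/2) \<odot> u \<oplus> (1/c) \<odot> x \<preceq> ((1/2) \<odot> u \<oplus> (1/c) \<odot> y) \<oplus> r \<odot> u \<longleftrightarrow> x \<preceq> y \<oplus> (c * r) \<odot> u"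
          by (rule leq_iff_scaled_diff[where r = "1/c"]) (use c xy in \<open>auto simp: K field_simps\<close>)
        moreover have "(1/2) \<odot> u \<oplus> (1/c) \<odot> y \<preceq> ((1/2) \<odot> u \<oplus> (1/c) \<odot> x) \<oplus> r \<odot> u \<longleftrightarrow> y \<preceq> x \<oplus> (c * r) \<odot> u"
          by (rule leq_iff_scaled_diff[where r = "1/c"]) (use c xy in \<open>auto simp: K field_simps\<close>)
        ultimately show ?thesis using unit_dist_le_iff xy r c by simp
      qed
      have \<rho>r: "range \<rho> \<subseteq> carrier (unit_interval V)" using \<rho> by auto
      have \<rho>c: "\<forall>\<epsilon>>0. \<exists>N. \<forall>n\<ge>N. \<forall>m\<ge>N. edist (unit_interval V) (\<rho> n) (\<rho> m) \<le> \<epsilon>"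
      proof (intro allI impI)
        fix \<epsilon> :: real assume e: "0 < \<epsilon>"
        then obtain L where L: "\<forall>n\<ge>L. \<forall>m\<ge>L. unit_dist V (\<sigma> n) (\<sigma> m) \<le> c * \<epsilon>"
          using cauchy[rule_format, of "c * \<epsilon>"] c by auto
        have "edist (unit_interval V) (\<rho> n) (\<rho> m) \<le> \<epsilon>" if "n \<ge> L" "m \<ge> L" for n m
          using L that scale[OF \<sigma>' \<sigma>', of \<epsilon> "n + N" "m + N"] e edist_unit_interval[OF \<rho> \<rho>, of n m]
          by (simp add: \<rho>_def)
        then show "\<exists>N. \<forall>n\<ge>N. \<forall>m\<ge>N. edist (unit_interval V) (\<rho> n) (\<rho> m) \<le> \<epsilon>" by blast
      qed
      obtain y where y: "y \<in> carrier (unit_interval V)"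
        "\<forall>\<epsilon>>0. \<exists>N. \<forall>n\<ge>N. edist (unit_interval V) (\<rho> n) y \<le> \<epsilon>"
        using complete[unfolded U.mcomplete_iff_le, THEN spec, THEN mp, OF \<rho>r, THEN mp, OF \<rho>c] by blast
      have yc: "y \<in> carrier V" using y by (simp add: carrier_unit_interval)
      define x where "x = c \<odot> (y \<ominus> (1/2) \<odot> u)"
      have xc: "x \<in> carrier V" using yc by (simp add: x_def)
      obtain K where "coords V y y u K" by (rule ex_coords[of y y u]) (use yc in auto)
      note K = coords.K[OF this]
      note K = K(1,2,4-10)
      have yx: "y = (1/2) \<odot> u \<oplus> (1/c) \<odot> x" using c by (simp add: x_def K)
      have "\<exists>M. \<forall>n\<ge>M. unit_dist V (\<sigma> n) x \<le> \<epsilon>" if e: "0 < \<epsilon>" for \<epsilon>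
      proof -
        obtain L where L: "\<forall>n\<ge>L. edist (unit_interval V) (\<rho> n) y \<le> \<epsilon> / c"
          using y(2)[rule_format, of "\<epsilon> / c"] c e by auto
        \<comment> \<open>\<open>\<rho>\<close> started at index \<open>N\<close> of
          \<open>\<sigma>\<close>, whence the shift in the threshold.\<close>
        have "unit_dist V (\<sigma> n) x \<le> \<epsilon>" if n: "n \<ge> L + N" for n
        proof -
          have "edist (unit_interval V) (\<rho> (n - N)) y \<le> \<epsilon> / c" using L n by simp
          moreover have "\<rho> (n - N) = (1/2) \<odot> u \<oplus> (1/c) \<odot> \<sigma> n" using n by (simp add: \<rho>_def)
          ultimately show ?thesis
            using scale[OF \<sigma>'[of n] xc, of "\<epsilon> / c"] e c edist_unit_interval[OF \<rho>[of "n - N"] y(1)] yx by simp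
        qed
        then show ?thesis by blast
      qed
      then show "\<exists>x \<in> carrier V. \<forall>\<epsilon>>0. \<exists>N. \<forall>n\<ge>N. unit_dist V (\<sigma> n) x \<le> \<epsilon>" using xc by blast
    qed
  qed
qed

end

section \<open>The unit interval functor is fully faithful\<close>

lemma compose_ident_right: "f \<in> A \<rightarrow>\<^sub>E B \<Longrightarrow> compose A f (restrict (\<lambda>x. x) A) = f"
  by (rule ext) (auto simp: compose_def PiE_def extensional_def)

lemma compose_ident_left: "f \<in> A \<rightarrow>\<^sub>E B \<Longrightarrow> compose A (restrict (\<lambda>x. x) B) f = f"
  by (rule ext) (auto simp: compose_def PiE_def extensional_def Pi_def)

lemma compose_assoc_extensional:
  "f \<in> A \<rightarrow>\<^sub>E B \<Longrightarrow> compose A h (compose A g f) = compose A (compose B h g) f"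
  by (rule ext) (auto simp: compose_def PiE_def Pi_def)

lemma ous_homD:
  assumes "f \<in> ous_hom V W"
  shows "f \<in> carrier V \<rightarrow>\<^sub>E carrier W"
    "\<And>x. x \<in> carrier V \<Longrightarrow> f x \<in> carrier W"
    "\<And>x y. x \<in> carrier V \<Longrightarrow> y \<in> carrier V \<Longrightarrow> f (x \<oplus>\<^bsub>V\<^esub> y) = f x \<oplus>\<^bsub>W\<^esub> f y"
    "\<And>r x. x \<in> carrier V \<Longrightarrow> f (r \<odot>\<^bsub>V\<^esub> x) = r \<odot>\<^bsub>W\<^esub> f x"
    "\<And>x y. x \<in> carrier V \<Longrightarrow> y \<in> carrier V \<Longrightarrow> leq V x y \<Longrightarrow> leq W (f x) (f y)"
    "f (unit V) = unit W"
  using assms unfolding ous_hom_def by auto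

lemma emod_homD:
  assumes "f \<in> emod_hom E F"
  shows "f \<in> carrier E \<rightarrow>\<^sub>E carrier F"
    "\<And>x. x \<in> carrier E \<Longrightarrow> f x \<in> carrier F"
    "f (eone E) = eone F"
    "\<And>x y z. x \<in> carrier E \<Longrightarrow> y \<in> carrier E \<Longrightarrow> osum E x y = Some z \<Longrightarrow> osum F (f x) (f y) = Some (f z)"
    "\<And>r x. 0 \<le> r \<Longrightarrow> r \<le> 1 \<Longrightarrow> x \<in> carrier E \<Longrightarrow> f (escale E r x) = escale F r (f x)"
  using assms unfolding emod_hom_def by auto

lemma is_category_OUS: "is_category OUS"
  unfolding is_category_def
proof (intro conjI ballI)
  fix U assume "U \<in> Obj OUS"
  then interpret U: ous U by (simp add: OUS_def ous_def)
  show "Ident OUS U \<in> Hom OUS U U" by (simp add: OUS_def ous_hom_def)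
next
  fix U V W f g assume "U \<in> Obj OUS" "V \<in> Obj OUS" and f: "f \<in> Hom OUS U V" and g: "g \<in> Hom OUS V W"
  then interpret U: ous U by (simp add: OUS_def ous_def)
  have f': "f \<in> ous_hom U V" and g': "g \<in> ous_hom V W" using f g by (auto simp: OUS_def)
  show "Comp OUS U V W g f \<in> Hom OUS U W"
    using ous_homD[OF f'] ous_homD[OF g']
    by (auto simp: OUS_def ous_hom_def compose_def)
qed (auto simp: OUS_def ous_hom_def compose_ident_left compose_ident_right compose_assoc_extensional)

lemma effect_algebra_closed:
  "effect_algebra E \<Longrightarrow> x \<in> carrier E \<Longrightarrow> y \<in> carrier E \<Longrightarrow> osum E x y = Some z \<Longrightarrow> z \<in> carrier E"
  unfolding effect_algebra_def by blast

lemma effect_module_algebra: "effect_module E \<Longrightarrow> effect_algebra E"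
  unfolding effect_module_def by (rule conjunct1)

lemma eone_closed: "effect_algebra E \<Longrightarrow> eone E \<in> carrier E"
  unfolding effect_algebra_def eone_def by blast

lemma escale_closed: "effect_module E \<Longrightarrow> x \<in> carrier E \<Longrightarrow> 0 \<le> r \<Longrightarrow> r \<le> 1 \<Longrightarrow> escale E r x \<in> carrier E"
  by (simp add: effect_module_def)

lemma is_category_EMod: "is_category EMod"
  unfolding is_category_def
proof (intro conjI ballI)
  fix E :: "'a effect_structure" assume "E \<in> Obj EMod"
  then have E: "effect_module E" by (simp add: EMod_def)
  show "Ident EMod E \<in> Hom EMod E E"
    using eone_closed[OF effect_module_algebra[OF E]] escale_closed[OF E]
    by (auto simp: EMod_def emod_hom_def dest: effect_algebra_closed[OF effect_module_algebra[OF E]])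
next
  fix D E F :: "'a effect_structure" and f g
  assume "D \<in> Obj EMod" and f: "f \<in> Hom EMod D E" and g: "g \<in> Hom EMod E F"
  then have D: "effect_module D" by (simp add: EMod_def)
  have f': "f \<in> emod_hom D E" and g': "g \<in> emod_hom E F" using f g by (auto simp: EMod_def)
  show "Comp EMod D E F g f \<in> Hom EMod D F"
    unfolding EMod_def emod_hom_def compose_def category.simps
  proof (intro CollectI conjI ballI allI impI restrict_PiE_iff[THEN iffD2])
    fix x y z assume xy: "x \<in> carrier D" "y \<in> carrier D" and z: "osum D x y = Some z"
    then show "osum F (restrict (\<lambda>x. g (f x)) (carrier D) x) (restrict (\<lambda>x. g (f x)) (carrier D) y) =
        Some (restrict (\<lambda>x. g (f x)) (carrier D) z)"
      using emod_homD(4)[OF f' xy z] emod_homD(2)[OF f'] emod_homD(4)[OF g']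
        effect_algebra_closed[OF effect_module_algebra[OF D] xy z] by simp
  qed (use emod_homD[OF f'] emod_homD[OF g'] eone_closed[OF effect_module_algebra[OF D]]
      escale_closed[OF D] in simp_all)
qed (auto simp: EMod_def emod_hom_def compose_ident_left compose_ident_right compose_assoc_extensional)

lemma Obj_AEMod: "E \<in> Obj AEMod \<longleftrightarrow> effect_module E \<and> archimedean E"
  by (auto simp: AEMod_def full_subcategory_def EMod_def)

lemma Hom_AEMod: "Hom AEMod = emod_hom"
  and Ident_AEMod: "Ident AEMod = (\<lambda>E. restrict (\<lambda>x. x) (carrier E))"
  and Comp_AEMod: "Comp AEMod = (\<lambda>D E F g f. compose (carrier D) g f)"
  by (simp_all add: AEMod_def full_subcategory_def EMod_def)

lemma is_functor_unit_interval: "is_functor OUS AEMod unit_interval_functor"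
  unfolding is_functor_def
proof (intro conjI ballI is_category_OUS)
  show "is_category AEMod" unfolding AEMod_def by (rule is_category_full_subcategory[OF is_category_EMod])
next
  fix V :: "'a ordered_space" assume "V \<in> Obj OUS"
  then interpret V: ous V by (simp add: OUS_def ous_def)
  show "OMap unit_interval_functor V \<in> Obj AEMod"
    using V.effect_module_unit_interval V.archimedean_unit_interval
    by (simp add: unit_interval_functor_def Obj_AEMod)
  show "MMap unit_interval_functor V V (Ident OUS V) = Ident AEMod (OMap unit_interval_functor V)"
    by (auto simp: unit_interval_functor_def Ident_AEMod OUS_def fun_eq_iff restrict_def
        V.carrier_unit_interval)
next
  fix V W :: "'a ordered_space" and f assume "V \<in> Obj OUS" "W \<in> Obj OUS" and f: "f \<in> Hom OUS V W"
  then interpret V: ous V + W: ous W by (simp_all add: OUS_def ous_def)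
  have f': "f \<in> ous_hom V W" using f by (simp add: OUS_def)
  note f = ous_homD[OF this]
  have f0: "f \<zero>\<^bsub>V\<^esub> = \<zero>\<^bsub>W\<^esub>"
    using f(4)[of "unit V" 0] V.smult_l_null[of "unit V"] W.smult_l_null[of "unit W"] f(6)
    by (simp add: real_scalars_def)
  have pos: "leq W \<zero>\<^bsub>W\<^esub> (f x)" if "x \<in> carrier V" "leq V \<zero>\<^bsub>V\<^esub> x" for x
    using f(5)[of "\<zero>\<^bsub>V\<^esub>" x] that f0 by simp
  have le1: "leq W (f x) (unit W)" if "x \<in> carrier V" "leq V x (unit V)" for x
    using f(5)[of x "unit V"] that f(6) by simp
  have add: "leq W (f x \<oplus>\<^bsub>W\<^esub> f y) (unit W)" if "x \<in> carrier V" "y \<in> carrier V" "leq V (x \<oplus>\<^bsub>V\<^esub> y) (unit V)" for x y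
    using le1[of "x \<oplus>\<^bsub>V\<^esub> y"] that f(3) by simp
  have sc: "r \<odot>\<^bsub>V\<^esub> x \<in> carrier (unit_interval V)" if "x \<in> carrier (unit_interval V)" "0 \<le> r" "r \<le> 1" for r x
    using V.unit_interval_scale that by blast
  have U: "x \<in> carrier V \<Longrightarrow> leq V \<zero>\<^bsub>V\<^esub> x \<Longrightarrow> leq V x (unit V) \<Longrightarrow> x \<in> carrier (unit_interval V)" for x
    by (simp add: V.carrier_unit_interval)
  have one: "unit V \<in> carrier (unit_interval V)" using V.unit_pos by (simp add: V.carrier_unit_interval)
  have cl: "x \<oplus>\<^bsub>V\<^esub> y \<in> carrier (unit_interval V)"
    if "x \<in> carrier (unit_interval V)" "y \<in> carrier (unit_interval V)" "leq V (x \<oplus>\<^bsub>V\<^esub> y) (unit V)" for x y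
    using effect_algebra_closed[OF V.effect_algebra_unit_interval that(1,2)] that(3)
    by (simp add: V.osum_unit_interval)
  show "MMap unit_interval_functor V W f \<in> Hom AEMod (OMap unit_interval_functor V) (OMap unit_interval_functor W)"
    unfolding unit_interval_functor_def Hom_AEMod emod_hom_def functor_data.simps
  proof (intro CollectI conjI ballI allI impI restrict_PiE_iff[THEN iffD2])
    fix x assume x: "x \<in> carrier (unit_interval V)"
    show "f x \<in> carrier (unit_interval W)"
      using x f(2) pos le1 by (simp add: V.carrier_unit_interval W.carrier_unit_interval)
    fix y z assume y: "y \<in> carrier (unit_interval V)" and z: "osum (unit_interval V) x y = Some z"
    then have "leq V (x \<oplus>\<^bsub>V\<^esub> y) (unit V)" "z = x \<oplus>\<^bsub>V\<^esub> y" by (simp_all add: V.osum_unit_interval split: if_splits)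
    then show "osum (unit_interval W) (restrict f (carrier (unit_interval V)) x)
        (restrict f (carrier (unit_interval V)) y) = Some (restrict f (carrier (unit_interval V)) z)"
      using x y cl[OF x y] add f(3) by (simp add: W.osum_unit_interval V.carrier_unit_interval)
  next
    fix r :: real and x assume r: "r \<in> {0..1}" and x: "x \<in> carrier (unit_interval V)"
    then show "restrict f (carrier (unit_interval V)) (escale (unit_interval V) r x) =
        escale (unit_interval W) r (restrict f (carrier (unit_interval V)) x)"
      using sc[OF x, of r] f(4)[of x r]
      by (simp add: V.escale_unit_interval W.escale_unit_interval V.carrier_unit_interval)
  qed (use one f(6) in \<open>simp add: V.eone_unit_interval W.eone_unit_interval\<close>)
  fix X :: "'a ordered_space" and g
  assume "X \<in> Obj OUS" "g \<in> Hom OUS W X"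
  show "MMap unit_interval_functor V X (Comp OUS V W X g f) =
    Comp AEMod (OMap unit_interval_functor V) (OMap unit_interval_functor W) (OMap unit_interval_functor X)
      (MMap unit_interval_functor W X g) (MMap unit_interval_functor V W f)"
    using f(2) pos le1
    by (auto simp: unit_interval_functor_def Comp_AEMod OUS_def compose_def fun_eq_iff restrict_def
        V.carrier_unit_interval W.carrier_unit_interval)
qed

section \<open>Extending interval morphisms to the whole space\<close>

context ous
begin

lemma centre_unit_interval: "0 \<le> r \<Longrightarrow> r \<le> 1 \<Longrightarrow> r \<odot> u \<in> carrier (unit_interval V)"
  using unit_interval_scale[of u r] unit_pos by (simp add: carrier_unit_interval)

text \<open>An order bound \<open>n\<close> on \<open>x\<close> shows that small multiples of
  \<open>x\<close> stay within half the unit of 0. Admitting all smaller \<open>s\<close> lets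
  finitely many vectors share one parameter.\<close>

lemma ex_near_centre:
  assumes x: "x \<in> carrier V"
  obtains t where "0 < t" "\<And>s. 0 < s \<Longrightarrow> s \<le> t \<Longrightarrow> (1/2) \<odot> u \<oplus> s \<odot> x \<in> carrier (unit_interval V)"
proof -
  obtain n :: nat where n: "\<ominus> (real n \<odot> u) \<preceq> x" "x \<preceq> real n \<odot> u"
    by (rule order_bounded[OF x])
  obtain K where "coords V x x u K" by (rule ex_coords[of x x u]) (use x in auto)
  note K = coords.K[OF this]
  note K = K(1,4-10)
  \<comment> \<open>The summand 1 keeps the denominator positive when \<open>n\<close> is 0.\<close>
  define t where "t = 1 / (2 * (real n + 1))"
  have "0 < t" by (simp add: t_def)
  moreover have "(1/2) \<odot> u \<oplus> s \<odot> x \<in> carrier (unit_interval V)" if s: "0 < s" "s \<le> t" for s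
  proof -
    have "s * real n \<le> t * real n" using s by (simp add: mult_right_mono)
    also have "\<dots> \<le> 1/2" by (simp add: t_def field_simps)
    finally have sn: "s * real n \<le> 1/2" .
    have "s \<odot> x \<preceq> (s * real n) \<odot> u" using smult_mono[OF n(2), of s] s x by (simp add: K)
    then have "s \<odot> x \<preceq> (1/2) \<odot> u" using leq_trans[OF _ scaled_unit_mono[OF sn]] x by auto
    then have up: "(1/2) \<odot> u \<oplus> s \<odot> x \<preceq> u"
      using leq_iff_same_diff[of "s \<odot> x" "(1/2) \<odot> u" "(1/2) \<odot> u \<oplus> s \<odot> x" u] x by (simp add: K)
    have "(s * real n) \<odot> u \<oplus> s \<odot> x \<preceq> (1/2) \<odot> u \<oplus> s \<odot> x"
      using x sn by (intro add_mono_left scaled_unit_mono) auto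
    moreover have "\<zero> \<preceq> (s * real n) \<odot> u \<oplus> s \<odot> x"
      using n(1) s x leq_iff_scaled_diff[of "\<ominus> (real n \<odot> u)" x \<zero> "(s * real n) \<odot> u \<oplus> s \<odot> x" s] by (simp add: K)
    ultimately have "\<zero> \<preceq> (1/2) \<odot> u \<oplus> s \<odot> x" using leq_trans[of \<zero>] x by auto
    with up x show ?thesis by (simp add: carrier_unit_interval)
  qed
  ultimately show ?thesis by (rule that)
qed

end

lemma unit_interval_faithful:
  assumes "order_unit_space V" "order_unit_space W"
    and f: "f \<in> ous_hom V W" and g: "g \<in> ous_hom V W"
    and eq: "\<And>x. x \<in> carrier (unit_interval V) \<Longrightarrow> f x = g x"
  shows "f = g"
proof (rule extensionalityI)
  interpret V: ous V + W: ous W using assms by (simp_all add: ous_def)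
  show "f \<in> extensional (carrier V)" "g \<in> extensional (carrier V)"
    using ous_homD(1)[OF f] ous_homD(1)[OF g] by (auto simp: PiE_def)
  fix x assume x: "x \<in> carrier V"
  obtain t where t: "0 < t" "(1/2) \<odot>\<^bsub>V\<^esub> unit V \<oplus>\<^bsub>V\<^esub> t \<odot>\<^bsub>V\<^esub> x \<in> carrier (unit_interval V)"
    using V.ex_near_centre[OF x] by (metis order_refl)
  have lin: "h ((1/2) \<odot>\<^bsub>V\<^esub> unit V \<oplus>\<^bsub>V\<^esub> t \<odot>\<^bsub>V\<^esub> x) = (1/2) \<odot>\<^bsub>W\<^esub> unit W \<oplus>\<^bsub>W\<^esub> t \<odot>\<^bsub>W\<^esub> h x"
    if "h \<in> ous_hom V W" for h
    using x by (simp add: ous_homD[OF that])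
  obtain K where "coords W (f x) (g x) (unit W) K"
    by (rule W.ex_coords[of "f x" "g x" "unit W"]) (use x ous_homD(2)[OF f] ous_homD(2)[OF g] in auto)
  note K = coords.K[OF this]
  have "(1/2) \<odot>\<^bsub>W\<^esub> unit W \<oplus>\<^bsub>W\<^esub> t \<odot>\<^bsub>W\<^esub> f x = (1/2) \<odot>\<^bsub>W\<^esub> unit W \<oplus>\<^bsub>W\<^esub> t \<odot>\<^bsub>W\<^esub> g x"
    using eq[OF t(2)] lin[OF f] lin[OF g] by simp
  \<comment> \<open>The affine map that moved \<open>x\<close> into the interval is undone in
    \<open>W\<close>.\<close>
  then have "(1/t) \<odot>\<^bsub>W\<^esub> ((1/2) \<odot>\<^bsub>W\<^esub> unit W \<oplus>\<^bsub>W\<^esub> t \<odot>\<^bsub>W\<^esub> f x \<ominus>\<^bsub>W\<^esub> (1/2) \<odot>\<^bsub>W\<^esub> unit W) =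
      (1/t) \<odot>\<^bsub>W\<^esub> ((1/2) \<odot>\<^bsub>W\<^esub> unit W \<oplus>\<^bsub>W\<^esub> t \<odot>\<^bsub>W\<^esub> g x \<ominus>\<^bsub>W\<^esub> (1/2) \<odot>\<^bsub>W\<^esub> unit W)" by simp
  then show "f x = g x" using t(1) by (simp add: K(1,2,4-10))
qed

text \<open>The extension is read off near the centre of the interval:
  \<open>f x = (h (u/2 + t x) - u/2) / t\<close> for every \<open>t > 0\<close> for which the argument of \<open>h\<close> lies in the
  interval, and any finite number of vectors admits a common \<open>t\<close>.\<close>

lemma unit_interval_full:
  assumes "order_unit_space V" "order_unit_space W"
    and h: "h \<in> emod_hom (unit_interval V) (unit_interval W)"
  shows "\<exists>f \<in> ous_hom V W. restrict f (carrier (unit_interval V)) = h"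
proof -
  interpret V: ous V + W: ous W using assms by (simp_all add: ous_def)
  let ?I = "carrier (unit_interval V)"
  define v where "v = unit V"
  define w where "w = unit W"
  have vc: "v \<in> carrier V" "w \<in> carrier W" by (auto simp: v_def w_def)
  note h' = emod_homD[OF h]
  have hc: "h x \<in> carrier W" if "x \<in> ?I" for x
    using h'(2)[OF that] by (simp add: W.carrier_unit_interval)
  have hpos: "leq W \<zero>\<^bsub>W\<^esub> (h x)" if "x \<in> ?I" for x
    using h'(2)[OF that] by (simp add: W.carrier_unit_interval)
  have hone: "h v = w" using h'(3) by (simp add: V.eone_unit_interval W.eone_unit_interval v_def w_def)
  have hadd: "h (x \<oplus>\<^bsub>V\<^esub> y) = h x \<oplus>\<^bsub>W\<^esub> h y"
    if "x \<in> ?I" "y \<in> ?I" "x \<oplus>\<^bsub>V\<^esub> y \<in> ?I" for x y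
    using h'(4)[OF that(1,2), of "x \<oplus>\<^bsub>V\<^esub> y"] that(3)
    by (simp add: V.osum_unit_interval W.osum_unit_interval V.carrier_unit_interval split: if_splits)
  have hscale: "h (r \<odot>\<^bsub>V\<^esub> x) = r \<odot>\<^bsub>W\<^esub> h x" if "0 \<le> r" "r \<le> 1" "x \<in> ?I" for r x
    using h'(5)[OF that] by (simp add: V.escale_unit_interval W.escale_unit_interval)
  have vI: "r \<odot>\<^bsub>V\<^esub> v \<in> ?I" if "0 \<le> r" "r \<le> 1" for r
    using V.centre_unit_interval[OF that] by (simp add: v_def)
  have vI1: "v \<in> ?I" using V.unit_pos by (simp add: v_def V.carrier_unit_interval)
  have hunit: "h (r \<odot>\<^bsub>V\<^esub> v) = r \<odot>\<^bsub>W\<^esub> w" if "0 \<le> r" "r \<le> 1" for r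
    using hscale[OF that vI1] hone by simp
  define p where "p t x = (1/2) \<odot>\<^bsub>V\<^esub> v \<oplus>\<^bsub>V\<^esub> t \<odot>\<^bsub>V\<^esub> x" for t x
  define g where "g t x = (1/t) \<odot>\<^bsub>W\<^esub> (h (p t x) \<ominus>\<^bsub>W\<^esub> (1/2) \<odot>\<^bsub>W\<^esub> w)" for t x
  have near: "\<exists>t>0. \<forall>s. 0 < s \<longrightarrow> s \<le> t \<longrightarrow> p s x \<in> ?I" if "x \<in> carrier V" for x
    using V.ex_near_centre[OF that] unfolding p_def v_def by metis
  have g_shrink: "g s x = g t x" if x: "x \<in> carrier V" and s: "0 < s" "s \<le> t"
      and pI: "p s x \<in> ?I" "p t x \<in> ?I" for s t x
  proof -
    obtain K where "coords V x x (unit V) K" by (rule V.ex_coords[of x x "unit V"]) (use x in auto)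
    note K = coords.K[OF this]
    note K = K(1,4-10)
    let ?l = "s / t"
    have t0: "0 < t" using s by simp
    have l: "0 \<le> ?l" "?l \<le> 1" using s by auto
    have l'0: "0 \<le> (1 - ?l) / 2" using l by simp
    have l'1: "(1 - ?l) / 2 \<le> 1" using order_trans[of "- 1" 0 ?l] l by simp
    note l' = l'0 l'1
    \<comment> \<open>The point for \<open>s\<close> lies on the segment from the centre to the
      point for \<open>t\<close>, so \<open>h\<close> is determined there by its additivity and
      homogeneity on the interval.\<close>
    have ps: "p s x = ?l \<odot>\<^bsub>V\<^esub> p t x \<oplus>\<^bsub>V\<^esub> ((1 - ?l) / 2) \<odot>\<^bsub>V\<^esub> v"
      using s by (simp add: p_def v_def K field_simps)
    have "h (p s x) = h (?l \<odot>\<^bsub>V\<^esub> p t x) \<oplus>\<^bsub>W\<^esub> h (((1 - ?l) / 2) \<odot>\<^bsub>V\<^esub> v)"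
      using hadd[OF V.unit_interval_scale[OF pI(2) l] vI[OF l']] pI(1) by (simp only: ps)
    then have hp: "h (p s x) = ?l \<odot>\<^bsub>W\<^esub> h (p t x) \<oplus>\<^bsub>W\<^esub> ((1 - ?l) / 2) \<odot>\<^bsub>W\<^esub> w"
      using hscale[OF l pI(2)] hunit[OF l'] by simp
    obtain L where "coords W (h (p t x)) (h (p t x)) (unit W) L"
      by (rule W.ex_coords[of "h (p t x)" "h (p t x)" "unit W"]) (use hc pI in auto)
    note L = coords.K[OF this]
    note L = L(1,4-10)
    have "((1 - s / t) / 2 - 1 / 2) / s = - (1 / (t * 2))" using s t0 by (simp add: field_simps)
    then show ?thesis unfolding g_def hp using s t0 by (simp add: w_def L)
  qed
  have g_indep: "g s x = g t x" if "x \<in> carrier V" "0 < s" "0 < t" "p s x \<in> ?I" "p t x \<in> ?I" for s t x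
  proof (cases "s \<le> t")
    case True
    then show ?thesis using that by (intro g_shrink) auto
  next
    case False
    then show ?thesis using that by (intro g_shrink[symmetric]) auto
  qed
  \<comment> \<open>An arbitrary admissible parameter; \<open>g_indep\<close> makes the choice
    irrelevant, and \<open>f_eq\<close> then allows any parameter that suits an argument.\<close>
  define T where "T x = (SOME t. 0 < t \<and> p t x \<in> ?I)" for x
  define f where "f = restrict (\<lambda>x. g (T x) x) (carrier V)"
  have f_eq: "f x = g t x" if "x \<in> carrier V" "0 < t" "p t x \<in> ?I" for x t
  proof -
    have "0 < T x \<and> p (T x) x \<in> ?I" unfolding T_def by (rule someI[of _ t]) (use that in auto)
    then show ?thesis using g_indep[of x "T x" t] that by (simp add: f_def)
  qed
  have pc: "p t x \<in> carrier V" if "x \<in> carrier V" for t x using that vc by (simp add: p_def)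
  have gc: "g t x \<in> carrier W" if "p t x \<in> ?I" for t x using hc[OF that] vc by (simp add: g_def)
  have fc: "f x \<in> carrier W" if x: "x \<in> carrier V" for x
    using near[OF x] f_eq[OF x] gc by (metis order_refl)
  have f_add: "f (x \<oplus>\<^bsub>V\<^esub> y) = f x \<oplus>\<^bsub>W\<^esub> f y" if x: "x \<in> carrier V" and y: "y \<in> carrier V" for x y
  proof -
    obtain a where a: "a > 0" "\<And>s. 0 < s \<Longrightarrow> s \<le> a \<Longrightarrow> p s x \<in> ?I" using near[OF x] by blast
    obtain b where b: "b > 0" "\<And>s. 0 < s \<Longrightarrow> s \<le> b \<Longrightarrow> p s y \<in> ?I" using near[OF y] by blast
    obtain c where c: "c > 0" "\<And>s. 0 < s \<Longrightarrow> s \<le> c \<Longrightarrow> p s (x \<oplus>\<^bsub>V\<^esub> y) \<in> ?I"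
      using near[OF V.a_closed[OF x y]] by blast
    define t where "t = min (min a b) c"
    have t: "0 < t" "p t x \<in> ?I" "p t y \<in> ?I" "p (t/2) (x \<oplus>\<^bsub>V\<^esub> y) \<in> ?I"
      using a b c by (auto simp: t_def)
    obtain K where "coords V x y (unit V) K" by (rule V.ex_coords[of x y "unit V"]) (use x y in auto)
    note K = coords.K[OF this]
    note K = K(1,2,4-10)
    \<comment> \<open>Halving the parameter for the sum turns its point into the midpoint of the
      points of the summands, a sum that is defined in the interval.\<close>
    have ps: "p (t/2) (x \<oplus>\<^bsub>V\<^esub> y) = (1/2) \<odot>\<^bsub>V\<^esub> p t x \<oplus>\<^bsub>V\<^esub> (1/2) \<odot>\<^bsub>V\<^esub> p t y"
      by (simp add: p_def v_def K)
    have hp: "h (p (t/2) (x \<oplus>\<^bsub>V\<^esub> y)) = (1/2) \<odot>\<^bsub>W\<^esub> h (p t x) \<oplus>\<^bsub>W\<^esub> (1/2) \<odot>\<^bsub>W\<^esub> h (p t y)"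
      using hadd[of "(1/2) \<odot>\<^bsub>V\<^esub> p t x" "(1/2) \<odot>\<^bsub>V\<^esub> p t y"] t(2-4) hscale[of "1/2"] V.unit_interval_scale[of _ "1/2"]
      by (simp add: ps)
    obtain L where "coords W (h (p t x)) (h (p t y)) (unit W) L"
      by (rule W.ex_coords[of "h (p t x)" "h (p t y)" "unit W"]) (use hc t in auto)
    note L = coords.K[OF this]
    note L = L(1,2,4-10)
    have "f (x \<oplus>\<^bsub>V\<^esub> y) = g (t/2) (x \<oplus>\<^bsub>V\<^esub> y)" using f_eq t x y by simp
    also have "\<dots> = g t x \<oplus>\<^bsub>W\<^esub> g t y"
      unfolding g_def hp using t(1) by (simp add: w_def L field_simps)
    also have "\<dots> = f x \<oplus>\<^bsub>W\<^esub> f y" using f_eq t x y by simp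
    finally show ?thesis .
  qed
  have f_pos_scale: "f (r \<odot>\<^bsub>V\<^esub> x) = r \<odot>\<^bsub>W\<^esub> f x" if x: "x \<in> carrier V" and r: "0 < r" for x r
  proof -
    obtain a where a: "a > 0" "\<And>s. 0 < s \<Longrightarrow> s \<le> a \<Longrightarrow> p s x \<in> ?I" using near[OF x] by blast
    then have pa: "p a x \<in> ?I" by simp
    obtain K where "coords V x x (unit V) K" by (rule V.ex_coords[of x x "unit V"]) (use x in auto)
    note K = coords.K[OF this]
    note K = K(1,4-10)
    \<comment> \<open>Scaling the vector by \<open>r\<close> and the parameter by
      \<open>1 / r\<close> leaves the interval point unchanged.\<close>
    have eq: "p (a/r) (r \<odot>\<^bsub>V\<^esub> x) = p a x" using r by (simp add: p_def v_def K)
    obtain L where "coords W (h (p a x)) (h (p a x)) (unit W) L"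
      by (rule W.ex_coords[of "h (p a x)" "h (p a x)" "unit W"]) (use hc pa in auto)
    note L = coords.K[OF this]
    note L = L(1,4-10)
    have "f (r \<odot>\<^bsub>V\<^esub> x) = g (a/r) (r \<odot>\<^bsub>V\<^esub> x)" using f_eq[of "r \<odot>\<^bsub>V\<^esub> x" "a/r"] eq pa a r x by simp
    also have "\<dots> = r \<odot>\<^bsub>W\<^esub> g a x" unfolding g_def eq using r a by (simp add: w_def L field_simps)
    also have "\<dots> = r \<odot>\<^bsub>W\<^esub> f x" using f_eq pa a x by simp
    finally show ?thesis .
  qed
  have f0: "f \<zero>\<^bsub>V\<^esub> = \<zero>\<^bsub>W\<^esub>"
  proof -
    have "f \<zero>\<^bsub>V\<^esub> = f \<zero>\<^bsub>V\<^esub> \<oplus>\<^bsub>W\<^esub> f \<zero>\<^bsub>V\<^esub>" using f_add[of "\<zero>\<^bsub>V\<^esub>" "\<zero>\<^bsub>V\<^esub>"] by simp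
    then show ?thesis using W.add.r_cancel_one'[of "f \<zero>\<^bsub>V\<^esub>" "f \<zero>\<^bsub>V\<^esub>"] fc by simp
  qed
  have f_scale: "f (r \<odot>\<^bsub>V\<^esub> x) = r \<odot>\<^bsub>W\<^esub> f x" if x: "x \<in> carrier V" for x r
  proof -
    obtain K where "coords V x x (unit V) K" by (rule V.ex_coords[of x x "unit V"]) (use x in auto)
    note K = coords.K[OF this]
    note K = K(1,4-10)
    obtain L where "coords W (f x) (f (r \<odot>\<^bsub>V\<^esub> x)) (unit W) L"
      by (rule W.ex_coords[of "f x" "f (r \<odot>\<^bsub>V\<^esub> x)" "unit W"]) (use fc x in auto)
    note L = coords.K[OF this]
    consider "r > 0" | "r = 0" | "r < 0" by linarith
    then show ?thesis
    proof cases
      case 1 then show ?thesis by (rule f_pos_scale[OF x])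
    next
      case 2
      have "0 \<odot>\<^bsub>V\<^esub> x = \<zero>\<^bsub>V\<^esub>" "0 \<odot>\<^bsub>W\<^esub> f x = \<zero>\<^bsub>W\<^esub>" 
        using V.smult_l_null[OF x] W.smult_l_null[OF fc[OF x]] by (simp_all add: real_scalars_def)
      then show ?thesis using f0 2 by simp
    next
      case 3
      \<comment> \<open>For negative \<open>r\<close> the multiple by \<open>-r\<close> has a
        positive factor, and the two multiples add up to zero.\<close>
      have "f (r \<odot>\<^bsub>V\<^esub> x) \<oplus>\<^bsub>W\<^esub> (-r) \<odot>\<^bsub>W\<^esub> f x = f (r \<odot>\<^bsub>V\<^esub> x \<oplus>\<^bsub>V\<^esub> (-r) \<odot>\<^bsub>V\<^esub> x)"
        using 3 x by (simp add: f_add f_pos_scale)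
      also have "r \<odot>\<^bsub>V\<^esub> x \<oplus>\<^bsub>V\<^esub> (-r) \<odot>\<^bsub>V\<^esub> x = \<zero>\<^bsub>V\<^esub>" by (simp add: K)
      finally have "f (r \<odot>\<^bsub>V\<^esub> x) \<oplus>\<^bsub>W\<^esub> (-r) \<odot>\<^bsub>W\<^esub> f x = \<zero>\<^bsub>W\<^esub>" using f0 by simp
      then have "f (r \<odot>\<^bsub>V\<^esub> x) \<oplus>\<^bsub>W\<^esub> (-r) \<odot>\<^bsub>W\<^esub> f x \<oplus>\<^bsub>W\<^esub> r \<odot>\<^bsub>W\<^esub> f x = \<zero>\<^bsub>W\<^esub> \<oplus>\<^bsub>W\<^esub> r \<odot>\<^bsub>W\<^esub> f x" by simp
      then show ?thesis by (simp add: L(1,2,4-10))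
    qed
  qed
  have f_pos: "leq W \<zero>\<^bsub>W\<^esub> (f x)" if x: "x \<in> carrier V" "leq V \<zero>\<^bsub>V\<^esub> x" for x
  proof -
    obtain a where a: "a > 0" "\<And>s. 0 < s \<Longrightarrow> s \<le> a \<Longrightarrow> p s x \<in> ?I" using near[OF x(1)] by blast
    then have pa: "p a x \<in> ?I" by simp
    have pos: "leq V \<zero>\<^bsub>V\<^esub> (a \<odot>\<^bsub>V\<^esub> x)" 
    proof -
      have "a \<odot>\<^bsub>V\<^esub> \<zero>\<^bsub>V\<^esub> = \<zero>\<^bsub>V\<^esub>" using V.smult_r_null[of a] by (simp add: real_scalars_def)
      then show ?thesis using V.smult_mono[OF x(2), of a] a x by simp
    qed
    \<comment> \<open>For positive \<open>x\<close> the multiple by \<open>a\<close> is itself in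
      the interval, so \<open>h\<close> splits at the sum with half the unit and \<open>f x\<close>
      becomes a positive multiple of a value of \<open>h\<close>.\<close>
    have "a \<odot>\<^bsub>V\<^esub> x \<oplus>\<^bsub>V\<^esub> (1/2) \<odot>\<^bsub>V\<^esub> v = p a x" using x vc by (simp add: p_def V.a_comm)
    then have "leq V (a \<odot>\<^bsub>V\<^esub> x) (unit V)"
      using V.add_leqD[of "a \<odot>\<^bsub>V\<^esub> x" "(1/2) \<odot>\<^bsub>V\<^esub> v" "unit V"] pa vI[of "1/2"] x
      by (simp add: V.carrier_unit_interval)
    then have ax: "a \<odot>\<^bsub>V\<^esub> x \<in> ?I" using pos x by (simp add: V.carrier_unit_interval)
    have hp: "h (p a x) = (1/2) \<odot>\<^bsub>W\<^esub> w \<oplus>\<^bsub>W\<^esub> h (a \<odot>\<^bsub>V\<^esub> x)"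
      unfolding p_def using hadd[OF vI[of "1/2"] ax] pa hunit[of "1/2"] by (simp add: p_def)
    obtain L where "coords W (h (a \<odot>\<^bsub>V\<^esub> x)) (h (a \<odot>\<^bsub>V\<^esub> x)) (unit W) L"
      by (rule W.ex_coords[of "h (a \<odot>\<^bsub>V\<^esub> x)" "h (a \<odot>\<^bsub>V\<^esub> x)" "unit W"]) (use hc ax in auto)
    note L = coords.K[OF this]
    note L = L(1,4-10)
    have "f x = (1/a) \<odot>\<^bsub>W\<^esub> h (a \<odot>\<^bsub>V\<^esub> x)"
      using f_eq[OF x(1) a(1) pa] a by (simp add: g_def hp w_def L)
    then show ?thesis
      using W.smult_mono[OF hpos[OF ax], of "1/a"] a hc[OF ax] W.smult_r_null[of "1/a"]
      by (simp add: real_scalars_def)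
  qed
  have f_mono: "leq W (f x) (f y)" if x: "x \<in> carrier V" and y: "y \<in> carrier V" and le: "leq V x y" for x y
  proof -
    obtain K where "coords V x y (unit V) K" by (rule V.ex_coords[of x y "unit V"]) (use x y in auto)
    note K = coords.K[OF this]
    obtain L where "coords W (f x) (f y) (unit W) L"
      by (rule W.ex_coords[of "f x" "f y" "unit W"]) (use fc x y in auto)
    note L = coords.K[OF this]
    have "y \<ominus>\<^bsub>V\<^esub> x = y \<oplus>\<^bsub>V\<^esub> (-1) \<odot>\<^bsub>V\<^esub> x" by (simp add: K(1,2,4-10))
    then have "f (y \<ominus>\<^bsub>V\<^esub> x) = f y \<oplus>\<^bsub>W\<^esub> (-1) \<odot>\<^bsub>W\<^esub> f x" using x y by (simp add: f_add f_scale)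
    also have "\<dots> = f y \<ominus>\<^bsub>W\<^esub> f x" by (simp add: L(1,2,4-10))
    finally show ?thesis
      using f_pos[of "y \<ominus>\<^bsub>V\<^esub> x"] le x y V.leq_iff_diff W.leq_iff_diff fc by simp
  qed
  have f_I: "f x = h x" if x: "x \<in> ?I" for x
  proof -
    have xV: "x \<in> carrier V" using x by (simp add: V.carrier_unit_interval)
    obtain K where "coords V x x (unit V) K" by (rule V.ex_coords[of x x "unit V"]) (use xV in auto)
    note K = coords.K[OF this]
    note K = K(1,4-10)
    \<comment> \<open>On the interval the parameter 1/2 is always admissible: the mean of
      \<open>v\<close> and an interval point is again in the interval.\<close>
    have "leq V ((1/2) \<odot>\<^bsub>V\<^esub> x) ((1/2) \<odot>\<^bsub>V\<^esub> v)"
      using V.smult_mono[of x v "1/2"] x vc by (simp add: V.carrier_unit_interval v_def)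
    from V.add_mono[OF V.leq_refl this, of "(1/2) \<odot>\<^bsub>V\<^esub> v"] have "leq V (p (1/2) x) (unit V)"
      using vc xV by (simp add: p_def v_def K)
    then have half: "(1/2) \<odot>\<^bsub>V\<^esub> x \<in> ?I" and le: "leq V ((1/2) \<odot>\<^bsub>V\<^esub> v \<oplus>\<^bsub>V\<^esub> (1/2) \<odot>\<^bsub>V\<^esub> x) (unit V)"
      using V.unit_interval_scale[OF x, of "1/2"] by (simp_all add: p_def)
    have pI: "p (1/2) x \<in> ?I"
      using effect_algebra_closed[OF V.effect_algebra_unit_interval vI[of "1/2"] half] le
      by (simp add: V.osum_unit_interval p_def)
    have hp: "h (p (1/2) x) = (1/2) \<odot>\<^bsub>W\<^esub> w \<oplus>\<^bsub>W\<^esub> (1/2) \<odot>\<^bsub>W\<^esub> h x"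
      using hadd[OF vI[of "1/2"] half] pI hunit[of "1/2"] hscale[of "1/2" x] x by (simp add: p_def)
    obtain L where "coords W (h x) (h x) (unit W) L"
      by (rule W.ex_coords[of "h x" "h x" "unit W"]) (use hc x in auto)
    note L = coords.K[OF this]
    note L = L(1,4-10)
    show ?thesis using f_eq[OF xV _ pI] by (simp add: g_def hp w_def L)
  qed
  have "f \<in> ous_hom V W"
    unfolding ous_hom_def
    using fc f_add f_scale f_mono f_I[OF vI1] hone by (auto simp: f_def v_def w_def)
  moreover have "restrict f ?I = h"
    using f_I h'(1) by (auto simp: fun_eq_iff restrict_def PiE_def extensional_def)
  ultimately show ?thesis by blast
qed

lemma bij_betw_unit_interval:
  assumes "order_unit_space V" "order_unit_space W"
  shows "bij_betw (\<lambda>f. restrict f (carrier (unit_interval V))) (ous_hom V W)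
    (emod_hom (unit_interval V) (unit_interval W))"
  unfolding bij_betw_def
proof (intro conjI inj_onI subset_antisym subsetI)
  fix f g assume f: "f \<in> ous_hom V W" and g: "g \<in> ous_hom V W"
    and "restrict f (carrier (unit_interval V)) = restrict g (carrier (unit_interval V))"
  then have "f x = g x" if "x \<in> carrier (unit_interval V)" for x
    using that by (metis restrict_apply')
  then show "f = g" by (rule unit_interval_faithful[OF assms f g])
next
  fix h assume "h \<in> (\<lambda>f. restrict f (carrier (unit_interval V))) ` ous_hom V W"
  then show "h \<in> emod_hom (unit_interval V) (unit_interval W)"
    using is_functor_unit_interval assms
    by (auto simp: is_functor_def unit_interval_functor_def OUS_def Hom_AEMod)
next
  fix h assume "h \<in> emod_hom (unit_interval V) (unit_interval W)"
  from unit_interval_full[OF assms this]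
  obtain f where "f \<in> ous_hom V W" "restrict f (carrier (unit_interval V)) = h" by blast
  then show "h \<in> (\<lambda>f. restrict f (carrier (unit_interval V))) ` ous_hom V W" by (intro image_eqI) simp_all
qed

section \<open>Calculus in an effect module\<close>

locale effmod =
  fixes E :: "'a effect_structure"
  assumes effect_module: "effect_module E"
begin

lemmas effect_algebra = effect_module_algebra[OF effect_module]

abbreviation ez where "ez \<equiv> ezero E"
abbreviation e1 where "e1 \<equiv> eone E"
abbreviation le (infix \<open>\<sqsubseteq>\<close> 50) where "x \<sqsubseteq> y \<equiv> ele E x y"

lemma osum_comm: "x \<in> carrier E \<Longrightarrow> y \<in> carrier E \<Longrightarrow> osum E x y = osum E y x"
  by (rule effect_algebra[unfolded effect_algebra_def, THEN conjunct2, THEN conjunct1, rule_format])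

lemma osum_assoc:
  "x \<in> carrier E \<Longrightarrow> y \<in> carrier E \<Longrightarrow> z \<in> carrier E \<Longrightarrow>
    Option.bind (osum E x y) (\<lambda>s. osum E s z) = Option.bind (osum E y z) (\<lambda>s. osum E x s)"
  by (rule effect_algebra[unfolded effect_algebra_def, THEN conjunct2, THEN conjunct2, THEN conjunct1,
        rule_format])

lemma zero_closed [simp]: "ez \<in> carrier E"
  by (rule effect_algebra[unfolded effect_algebra_def, THEN conjunct2, THEN conjunct2, THEN conjunct2, THEN conjunct1])

lemma osum_zero: "x \<in> carrier E \<Longrightarrow> osum E ez x = Some x"
  by (rule effect_algebra[unfolded effect_algebra_def, THEN conjunct2, THEN conjunct2, THEN conjunct2, THEN conjunct2, THEN conjunct1, THEN bspec])

lemma ortho_closed [simp]: "x \<in> carrier E \<Longrightarrow> ortho E x \<in> carrier E"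
  by (rule effect_algebra[unfolded effect_algebra_def, THEN conjunct2, THEN conjunct2, THEN conjunct2, THEN conjunct2, THEN conjunct2, THEN conjunct1, THEN bspec, THEN conjunct1])

lemma osum_eq_one_iff:
  "x \<in> carrier E \<Longrightarrow> y \<in> carrier E \<Longrightarrow> osum E x y = Some e1 \<longleftrightarrow> y = ortho E x"
  by (rule effect_algebra[unfolded effect_algebra_def, THEN conjunct2, THEN conjunct2, THEN conjunct2, THEN conjunct2, THEN conjunct2, THEN conjunct1, THEN bspec, THEN conjunct2, THEN bspec])

lemma osum_one: "x \<in> carrier E \<Longrightarrow> osum E x e1 \<noteq> None \<Longrightarrow> x = ez"
  by (rule effect_algebra[unfolded effect_algebra_def, THEN conjunct2, THEN conjunct2, THEN conjunct2, THEN conjunct2, THEN conjunct2, THEN conjunct2, rule_format])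

lemma one_closed [simp]: "e1 \<in> carrier E"
  by (rule eone_closed[OF effect_algebra])

lemma scale_closed: "x \<in> carrier E \<Longrightarrow> 0 \<le> r \<Longrightarrow> r \<le> 1 \<Longrightarrow> escale E r x \<in> carrier E"
  by (rule escale_closed[OF effect_module])

lemma scale_one: "x \<in> carrier E \<Longrightarrow> escale E 1 x = x"
  using effect_module unfolding effect_module_def by (elim conjE) (erule bspec)

lemma scale_scale:
  "x \<in> carrier E \<Longrightarrow> 0 \<le> r \<Longrightarrow> r \<le> 1 \<Longrightarrow> 0 \<le> s \<Longrightarrow> s \<le> 1 \<Longrightarrow>
    escale E r (escale E s x) = escale E (r * s) x"
  by (rule effect_module[unfolded effect_module_def, THEN conjunct2, THEN conjunct2, THEN conjunct2,
        THEN conjunct1, rule_format, symmetric]) auto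

lemma scale_add:
  "x \<in> carrier E \<Longrightarrow> 0 \<le> r \<Longrightarrow> 0 \<le> s \<Longrightarrow> r + s \<le> 1 \<Longrightarrow>
    osum E (escale E r x) (escale E s x) = Some (escale E (r + s) x)"
  by (rule effect_module[unfolded effect_module_def, THEN conjunct2, THEN conjunct2, THEN conjunct2,
        THEN conjunct2, THEN conjunct1, rule_format]) auto

lemma scale_osum:
  "x \<in> carrier E \<Longrightarrow> y \<in> carrier E \<Longrightarrow> 0 \<le> r \<Longrightarrow> r \<le> 1 \<Longrightarrow> osum E x y = Some z \<Longrightarrow>
    osum E (escale E r x) (escale E r y) = Some (escale E r z)"
  by (rule effect_module[unfolded effect_module_def, THEN conjunct2, THEN conjunct2, THEN conjunct2,
        THEN conjunct2, THEN conjunct2, rule_format]) auto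

text \<open>Adjoining \<^term>\<open>None\<close> as an absorbing element turns the partial sum into a total commutative
  semigroup, in which sums can be rearranged without definedness conditions.\<close>

definition pl :: "'a option \<Rightarrow> 'a option \<Rightarrow> 'a option" (infixl \<open>\<boxplus>\<close> 65) where
  "a \<boxplus> b = (case a of None \<Rightarrow> None | Some x \<Rightarrow> (case b of None \<Rightarrow> None | Some y \<Rightarrow>
     if x \<in> carrier E \<and> y \<in> carrier E then osum E x y else None))"

lemma pl_None [simp]: "a \<boxplus> None = None" "None \<boxplus> a = None"
  by (auto simp: pl_def split: option.splits)

lemma pl_Some: "x \<in> carrier E \<Longrightarrow> y \<in> carrier E \<Longrightarrow> Some x \<boxplus> Some y = osum E x y"
  by (simp add: pl_def)

lemma pl_SomeD:
  assumes "a \<boxplus> b = Some z"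
  obtains x y where "a = Some x" "b = Some y" "x \<in> carrier E" "y \<in> carrier E" "osum E x y = Some z"
    "z \<in> carrier E"
proof (cases a)
  case (Some x)
  show ?thesis
  proof (cases b)
    case (Some y)
    have "x \<in> carrier E \<and> y \<in> carrier E" "osum E x y = Some z"
      using assms \<open>a = Some x\<close> Some by (simp_all add: pl_def split: if_splits)
    then show ?thesis using effect_algebra_closed[OF effect_algebra] \<open>a = Some x\<close> Some that by metis
  qed (use assms in simp)
qed (use assms in simp)

sublocale pl: abel_semigroup pl
proof
  fix a b c
  show "a \<boxplus> b = b \<boxplus> a" using osum_comm by (auto simp: pl_def split: option.splits)
  show "a \<boxplus> b \<boxplus> c = a \<boxplus> (b \<boxplus> c)"
  \<comment> \<open>For three elements of the carrier this is the associativity axiom; in every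
    other case both sides are \<open>None\<close>, since \<open>\<boxplus>\<close> rejects values
    off the carrier.\<close>
  proof (cases "\<exists>x \<in> carrier E. \<exists>y \<in> carrier E. \<exists>z \<in> carrier E. a = Some x \<and> b = Some y \<and> c = Some z")
    case True
    then obtain x y z where *: "a = Some x" "b = Some y" "c = Some z"
      "x \<in> carrier E" "y \<in> carrier E" "z \<in> carrier E" by blast
    have "a \<boxplus> b \<boxplus> c = Option.bind (osum E x y) (\<lambda>s. osum E s z)"
      using * effect_algebra_closed[OF effect_algebra, of x y]
      by (cases "osum E x y") (auto simp: pl_def)
    also have "\<dots> = Option.bind (osum E y z) (\<lambda>s. osum E x s)" by (rule osum_assoc) (use * in auto)
    also have "\<dots> = a \<boxplus> (b \<boxplus> c)"
      using * effect_algebra_closed[OF effect_algebra, of y z]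
      by (cases "osum E y z") (auto simp: pl_def)
    finally show ?thesis .
  next
    case False
    have "a \<boxplus> b \<boxplus> c = None"
    proof (rule ccontr)
      assume "a \<boxplus> b \<boxplus> c \<noteq> None"
      then obtain w where "a \<boxplus> b \<boxplus> c = Some w" by auto
      then obtain s z where "a \<boxplus> b = Some s" "c = Some z" "z \<in> carrier E" by (rule pl_SomeD)
      moreover from this(1) obtain x y where "a = Some x" "b = Some y" "x \<in> carrier E" "y \<in> carrier E"
        by (rule pl_SomeD)
      ultimately show False using False by blast
    qed
    moreover have "a \<boxplus> (b \<boxplus> c) = None"
    proof (rule ccontr)
      assume "a \<boxplus> (b \<boxplus> c) \<noteq> None"
      then obtain w where "a \<boxplus> (b \<boxplus> c) = Some w" by auto
      then obtain x s where "a = Some x" "b \<boxplus> c = Some s" "x \<in> carrier E" by (rule pl_SomeD)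
      moreover from this(2) obtain y z where "b = Some y" "c = Some z" "y \<in> carrier E" "z \<in> carrier E"
        by (rule pl_SomeD)
      ultimately show False using False by blast
    qed
    ultimately show ?thesis by simp
  qed
qed

lemmas pl_ac = pl.assoc pl.commute pl.left_commute

lemma pl_swap: "(a \<boxplus> b) \<boxplus> (c \<boxplus> d) = (a \<boxplus> c) \<boxplus> (b \<boxplus> d)"
  by (simp add: pl_ac)

lemma ele_iff: "x \<in> carrier E \<Longrightarrow> x \<sqsubseteq> y \<longleftrightarrow> (\<exists>z \<in> carrier E. Some y = Some x \<boxplus> Some z)"
  unfolding ele_def using pl_Some by metis

lemma pl_eq_one_iff: "x \<in> carrier E \<Longrightarrow> y \<in> carrier E \<Longrightarrow> Some x \<boxplus> Some y = Some e1 \<longleftrightarrow> y = ortho E x"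
  by (simp add: pl_Some osum_eq_one_iff)

lemma pl_ortho: "x \<in> carrier E \<Longrightarrow> Some x \<boxplus> Some (ortho E x) = Some e1"
  using pl_eq_one_iff by simp

text \<open>Cancellation comes from uniqueness of complements: after adding the complement of
  \<open>z\<close>, both \<open>x\<close> and \<open>y\<close> are the complement of the same
  element \<open>k\<close>.\<close>

lemma pl_cancel:
  assumes "Some x \<boxplus> c = Some z" "Some y \<boxplus> c = Some z"
  shows "x = y"
proof -
  obtain w where c: "c = Some w" "w \<in> carrier E" "x \<in> carrier E" and z: "z \<in> carrier E"
    using assms(1) by (rule pl_SomeD) auto
  have y: "y \<in> carrier E" using assms(2) by (rule pl_SomeD) auto
  have "Some v \<boxplus> (c \<boxplus> Some (ortho E z)) = Some e1" if "Some v \<boxplus> c = Some z" for v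
    using pl_ortho[OF z] that by (simp add: pl.assoc[symmetric])
  note 1 = this[OF assms(1)] and 2 = this[OF assms(2)]
  from 1 obtain k where k: "c \<boxplus> Some (ortho E z) = Some k" "k \<in> carrier E" by (rule pl_SomeD) auto
  have "x = ortho E k" "y = ortho E k"
    using 1 2 pl_eq_one_iff[of k x] pl_eq_one_iff[of k y] k c y by (simp_all add: pl.commute)
  then show ?thesis by simp
qed

lemma ortho_ortho: "x \<in> carrier E \<Longrightarrow> ortho E (ortho E x) = x"
  using pl_ortho[of x] pl_eq_one_iff[of "ortho E x" x] by (simp add: pl.commute)

lemma pl_zero: "x \<in> carrier E \<Longrightarrow> Some ez \<boxplus> Some x = Some x"
  by (simp add: pl_Some osum_zero)

lemma le_refl [simp]: "x \<in> carrier E \<Longrightarrow> x \<sqsubseteq> x"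
proof -
  assume x: "x \<in> carrier E"
  have "Some x = Some x \<boxplus> Some ez" using pl_zero[OF x] pl.commute by metis
  then show ?thesis unfolding ele_iff[OF x] using zero_closed by blast
qed

lemma le_closed: "x \<in> carrier E \<Longrightarrow> x \<sqsubseteq> y \<Longrightarrow> y \<in> carrier E"
  unfolding ele_def using effect_algebra_closed[OF effect_algebra] by blast

lemma le_trans:
  assumes "x \<sqsubseteq> y" "y \<sqsubseteq> z" "x \<in> carrier E"
  shows "x \<sqsubseteq> z"
proof -
  obtain a where a: "Some y = Some x \<boxplus> Some a" using assms ele_iff by blast
  obtain b where "Some z = Some y \<boxplus> Some b" using assms le_closed ele_iff by blast
  with a have z: "Some z = Some x \<boxplus> (Some a \<boxplus> Some b)" by (simp add: pl.assoc)
  then have "Some x \<boxplus> (Some a \<boxplus> Some b) = Some z" by simp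
  then obtain w where "Some a \<boxplus> Some b = Some w" "w \<in> carrier E" by (rule pl_SomeD) auto
  with z assms(3) show ?thesis using ele_iff by auto
qed

text \<open>Adding 1 to both sides shows that \<open>y\<close> plus 1 is defined, which the last
  axiom of effect algebras permits for zero only.\<close>

lemma pl_eq_zero:
  assumes "x \<in> carrier E" "y \<in> carrier E" "Some x \<boxplus> Some y = Some ez"
  shows "y = ez"
proof -
  have "Some x \<boxplus> (Some y \<boxplus> Some e1) = Some e1"
    using assms(3) pl_zero[of e1] by (simp add: pl.assoc[symmetric])
  then obtain w where "Some y \<boxplus> Some e1 = Some w" by (rule pl_SomeD) auto
  then show ?thesis using osum_one assms by (simp add: pl_Some)
qed

lemma le_antisym:
  assumes "x \<sqsubseteq> y" "y \<sqsubseteq> x" "x \<in> carrier E"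
  shows "x = y"
proof -
  obtain a where a: "a \<in> carrier E" "Some y = Some x \<boxplus> Some a" using assms ele_iff by blast
  obtain b where b: "b \<in> carrier E" "Some x = Some y \<boxplus> Some b" using assms le_closed ele_iff by blast
  have "Some x \<boxplus> (Some a \<boxplus> Some b) = Some x" using a b by (simp add: pl.assoc[symmetric])
  moreover from this obtain w where w: "Some a \<boxplus> Some b = Some w" "w \<in> carrier E" by (rule pl_SomeD) auto
  ultimately have "Some w \<boxplus> Some x = Some x" by (simp add: pl.commute)
  from pl_cancel[OF this pl_zero[OF assms(3)]] have "a = ez"
    using pl_eq_zero[of b a] a b w by (simp add: pl.commute)
  then show ?thesis using a pl_zero[OF assms(3)] by (simp add: pl.commute)
qed

lemma zero_le: "x \<in> carrier E \<Longrightarrow> ez \<sqsubseteq> x"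
  using pl_zero ele_iff[of ez x] by auto

lemma le_one: "x \<in> carrier E \<Longrightarrow> x \<sqsubseteq> e1"
  using pl_ortho[of x] ele_iff[of x e1] ortho_closed by metis

text \<open>Illegal scalings become \<open>None\<close>, so that scaled elements can enter sums
  under \<open>\<boxplus>\<close> without separate side conditions on definedness.\<close>

definition sc :: "real \<Rightarrow> 'a \<Rightarrow> 'a option" where
  "sc r x = (if 0 \<le> r \<and> r \<le> 1 \<and> x \<in> carrier E then Some (escale E r x) else None)"

lemma sc_Some: "x \<in> carrier E \<Longrightarrow> 0 \<le> r \<Longrightarrow> r \<le> 1 \<Longrightarrow> sc r x = Some (escale E r x)"
  by (simp add: sc_def)

lemma sc_one: "x \<in> carrier E \<Longrightarrow> sc 1 x = Some x"
  by (simp add: sc_Some scale_one)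

lemma sc_add: "x \<in> carrier E \<Longrightarrow> 0 \<le> r \<Longrightarrow> 0 \<le> s \<Longrightarrow> r + s \<le> 1 \<Longrightarrow> sc r x \<boxplus> sc s x = sc (r + s) x"
  by (simp add: sc_Some pl_Some scale_closed scale_add)

lemma sc_scale:
  "x \<in> carrier E \<Longrightarrow> 0 \<le> r \<Longrightarrow> r \<le> 1 \<Longrightarrow> 0 \<le> s \<Longrightarrow> s \<le> 1 \<Longrightarrow> sc r (escale E s x) = sc (r * s) x"
  by (simp add: sc_Some scale_closed scale_scale mult_le_one)

lemma sc_pl:
  assumes "Some z = Some x \<boxplus> Some y" "0 \<le> r" "r \<le> 1"
  shows "sc r z = sc r x \<boxplus> sc r y"
proof -
  have "Some x \<boxplus> Some y = Some z" using assms(1) by simp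
  then have *: "x \<in> carrier E" "y \<in> carrier E" "osum E x y = Some z" "z \<in> carrier E"
    by (rule pl_SomeD; simp)+
  then show ?thesis using assms(2,3) scale_osum[of x y r z] by (simp add: sc_Some pl_Some scale_closed)
qed

lemma sc_ortho: "x \<in> carrier E \<Longrightarrow> 0 \<le> r \<Longrightarrow> r \<le> 1 \<Longrightarrow> sc r x \<boxplus> sc r (ortho E x) = sc r e1"
  using sc_pl[of e1 x "ortho E x" r] pl_ortho[of x] by simp

definition cc :: "real \<Rightarrow> 'a \<Rightarrow> real \<Rightarrow> 'a \<Rightarrow> 'a" where
  "cc a x b y = the (sc a x \<boxplus> sc b y)"

text \<open>The sum is defined because it is part of a defined one: together with the same
  combination of the complements it makes up the multiple of 1 by \<open>a + b\<close>.\<close>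

lemma
  assumes x: "x \<in> carrier E" and y: "y \<in> carrier E" and ab: "0 \<le> a" "0 \<le> b" "a + b \<le> 1"
  shows cc_closed [simp]: "cc a x b y \<in> carrier E"
    and Some_cc: "Some (cc a x b y) = sc a x \<boxplus> sc b y"
proof -
  have "(sc a x \<boxplus> sc b y) \<boxplus> (sc a (ortho E x) \<boxplus> sc b (ortho E y)) = sc (a + b) e1"
    using x y ab by (subst pl_swap) (simp add: sc_ortho sc_add)
  then have "(sc a x \<boxplus> sc b y) \<boxplus> (sc a (ortho E x) \<boxplus> sc b (ortho E y)) = Some (escale E (a + b) e1)"
    using ab by (simp add: sc_Some)
  then obtain z where "sc a x \<boxplus> sc b y = Some z" "z \<in> carrier E" by (rule pl_SomeD)
  then show "cc a x b y \<in> carrier E" "Some (cc a x b y) = sc a x \<boxplus> sc b y" by (simp_all add: cc_def)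
qed

lemma sc_cc:
  assumes "x \<in> carrier E" "y \<in> carrier E" "0 \<le> a" "0 \<le> b" "a + b \<le> 1" "0 \<le> r" "r \<le> 1"
  shows "sc r (cc a x b y) = sc (r * a) x \<boxplus> sc (r * b) y"
proof -
  have "Some (cc a x b y) = Some (escale E a x) \<boxplus> Some (escale E b y)"
    using Some_cc[OF assms(1-5)] assms by (simp add: sc_Some)
  from sc_pl[OF this assms(6,7)] show ?thesis using assms by (simp add: sc_scale)
qed

text \<open>For weights with sum exactly 1, the combination of the complements completes that of the
  elements to 1.\<close>

lemma ortho_cc:
  assumes "x \<in> carrier E" "y \<in> carrier E" "0 \<le> a" "0 \<le> b" "a + b = 1"
  shows "ortho E (cc a x b y) = cc a (ortho E x) b (ortho E y)"
proof -
  have "Some (cc a x b y) \<boxplus> Some (cc a (ortho E x) b (ortho E y)) = Some e1"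
    using assms by (simp add: Some_cc) (subst pl_swap, simp add: sc_ortho sc_add sc_one)
  then show ?thesis using pl_eq_one_iff assms by simp
qed

lemma cc_mono:
  assumes xx: "x \<sqsubseteq> x'" and x: "x \<in> carrier E" and y: "y \<in> carrier E" and ab: "0 \<le> a" "0 \<le> b" "a + b \<le> 1"
  shows "cc a x b y \<sqsubseteq> cc a x' b y"
proof -
  obtain z where z: "z \<in> carrier E" "Some x' = Some x \<boxplus> Some z" using xx x ele_iff by blast
  have x': "x' \<in> carrier E" using xx x le_closed by blast
  have "Some (cc a x' b y) = sc a x \<boxplus> sc a z \<boxplus> sc b y"
    using Some_cc[OF x' y ab] sc_pl[OF z(2), of a] ab by simp
  also have "\<dots> = Some (cc a x b y) \<boxplus> Some (escale E a z)"
    using Some_cc[OF x y ab] sc_Some[OF z(1), of a] ab by (simp add: pl_ac)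
  finally show ?thesis using ele_iff[of "cc a x b y"] x y ab z(1) scale_closed by auto
qed

section \<open>Midpoints, homotheties and cancellation of factors\<close>

abbreviation mid :: "'a \<Rightarrow> 'a \<Rightarrow> 'a" where "mid x y \<equiv> cc (1/2) x (1/2) y"

definition centre :: 'a where "centre = escale E (1/2) e1"

text \<open>The ratio \<open>r\<close> may be negative; the fixed point is \<open>centre\<close>.\<close>

definition homothety :: "real \<Rightarrow> 'a \<Rightarrow> 'a" where
  "homothety r x = cc ((1 + r) / 2) x ((1 - r) / 2) (ortho E x)"

lemma centre_closed [simp]: "centre \<in> carrier E"
  by (simp add: centre_def scale_closed)

lemma homothety_closed [simp]: "x \<in> carrier E \<Longrightarrow> \<bar>r\<bar> \<le> 1 \<Longrightarrow> homothety r x \<in> carrier E"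
  unfolding homothety_def by (rule cc_closed) (auto simp: field_simps abs_le_iff)

lemma Some_homothety: "x \<in> carrier E \<Longrightarrow> \<bar>r\<bar> \<le> 1 \<Longrightarrow>
    Some (homothety r x) = sc ((1 + r) / 2) x \<boxplus> sc ((1 - r) / 2) (ortho E x)"
  unfolding homothety_def by (rule Some_cc) (auto simp: field_simps abs_le_iff)

lemma sc_homothety: "x \<in> carrier E \<Longrightarrow> \<bar>r\<bar> \<le> 1 \<Longrightarrow> 0 \<le> s \<Longrightarrow> s \<le> 1 \<Longrightarrow>
    sc s (homothety r x) = sc (s * ((1 + r) / 2)) x \<boxplus> sc (s * ((1 - r) / 2)) (ortho E x)"
  unfolding homothety_def by (rule sc_cc) (auto simp: field_simps abs_le_iff)

lemma ortho_homothety: "x \<in> carrier E \<Longrightarrow> \<bar>r\<bar> \<le> 1 \<Longrightarrow> ortho E (homothety r x) = homothety r (ortho E x)"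
  unfolding homothety_def by (rule ortho_cc) (auto simp: field_simps abs_le_iff)

text \<open>The multiples of \<open>x\<close> and its complement by \<open>(1 - r) / 2\<close> merge
  into a multiple of 1. In this form a nonnegative homothety is scaling plus a constant, hence
  monotone.\<close>

lemma Some_homothety_nonneg:
  assumes x: "x \<in> carrier E" and r: "0 \<le> r" "r \<le> 1"
  shows "Some (homothety r x) = sc r x \<boxplus> sc ((1 - r) / 2) e1"
proof -
  have "sc ((1 + r) / 2) x = sc r x \<boxplus> sc ((1 - r) / 2) x"
    using sc_add[OF x, of r "(1 - r) / 2"] r by (simp add: field_simps)
  then show ?thesis using Some_homothety[OF x, of r] sc_ortho[OF x, of "(1 - r) / 2"] r by (simp add: pl.assoc)
qed

lemma homothety_1: "x \<in> carrier E \<Longrightarrow> homothety 1 x = x"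
proof -
  assume x: "x \<in> carrier E"
  have "sc 1 x \<boxplus> sc 0 e1 = sc 1 x"
  proof -
    have "sc 0 e1 = Some ez"
    proof -
      \<comment> \<open>That the zero multiple of 1 is zero is no axiom; it follows by cancelling
        this idempotent sum.\<close>
      have *: "sc 0 e1 \<boxplus> sc 0 e1 = sc 0 e1" using sc_add[of e1 0 0] by simp
      then have "Some (escale E 0 e1) \<boxplus> Some (escale E 0 e1) = Some (escale E 0 e1)"
        by (simp add: sc_Some)
      from pl_cancel[OF this pl_zero] show ?thesis by (simp add: scale_closed sc_Some)
    qed
    then show ?thesis using pl_zero[OF x] x by (simp add: sc_one pl.commute)
  qed
  then show ?thesis using Some_homothety_nonneg[OF x, of 1] x by (simp add: sc_one)
qed

lemma homothety_ortho: "x \<in> carrier E \<Longrightarrow> \<bar>r\<bar> \<le> 1 \<Longrightarrow> homothety r (ortho E x) = homothety (- r) x"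
  by (rule option.inject[THEN iffD1]) (simp add: Some_homothety ortho_ortho pl.commute)

lemma mid_commute: "mid x y = mid y x"
  by (simp add: cc_def pl.commute)

text \<open>Both sides give each element weight 1/4. This law replaces associativity, which
  midpoints lack, and yields associativity of vector addition.\<close>

lemma mid_medial:
  assumes "a \<in> carrier E" "b \<in> carrier E" "x \<in> carrier E" "y \<in> carrier E"
  shows "mid (mid a b) (mid x y) = mid (mid a x) (mid b y)"
  by (rule option.inject[THEN iffD1]) (use assms in \<open>simp add: Some_cc sc_cc pl_ac\<close>)

text \<open>Homotheties are affine, negative ratios included, since complements commute with
  midpoints. This becomes distributivity of a scalar over a sum of vectors.\<close>

lemma homothety_mid:
  assumes x: "x \<in> carrier E" and y: "y \<in> carrier E" and r: "\<bar>r\<bar> \<le> 1"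
  shows "homothety r (mid x y) = mid (homothety r x) (homothety r y)"
proof (rule option.inject[THEN iffD1])
  have r': "0 \<le> 1 + r" "0 \<le> 1 - r" using r by auto
  show "Some (homothety r (mid x y)) = Some (mid (homothety r x) (homothety r y))"
    using x y r r' by (simp add: Some_homothety Some_cc sc_homothety ortho_cc sc_cc pl_ac mult.commute)
qed

lemma sc_add4:
  assumes "x \<in> carrier E" "y \<in> carrier E" "0 \<le> a" "0 \<le> b" "0 \<le> c" "0 \<le> d" "a + c \<le> 1" "b + d \<le> 1"
  shows "(sc a x \<boxplus> sc b y) \<boxplus> (sc c x \<boxplus> sc d y) = sc (a + c) x \<boxplus> sc (b + d) y"
  using assms by (subst pl_swap) (simp add: sc_add)

text \<open>Weights at \<open>x\<close> and at its complement are averaged separately. This becomes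
  distributivity of a vector over a sum of scalars.\<close>

lemma mid_homothety:
  assumes x: "x \<in> carrier E" and r: "\<bar>r\<bar> \<le> 1" and s: "\<bar>s\<bar> \<le> 1"
  shows "mid (homothety r x) (homothety s x) = homothety ((r + s) / 2) x"
proof (rule option.inject[THEN iffD1])
  have r': "0 \<le> 1 + r" "0 \<le> 1 - r" "0 \<le> 1 + s" "0 \<le> 1 - s" "\<bar>(r + s) / 2\<bar> \<le> 1" using r s by auto
  have h: "(0::real) \<le> 1/2" "1/2 \<le> (1::real)" by simp_all
  have "Some (mid (homothety r x) (homothety s x)) =
      sc (1/2 * ((1 + r) / 2) + 1/2 * ((1 + s) / 2)) x \<boxplus>
      sc (1/2 * ((1 - r) / 2) + 1/2 * ((1 - s) / 2)) (ortho E x)"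
  proof -
    have "Some (mid (homothety r x) (homothety s x)) = sc (1/2) (homothety r x) \<boxplus> sc (1/2) (homothety s x)"
      using x r s by (intro Some_cc) auto
    also have "\<dots> = sc (1/2 * ((1 + r) / 2) + 1/2 * ((1 + s) / 2)) x \<boxplus>
        sc (1/2 * ((1 - r) / 2) + 1/2 * ((1 - s) / 2)) (ortho E x)"
      unfolding sc_homothety[OF x r h] sc_homothety[OF x s h]
    proof (rule sc_add4[OF x ortho_closed[OF x]])
      show "1/2 * ((1 + r) / 2) + 1/2 * ((1 + s) / 2) \<le> 1" "1/2 * ((1 - r) / 2) + 1/2 * ((1 - s) / 2) \<le> 1"
        using r s by (simp_all add: abs_le_iff field_simps)
    qed (use r' in auto)
    finally show ?thesis .
  qed
  also have "1/2 * ((1 + r) / 2) + 1/2 * ((1 + s) / 2) = (1 + (r + s) / 2) / 2" by (simp add: field_simps)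
  also have "1/2 * ((1 - r) / 2) + 1/2 * ((1 - s) / 2) = (1 - (r + s) / 2) / 2" by (simp add: field_simps)
  finally show "Some (mid (homothety r x) (homothety s x)) = Some (homothety ((r + s) / 2) x)"
    using Some_homothety[OF x r'(5)] by simp
qed

text \<open>The complement of \<open>homothety s x\<close> is \<open>homothety (- s) x\<close>, so
  the outer combination mixes two homotheties of the same \<open>x\<close>; collecting the weights
  at \<open>x\<close> gives \<open>(1 + r * s) / 2\<close>.\<close>

lemma homothety_homothety:
  assumes x: "x \<in> carrier E" and r: "\<bar>r\<bar> \<le> 1" and s: "\<bar>s\<bar> \<le> 1"
  shows "homothety r (homothety s x) = homothety (r * s) x"
proof (rule option.inject[THEN iffD1])
  have r': "0 \<le> (1 + r) / 2" "0 \<le> (1 - r) / 2" "0 \<le> (1 + s) / 2" "0 \<le> (1 - s) / 2"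
    "(1 + r) / 2 \<le> 1" "(1 - r) / 2 \<le> 1" "\<bar>-s\<bar> \<le> 1" using r s by auto
  have rs: "\<bar>r * s\<bar> \<le> 1" using r s by (simp add: abs_mult mult_le_one)
  have sum: "a * b + a' * b' \<le> 1" if "0 \<le> a" "0 \<le> b" "0 \<le> a'" "0 \<le> b'" "a + a' = 1" "b \<le> 1" "b' \<le> 1" for a b a' b' :: real
    using that mult_left_mono[of b 1 a] mult_left_mono[of b' 1 a'] by simp
  have "(1 + r) / 2 + (1 - r) / 2 = 1" "(1 - s) / 2 \<le> 1" "(1 + s) / 2 \<le> 1"
    using s by (simp_all add: field_simps abs_le_iff)
  note r' = r' this
  have minus: "1 + - s = 1 - s" "1 - - s = 1 + s" by simp_all
  have "Some (homothety r (homothety s x)) = sc ((1 + r) / 2) (homothety s x) \<boxplus> sc ((1 - r) / 2) (homothety (-s) x)"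
    using Some_homothety[OF homothety_closed[OF x s] r] by (simp add: ortho_homothety[OF x s] homothety_ortho[OF x s])
  also have "\<dots> = sc ((1 + r) / 2 * ((1 + s) / 2) + (1 - r) / 2 * ((1 - s) / 2)) x \<boxplus>
      sc ((1 + r) / 2 * ((1 - s) / 2) + (1 - r) / 2 * ((1 + s) / 2)) (ortho E x)"
    unfolding sc_homothety[OF x s r'(1,5)] sc_homothety[OF x r'(7) r'(2,6)] minus
    by (rule sc_add4[OF x ortho_closed[OF x]])
      (intro mult_nonneg_nonneg r' sum)+
  also have "(1 + r) / 2 * ((1 + s) / 2) + (1 - r) / 2 * ((1 - s) / 2) = (1 + r * s) / 2" by (simp add: field_simps)
  also have "(1 + r) / 2 * ((1 - s) / 2) + (1 - r) / 2 * ((1 + s) / 2) = (1 - r * s) / 2" by (simp add: field_simps)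
  finally show "Some (homothety r (homothety s x)) = Some (homothety (r * s) x)"
    using Some_homothety[OF x rs] by simp
qed

lemma homothety_0: "x \<in> carrier E \<Longrightarrow> homothety 0 x = centre"
  using Some_homothety[of x 0] sc_ortho[of x "1/2"] by (simp add: centre_def sc_Some)

lemma homothety_centre: "\<bar>r\<bar> \<le> 1 \<Longrightarrow> homothety r centre = centre"
  using homothety_homothety[of e1 r 0] homothety_0[of e1] by simp

lemma mid_centre: "x \<in> carrier E \<Longrightarrow> mid x centre = homothety (1/2) x"
  using mid_homothety[of x 1 0] by (simp add: homothety_1 homothety_0)

lemma mid_ortho: "x \<in> carrier E \<Longrightarrow> mid x (ortho E x) = centre"
  using mid_homothety[of x 1 "-1"] homothety_ortho[of x 1] by (simp add: homothety_1 homothety_0)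

lemma homothety_eq_cc:
  assumes "x \<in> carrier E" "0 \<le> r" "r \<le> 1"
  shows "homothety r x = cc r x ((1 - r) / 2) e1"
proof -
  have "r + (1 - r) / 2 \<le> 1" using assms(3) by (simp add: field_simps)
  then have "Some (cc r x ((1 - r) / 2) e1) = Some (homothety r x)"
    using Some_homothety_nonneg[OF assms] Some_cc[of x e1 r "(1 - r) / 2"] assms by simp
  then show ?thesis by simp
qed

lemma homothety_mono:
  assumes "x \<sqsubseteq> y" "x \<in> carrier E" "0 \<le> r" "r \<le> 1"
  shows "homothety r x \<sqsubseteq> homothety r y"
proof -
  have "r + (1 - r) / 2 \<le> 1" using assms(4) by (simp add: field_simps)
  then show ?thesis
    using homothety_eq_cc[of _ r] le_closed[OF assms(2,1)] cc_mono[OF assms(1,2) one_closed, of r "(1 - r) / 2"]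
      assms by simp
qed

text \<open>Each element is twice its half, so the remainder \<open>z\<close> between the halves can
  be doubled; the doubled remainder is defined as a part of \<open>y\<close>.\<close>

lemma half_scale_reflect:
  assumes x: "x \<in> carrier E" and y: "y \<in> carrier E" and le: "escale E (1/2) x \<sqsubseteq> escale E (1/2) y"
  shows "x \<sqsubseteq> y"
proof -
  obtain z where z: "z \<in> carrier E" "Some (escale E (1/2) y) = Some (escale E (1/2) x) \<boxplus> Some z"
    using le ele_iff x scale_closed by auto
  have d: "Some v = Some (escale E (1/2) v) \<boxplus> Some (escale E (1/2) v)" if "v \<in> carrier E" for v
    using sc_add[OF that, of "1/2" "1/2"] that by (simp add: sc_Some scale_one)
  have "Some y = Some x \<boxplus> (Some z \<boxplus> Some z)"
    using d[OF y] d[OF x] z(2) by (simp add: pl_ac)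
  moreover from this[symmetric] obtain w where "Some z \<boxplus> Some z = Some w" "w \<in> carrier E" by (rule pl_SomeD) auto
  ultimately show ?thesis using ele_iff[OF x] by auto
qed

lemma scale_mono: "x \<sqsubseteq> y \<Longrightarrow> x \<in> carrier E \<Longrightarrow> 0 \<le> r \<Longrightarrow> r \<le> 1 \<Longrightarrow> escale E r x \<sqsubseteq> escale E r y"
proof -
  assume le: "x \<sqsubseteq> y" and x: "x \<in> carrier E" and r: "0 \<le> r" "r \<le> 1"
  obtain z where z: "z \<in> carrier E" "Some y = Some x \<boxplus> Some z" using le x ele_iff by blast
  have y: "y \<in> carrier E" using le x le_closed by blast
  from sc_pl[OF z(2) r] show ?thesis
    using x y z(1) r ele_iff[of "escale E r x"] scale_closed by (auto simp: sc_Some)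
qed

text \<open>Dividing by \<open>r\<close> is impossible, but a further scaling by
  \<open>(1/2) ^ n / r\<close> turns the factor into a power of 1/2, which repeated doubling
  removes.\<close>

lemma scale_reflect:
  assumes x: "x \<in> carrier E" and y: "y \<in> carrier E" and r: "0 < r" "r \<le> 1"
    and le: "escale E r x \<sqsubseteq> escale E r y"
  shows "x \<sqsubseteq> y"
proof -
  have p: "0 \<le> (1/2 :: real) ^ n" "(1/2) ^ n \<le> (1::real)" for n :: nat by (simp_all add: power_le_one)
  have pow: "escale E ((1/2) ^ n) x \<sqsubseteq> escale E ((1/2) ^ n) y \<Longrightarrow> x \<sqsubseteq> y" for n
  proof (induction n)
    case 0
    then show ?case using x y by (simp add: scale_one)
  next
    case (Suc n)
    then show ?case using half_scale_reflect[of "escale E ((1/2) ^ n) x" "escale E ((1/2) ^ n) y"] x y p[of n]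
      by (simp add: scale_closed scale_scale)
  qed
  obtain n where n: "(1/2) ^ n < r" using real_arch_pow_inv[OF r(1), of "1/2"] by auto
  have q: "0 \<le> (1/2 :: real) ^ n / r" "(1/2) ^ n / r \<le> 1" using n r by simp_all
  have "escale E ((1/2) ^ n / r) (escale E r x) \<sqsubseteq> escale E ((1/2) ^ n / r) (escale E r y)"
    using le q r x by (intro scale_mono[of "escale E r x"]) (auto simp: scale_closed)
  then show ?thesis using pow[of n] x y q r by (simp add: scale_scale)
qed

text \<open>If \<open>p'\<close> exceeds \<open>p\<close> by \<open>z\<close>, regrouping puts
  \<open>c\<close> last and cancellation leaves \<open>y\<close> as the sum of \<open>x\<close> and
  \<open>z\<close>.\<close>

lemma le_cancel:
  assumes hx: "Some x \<boxplus> c = Some p" and hy: "Some y \<boxplus> c = Some p'" and le: "p \<sqsubseteq> p'"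
  shows "x \<sqsubseteq> y"
proof -
  have p: "p \<in> carrier E" and x: "x \<in> carrier E" using hx by (rule pl_SomeD; simp)+
  obtain z where z: "z \<in> carrier E" "Some p' = Some p \<boxplus> Some z"
    using le ele_iff[OF p] by blast
  have e: "(Some x \<boxplus> Some z) \<boxplus> c = Some p'"
    by (simp add: z(2) hx[symmetric] pl_ac)
  then obtain w where w: "Some x \<boxplus> Some z = Some w" by (rule pl_SomeD)
  from pl_cancel[OF e[unfolded w] hy] w have "Some y = Some x \<boxplus> Some z" by simp
  then show "x \<sqsubseteq> y" using ele_iff[OF x] z(1) by blast
qed

text \<open>The constant summand is cancelled first, then the factor \<open>r\<close>.\<close>

lemma homothety_reflect:
  assumes x: "x \<in> carrier E" and y: "y \<in> carrier E" and r: "0 < r" "r \<le> 1"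
    and le: "homothety r x \<sqsubseteq> homothety r y"
  shows "x \<sqsubseteq> y"
proof (rule scale_reflect[OF x y r])
  have "Some (escale E r v) \<boxplus> sc ((1 - r) / 2) e1 = Some (homothety r v)" if "v \<in> carrier E" for v
    using Some_homothety_nonneg[OF that, of r] r that by (simp add: sc_Some)
  from le_cancel[OF this[OF x] this[OF y] le] show "escale E r x \<sqsubseteq> escale E r y" .
qed

end

section \<open>The order unit space of an Archimedean effect module\<close>

context effmod
begin

lemma scale_unit_mono: "0 \<le> r \<Longrightarrow> r \<le> s \<Longrightarrow> s \<le> 1 \<Longrightarrow> escale E r e1 \<sqsubseteq> escale E s e1"
proof -
  assume rs: "0 \<le> r" "r \<le> s" "s \<le> 1"
  have "Some (escale E s e1) = Some (escale E r e1) \<boxplus> Some (escale E (s - r) e1)"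
    using sc_add[of e1 r "s - r"] rs by (simp add: sc_Some)
  then show ?thesis using ele_iff[of "escale E r e1"] rs scale_closed[of e1] by auto
qed

text \<open>Equal multiples of 1 for distinct scalars would make a positive multiple of 1 vanish;
  cancelling its factor gives 1 below zero.\<close>

lemma inj_scale_unit:
  assumes "ez \<noteq> e1"
  shows "inj_on (\<lambda>r. escale E r e1) {0<..1}"
proof (rule linorder_inj_onI')
  fix r s :: real assume rs: "r \<in> {0<..1}" "s \<in> {0<..1}" "r < s"
  show "escale E r e1 \<noteq> escale E s e1"
  proof
    assume eq: "escale E r e1 = escale E s e1"
    have "Some (escale E (s - r) e1) \<boxplus> Some (escale E r e1) = Some (escale E r e1)"
      using sc_add[of e1 "s - r" r] rs by (simp add: sc_Some eq)
    from pl_cancel[OF this pl_zero] have "escale E (s - r) e1 = ez" using rs by (simp add: scale_closed)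
    then have "escale E (s - r) e1 \<sqsubseteq> escale E (s - r) ez"
      using zero_le[OF scale_closed[OF zero_closed, of "s - r"]] rs by simp
    from scale_reflect[OF _ _ _ _ this] have "e1 \<sqsubseteq> ez" using rs by simp
    then show False using le_antisym[OF zero_le[of e1]] assms by simp
  qed
qed

definition pairs :: "(real \<times> 'a) set" where
  "pairs = {0<..1} \<times> carrier E"

text \<open>The pair \<open>(t, x)\<close> stands for the vector \<open>(x - centre) / t\<close>.\<close>

definition lep :: "real \<times> 'a \<Rightarrow> real \<times> 'a \<Rightarrow> bool" where
  "lep p p' \<longleftrightarrow> homothety (fst p') (snd p) \<sqsubseteq> homothety (fst p) (snd p')"

lemma lep_refl: "p \<in> pairs \<Longrightarrow> lep p p"
  by (auto simp: lep_def pairs_def)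

lemma homothety_homothety':
  "x \<in> carrier E \<Longrightarrow> 0 < r \<Longrightarrow> r \<le> 1 \<Longrightarrow> 0 < s \<Longrightarrow> s \<le> 1 \<Longrightarrow>
    homothety r (homothety s x) = homothety (r * s) x"
  by (simp add: homothety_homothety)

lemma homothety_commute:
  "x \<in> carrier E \<Longrightarrow> \<bar>r\<bar> \<le> 1 \<Longrightarrow> \<bar>s\<bar> \<le> 1 \<Longrightarrow>
    homothety r (homothety s x) = homothety s (homothety r x)"
  by (simp add: homothety_homothety mult.commute)

text \<open>\<open>lep\<close> compares fractions by cross-multiplication. Multiplying each
  inequality by the missing denominator lets them be chained, and the common factor
  \<open>t'\<close> is then cancelled by \<open>homothety_reflect\<close>.\<close>

lemma lep_trans:
  assumes "lep p p'" "lep p' p''" "p \<in> pairs" "p' \<in> pairs" "p'' \<in> pairs"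
  shows "lep p p''"
proof -
  obtain t x t' x' t'' x'' where p: "p = (t, x)" "p' = (t', x')" "p'' = (t'', x'')"
    by (metis surj_pair)
  have t: "0 < t" "t \<le> 1" "0 < t'" "t' \<le> 1" "0 < t''" "t'' \<le> 1"
    and x: "x \<in> carrier E" "x' \<in> carrier E" "x'' \<in> carrier E"
    using assms(3-5) p by (auto simp: pairs_def)
  have 1: "homothety t' x \<sqsubseteq> homothety t x'" and 2: "homothety t'' x' \<sqsubseteq> homothety t' x''"
    using assms(1,2) p by (simp_all add: lep_def)
  have "homothety t' (homothety t'' x) \<sqsubseteq> homothety t (homothety t'' x')"
    using homothety_mono[OF 1, of t''] t x by (simp add: homothety_homothety' mult.commute)
  moreover have "homothety t (homothety t'' x') \<sqsubseteq> homothety t' (homothety t x'')"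
    using homothety_mono[OF 2, of t] t x by (simp add: homothety_homothety' mult.commute)
  ultimately have "homothety t' (homothety t'' x) \<sqsubseteq> homothety t' (homothety t x'')"
    using t x le_trans[of "homothety t' (homothety t'' x)"] by simp
  then show ?thesis
    using homothety_reflect[of "homothety t'' x" "homothety t x''" t'] t x p by (simp add: lep_def)
qed

text \<open>The order unit space must live on the type of \<open>E\<close>. This is possible because a nontrivial \<open>E\<close>
  contains a copy of the interval \<open>(0, 1]\<close> and hence is equipotent to \<open>E \<times> E\<close>.\<close>

lemma ex_quotient_map:
  "\<exists>q :: real \<times> 'a \<Rightarrow> 'a. \<forall>p \<in> pairs. \<forall>p' \<in> pairs. q p = q p' \<longleftrightarrow> lep p p' \<and> lep p' p"
proof (cases "ez = e1")
  case True
  have "x = ez" if "x \<in> carrier E" for x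
    using le_antisym[OF zero_le[OF that]] le_one[OF that] True by simp
  then have "carrier E = {ez}" by auto
  then have "lep p p'" if "p \<in> pairs" "p' \<in> pairs" for p p'
    using that homothety_closed[of ez] by (auto simp: lep_def pairs_def)
  then show ?thesis by (intro exI[of _ "\<lambda>_. undefined"]) simp
next
  case False
  have "(\<lambda>r. escale E r e1) ` {0<..1} \<subseteq> carrier E" using scale_closed by auto
  then have "infinite (carrier E)"
    using inj_on_finite[OF inj_scale_unit[OF False]] infinite_Ioc[of 0 "1::real"] by auto
  then obtain f where f: "bij_betw f (carrier E \<times> carrier E) (carrier E)"
    using card_of_Times_same_infinite card_of_ordIso by blast
  \<comment> \<open>The denominator is stored as a multiple of 1, so a pair becomes an element of
    \<open>E \<times> E\<close>, which \<open>f\<close> codes in \<open>E\<close>.\<close>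
  define j where "j p = f (escale E (fst p) e1, snd p)" for p :: "real \<times> 'a"
  have j: "inj_on j pairs"
  proof (rule inj_onI)
    fix p p' assume p: "p \<in> pairs" "p' \<in> pairs" and "j p = j p'"
    then have "(escale E (fst p) e1, snd p) = (escale E (fst p') e1, snd p')"
      unfolding j_def by (intro inj_onD[OF bij_betw_imp_inj_on[OF f]]) (auto simp: pairs_def scale_closed)
    then show "p = p'" using inj_onD[OF inj_scale_unit[OF False]] p
      by (auto simp: pairs_def prod_eq_iff)
  qed
  \<comment> \<open>Equivalent pairs have the same predicate \<open>eq p\<close>, so the choice in
    \<open>rp\<close> returns one common representative.\<close>
  define eq where "eq p p' \<longleftrightarrow> p' \<in> pairs \<and> lep p p' \<and> lep p' p" for p p'
  define rp where "rp p = (SOME p'. eq p p')" for p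
  have rp: "eq p (rp p)" if "p \<in> pairs" for p
    unfolding rp_def by (rule someI[of _ p]) (use that lep_refl in \<open>simp add: eq_def\<close>)
  have "j (rp p) = j (rp p') \<longleftrightarrow> lep p p' \<and> lep p' p" if p: "p \<in> pairs" "p' \<in> pairs" for p p'
  proof
    assume "j (rp p) = j (rp p')"
    then have "rp p = rp p'" using inj_onD[OF j] rp[OF p(1)] rp[OF p(2)] unfolding eq_def by blast
    then obtain r where "eq p r" "eq p' r" using rp[OF p(1)] rp[OF p(2)] by metis
    then show "lep p p' \<and> lep p' p" using lep_trans[OF _ _ p(1) _ p(2)] lep_trans[OF _ _ p(2) _ p(1)]
      unfolding eq_def by blast
  next
    assume le: "lep p p' \<and> lep p' p"
    have "eq p r \<longleftrightarrow> eq p' r" for r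
      using lep_trans[OF _ _ p(1,2), of r] lep_trans[OF _ _ p(2,1), of r]
        lep_trans[OF _ _ _ p(1,2), of r] lep_trans[OF _ _ _ p(2,1), of r] le
      unfolding eq_def by blast
    then have "eq p = eq p'" by blast
    then show "j (rp p) = j (rp p')" by (simp add: rp_def)
  qed
  then have "\<forall>p \<in> pairs. \<forall>p' \<in> pairs. j (rp p) = j (rp p') \<longleftrightarrow> lep p p' \<and> lep p' p" by blast
  then show ?thesis by (intro exI[of _ "\<lambda>p. j (rp p)"])
qed

end

text \<open>\<open>q (t, x)\<close> names the formal vector of a pair by an element of the type of
  \<open>E\<close>. Assuming only when names coincide keeps the cardinality argument out of the
  construction.\<close>

locale effmod_quotient = effmod +
  fixes q :: "real \<times> 'a \<Rightarrow> 'a"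
  assumes q: "p \<in> pairs \<Longrightarrow> p' \<in> pairs \<Longrightarrow> q p = q p' \<longleftrightarrow> lep p p' \<and> lep p' p"
begin

definition rep :: "'a \<Rightarrow> real \<times> 'a" where
  "rep v = inv_into pairs q v"

text \<open>With \<open>c\<close> the centre, \<open>(x - c) / t + (y - c) / s\<close> has numerator
  \<open>(s (x - c) + t (y - c)) / 2\<close> over \<open>t * s / 2\<close>, a midpoint of
  homotheties. Dividing by \<open>1 + \<bar>r\<bar>\<close> keeps the ratio of the homothety between
  -1 and 1. The unit is 1 minus the centre, over 1/2.\<close>

definition V :: "'a ordered_space" where
  "V = \<lparr>carrier = q ` pairs, mult = undefined, one = undefined, zero = q (1, centre),
     add = (\<lambda>v w. case (rep v, rep w) of ((t, x), (s, y)) \<Rightarrow>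
        q (t * s / 2, mid (homothety s x) (homothety t y))),
     smult = (\<lambda>r v. case rep v of (t, x) \<Rightarrow> q (t / (1 + \<bar>r\<bar>), homothety (r / (1 + \<bar>r\<bar>)) x)),
     leq = (\<lambda>v w. lep (rep v) (rep w)), unit = q (1/2, e1)\<rparr>"

lemma q_closed [simp]: "0 < t \<Longrightarrow> t \<le> 1 \<Longrightarrow> x \<in> carrier E \<Longrightarrow> q (t, x) \<in> carrier V"
  by (auto simp: V_def pairs_def)

lemma carrierE:
  assumes "v \<in> carrier V"
  obtains t x where "0 < t" "t \<le> 1" "x \<in> carrier E" "v = q (t, x)"
  using assms by (auto simp: V_def pairs_def)

lemma q_eq_iff:
  assumes "0 < t" "t \<le> 1" "x \<in> carrier E" "0 < s" "s \<le> 1" "y \<in> carrier E"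
  shows "q (t, x) = q (s, y) \<longleftrightarrow> homothety s x = homothety t y"
  using q[of "(t, x)" "(s, y)"] assms le_antisym[of "homothety s x" "homothety t y"]
  by (auto simp: pairs_def lep_def)

lemma rep_q:
  assumes "0 < t" "t \<le> 1" "x \<in> carrier E"
  obtains s y where "rep (q (t, x)) = (s, y)" "0 < s" "s \<le> 1" "y \<in> carrier E" "homothety s x = homothety t y"
proof -
  have p: "(t, x) \<in> pairs" using assms by (simp add: pairs_def)
  obtain s y where sy: "rep (q (t, x)) = (s, y)" by fastforce
  have "(s, y) \<in> pairs" "q (s, y) = q (t, x)"
    using inv_into_into[of "q (t, x)" q pairs] f_inv_into_f[of "q (t, x)" q pairs] p sy
    by (auto simp: rep_def)
  then show ?thesis using that[OF sy] q_eq_iff[of s y t x] assms by (auto simp: pairs_def)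
qed

text \<open>Over a common denominator the order is that of \<open>E\<close>, whichever
  representatives \<open>rep\<close> picks: both comparisons are multiplied up to the same ratio,
  which is then cancelled.\<close>

lemma leq_q:
  assumes t: "0 < t" "t \<le> 1" and x: "x \<in> carrier E" and y: "y \<in> carrier E"
  shows "leq V (q (t, x)) (q (t, y)) \<longleftrightarrow> x \<sqsubseteq> y"
proof -
  obtain s a where a: "rep (q (t, x)) = (s, a)" "0 < s" "s \<le> 1" "a \<in> carrier E" "homothety s x = homothety t a"
    by (rule rep_q[OF t x])
  obtain r b where b: "rep (q (t, y)) = (r, b)" "0 < r" "r \<le> 1" "b \<in> carrier E" "homothety r y = homothety t b"
    by (rule rep_q[OF t y])
  have "leq V (q (t, x)) (q (t, y)) \<longleftrightarrow> homothety r a \<sqsubseteq> homothety s b"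
    by (simp add: V_def a(1) b(1) lep_def)
  also have "\<dots> \<longleftrightarrow> homothety t (homothety r a) \<sqsubseteq> homothety t (homothety s b)"
    using t a b homothety_mono[of "homothety r a" "homothety s b" t]
      homothety_reflect[of "homothety r a" "homothety s b" t] by auto
  also have "homothety t (homothety r a) = homothety r (homothety s x)"
    unfolding a(5) by (rule homothety_commute) (use t a(2-4) b(2-4) in auto)
  also have "\<dots> = homothety (r * s) x" using a(2-4) b(2-4) x by (intro homothety_homothety') auto
  also have "homothety t (homothety s b) = homothety s (homothety r y)"
    unfolding b(5) by (rule homothety_commute) (use t a(2-4) b(2-4) in auto)
  also have "\<dots> = homothety (r * s) y" using a(2-4) b(2-4) y by (subst mult.commute) (intro homothety_homothety', auto)
  also have "homothety (r * s) x \<sqsubseteq> homothety (r * s) y \<longleftrightarrow> x \<sqsubseteq> y"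
  proof -
    have "0 < r * s" "r * s \<le> 1" using a(2,3) b(2,3) mult_le_one[of r s] by auto
    then show ?thesis using homothety_mono[of x y "r * s"] homothety_reflect[of x y "r * s"] x y by auto
  qed
  finally show ?thesis .
qed

text \<open>Expansion of a fraction by \<open>l\<close>.\<close>

lemma q_shift:
  assumes "0 < t" "t \<le> 1" "x \<in> carrier E" "0 < l" "l \<le> 1"
  shows "q (t, x) = q (l * t, homothety l x)"
proof -
  have "0 < l * t" "l * t \<le> 1" using assms mult_le_one[of l t] by auto
  then show ?thesis
    using assms homothety_homothety'[OF assms(3,1,2,4,5)] by (subst q_eq_iff) (auto simp: mult.commute)
qed

lemma add_q:
  assumes t: "0 < t" "t \<le> 1" and x: "x \<in> carrier E" and y: "y \<in> carrier E"
  shows "q (t, x) \<oplus>\<^bsub>V\<^esub> q (t, y) = q (t / 2, mid x y)"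
proof -
  obtain s a where a: "rep (q (t, x)) = (s, a)" "0 < s" "s \<le> 1" "a \<in> carrier E" "homothety s x = homothety t a"
    by (rule rep_q[OF t x])
  obtain r b where b: "rep (q (t, y)) = (r, b)" "0 < r" "r \<le> 1" "b \<in> carrier E" "homothety r y = homothety t b"
    by (rule rep_q[OF t y])
  have sr: "0 < s * r" "s * r \<le> 1" "s * r / 2 \<le> 1" using a b mult_le_one[of s r] by auto
  have 1: "homothety (t / 2) (homothety r a) = homothety (s * r / 2) x"
  proof -
    have "homothety (t / 2) (homothety r a) = homothety (r / 2) (homothety s x)"
      unfolding a(5) using t a(2-4) b(2-4) by (simp add: homothety_homothety' mult.commute)
    then show ?thesis using a(2-4) b(2-4) x by (simp add: homothety_homothety' mult.commute)
  qed
  have 2: "homothety (t / 2) (homothety s b) = homothety (s * r / 2) y"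
  proof -
    have "homothety (t / 2) (homothety s b) = homothety (s / 2) (homothety r y)"
      unfolding b(5) using t a(2-4) b(2-4) by (simp add: homothety_homothety' mult.commute)
    then show ?thesis using a(2-4) b(2-4) y by (simp add: homothety_homothety' mult.commute)
  qed
  have "homothety (t / 2) (mid (homothety r a) (homothety s b)) = homothety (s * r / 2) (mid x y)"
    using t a(2-4) b(2-4) x y sr 1 2 by (simp add: homothety_mid)
  then have "q (s * r / 2, mid (homothety r a) (homothety s b)) = q (t / 2, mid x y)"
    using t a(2-4) b(2-4) x y sr by (subst q_eq_iff) auto
  then show ?thesis by (simp add: V_def a(1) b(1))
qed

text \<open>Any bound \<open>k\<close> may stand in for the \<open>1 + \<bar>r\<bar>\<close> of the
  definition, so that several scalars can share one denominator.\<close>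

lemma smult_q:
  assumes t: "0 < t" "t \<le> 1" and x: "x \<in> carrier E" and k: "1 \<le> k" "\<bar>r\<bar> \<le> k"
  shows "r \<odot>\<^bsub>V\<^esub> q (t, x) = q (t / k, homothety (r / k) x)"
proof -
  obtain s a where a: "rep (q (t, x)) = (s, a)" "0 < s" "s \<le> 1" "a \<in> carrier E" "homothety s x = homothety t a"
    by (rule rep_q[OF t x])
  define l where "l = 1 + \<bar>r\<bar>"
  have l: "1 \<le> l" "\<bar>r\<bar> \<le> l" by (auto simp: l_def)
  have rk: "\<bar>r / k\<bar> \<le> 1" "\<bar>r / l\<bar> \<le> 1" "\<bar>r / (k * l)\<bar> \<le> 1"
    using k l mult_mono[of 1 k "\<bar>r\<bar>" l] by (simp_all add: abs_mult divide_le_eq)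
  have tk: "0 < t / k" "t / k \<le> 1" "0 < s / l" "s / l \<le> 1"
    using k l t a(2-4) by (simp_all add: divide_le_eq)
  have "homothety (t / k) (homothety (r / l) a) = homothety (r / (k * l)) (homothety s x)"
    unfolding a(5) using t a(2-4) rk tk by (simp add: homothety_homothety mult.commute)
  also have "\<dots> = homothety (s / l) (homothety (r / k) x)"
    using a(2-4) x rk tk by (simp add: homothety_homothety mult.commute)
  finally have "q (s / l, homothety (r / l) a) = q (t / k, homothety (r / k) x)"
    using tk rk a(2-4) x by (subst q_eq_iff) auto
  then show ?thesis by (simp add: V_def a(1) l_def)
qed

lemma zero_q: "0 < t \<Longrightarrow> t \<le> 1 \<Longrightarrow> \<zero>\<^bsub>V\<^esub> = q (t, centre)"
  using q_shift[of 1 centre t] by (simp add: V_def homothety_centre)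

lemma unit_q: "0 < t \<Longrightarrow> t \<le> 1/2 \<Longrightarrow> unit V = q (t, homothety (2 * t) e1)"
  using q_shift[of "1/2" e1 "2 * t"] by (simp add: V_def)

text \<open>Each fraction is expanded by half the product of the other two denominators. The half
  keeps \<open>t\<close> at most 1/2, where the unit can also be written over
  \<open>t\<close>.\<close>

lemma carrier3E:
  assumes "v \<in> carrier V" "w \<in> carrier V" "z \<in> carrier V"
  obtains t a b c where "0 < t" "t \<le> 1/2" "a \<in> carrier E" "b \<in> carrier E" "c \<in> carrier E"
    "v = q (t, a)" "w = q (t, b)" "z = q (t, c)"
proof -
  obtain r a where a: "0 < r" "r \<le> 1" "a \<in> carrier E" "v = q (r, a)" by (rule carrierE[OF assms(1)])
  obtain s b where b: "0 < s" "s \<le> 1" "b \<in> carrier E" "w = q (s, b)" by (rule carrierE[OF assms(2)])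
  obtain p c where c: "0 < p" "p \<le> 1" "c \<in> carrier E" "z = q (p, c)" by (rule carrierE[OF assms(3)])
  have le: "0 < x * y / 2" "x * y / 2 \<le> 1" if "0 < x" "x \<le> 1" "0 < y" "y \<le> 1" for x y :: real
    using that mult_le_one[of x y] by auto
  have "0 < r * s * p / 2" "r * s * p / 2 \<le> 1/2"
    using a b c mult_le_one[of r s] mult_le_one[of "r * s" p] by auto
  moreover have "v = q (r * s * p / 2, homothety (s * p / 2) a)"
    using q_shift[OF a(1-3) le[OF b(1,2) c(1,2)]] a(4) by (simp add: mult_ac)
  moreover have "w = q (r * s * p / 2, homothety (r * p / 2) b)"
    using q_shift[OF b(1-3) le[OF a(1,2) c(1,2)]] b(4) by (simp add: mult_ac)
  moreover have "z = q (r * s * p / 2, homothety (r * s / 2) c)"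
    using q_shift[OF c(1-3) le[OF a(1,2) b(1,2)]] c(4) by (simp add: mult_ac)
  moreover have "homothety (s * p / 2) a \<in> carrier E" "homothety (r * p / 2) b \<in> carrier E"
    "homothety (r * s / 2) c \<in> carrier E"
    using le[OF b(1,2) c(1,2)] le[OF a(1,2) c(1,2)] le[OF a(1,2) b(1,2)] a b c by auto
  ultimately show ?thesis using that by blast
qed

text \<open>Associativity is the medial law, and the negative of a vector is given by the
  orthocomplement.\<close>

lemma abelian_group_V: "abelian_group V"
proof (rule abelian_groupI)
  fix v w z assume "v \<in> carrier V" "w \<in> carrier V" "z \<in> carrier V"
  then obtain t a b c where t: "0 < t" "t \<le> 1/2" and abc: "a \<in> carrier E" "b \<in> carrier E" "c \<in> carrier E"
    and v: "v = q (t, a)" "w = q (t, b)" "z = q (t, c)" by (rule carrier3E)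
  \<comment> \<open>A sum of two vectors has denominator \<open>t / 2\<close>; padding the third
    with the centre, which represents zero, gives it the same one.\<close>
  have z2: "z = q (t / 2, mid c centre)" and v2: "v = q (t / 2, mid a centre)"
    using q_shift[of t c "1/2"] q_shift[of t a "1/2"] t abc v by (simp_all add: mid_centre)
  have "v \<oplus>\<^bsub>V\<^esub> w \<oplus>\<^bsub>V\<^esub> z = q (t / 2 / 2, mid (mid a b) (mid c centre))"
    unfolding z2 v(1,2) using t abc by (simp add: add_q)
  also have "mid (mid a b) (mid c centre) = mid (mid a centre) (mid b c)"
    using mid_medial[of a b centre c] abc by (simp add: mid_commute)
  also have "q (t / 2 / 2, mid (mid a centre) (mid b c)) = v \<oplus>\<^bsub>V\<^esub> (w \<oplus>\<^bsub>V\<^esub> z)"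
    unfolding v2 v(2,3) using t abc by (simp add: add_q)
  finally show "v \<oplus>\<^bsub>V\<^esub> w \<oplus>\<^bsub>V\<^esub> z = v \<oplus>\<^bsub>V\<^esub> (w \<oplus>\<^bsub>V\<^esub> z)" .
next
  fix v w assume "v \<in> carrier V" "w \<in> carrier V"
  from carrier3E[OF this this(1)] obtain t a b where t: "0 < t" "t \<le> 1/2" and ab: "a \<in> carrier E" "b \<in> carrier E"
    and v: "v = q (t, a)" "w = q (t, b)" by metis
  then show "v \<oplus>\<^bsub>V\<^esub> w \<in> carrier V" "v \<oplus>\<^bsub>V\<^esub> w = w \<oplus>\<^bsub>V\<^esub> v"
    by (simp_all add: add_q mid_commute)
next
  fix v assume "v \<in> carrier V"
  then obtain t a where t: "0 < t" "t \<le> 1" and a: "a \<in> carrier E" and v: "v = q (t, a)" by (rule carrierE)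
  have "\<zero>\<^bsub>V\<^esub> \<oplus>\<^bsub>V\<^esub> v = q (t / 2, mid centre a)" using t a v by (simp add: zero_q[OF t] add_q)
  also have "\<dots> = v" using q_shift[of t a "1/2"] t a v by (simp add: mid_centre mid_commute)
  finally show "\<zero>\<^bsub>V\<^esub> \<oplus>\<^bsub>V\<^esub> v = v" .
  have "q (t, ortho E a) \<oplus>\<^bsub>V\<^esub> v = q (t / 2, centre)"
    using t a v by (simp add: add_q mid_ortho mid_commute[of "ortho E a"])
  then have "q (t, ortho E a) \<oplus>\<^bsub>V\<^esub> v = \<zero>\<^bsub>V\<^esub>" using zero_q[of "t / 2"] t by simp
  then show "\<exists>w \<in> carrier V. w \<oplus>\<^bsub>V\<^esub> v = \<zero>\<^bsub>V\<^esub>" using t a by (intro bexI[of _ "q (t, ortho E a)"]) auto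
qed (simp add: zero_q[of 1])

lemma module_V: "Module.module real_scalars V"
proof (rule moduleI[OF cring_real_scalars abelian_group_V])
  fix r s :: real and v w assume "v \<in> carrier V" "w \<in> carrier V"
  from carrier3E[OF this this(1)] obtain t a b where t: "0 < t" "t \<le> 1/2" and ab: "a \<in> carrier E" "b \<in> carrier E"
    and v: "v = q (t, a)" "w = q (t, b)" by metis
  then have t1: "t \<le> 1" by simp
  \<comment> \<open>One bound for \<open>r\<close>, \<open>s\<close> and \<open>r + s\<close>; its
    square bounds the product.\<close>
  define k where "k = 1 + \<bar>r\<bar> + \<bar>s\<bar>"
  have k: "1 \<le> k" "\<bar>r\<bar> \<le> k" "\<bar>s\<bar> \<le> k" "\<bar>r + s\<bar> \<le> k" by (auto simp: k_def)
  have tk: "0 < t / k" "t / k \<le> 1" using t k by (auto simp: divide_le_eq)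
  have rk: "\<bar>r / k\<bar> \<le> 1" "\<bar>s / k\<bar> \<le> 1" "\<bar>(r + s) / k\<bar> \<le> 1" using k by (auto simp: divide_le_eq)
  show "r \<odot>\<^bsub>V\<^esub> v \<in> carrier V" using tk rk ab by (simp add: v smult_q[OF t(1) t1 _ k(1,2)])
  have "r \<odot>\<^bsub>V\<^esub> (v \<oplus>\<^bsub>V\<^esub> w) = q (t / 2 / k, homothety (r / k) (mid a b))"
    using t ab k by (simp add: v add_q smult_q[where k = k])
  also have "\<dots> = q (t / k / 2, mid (homothety (r / k) a) (homothety (r / k) b))"
    using ab rk by (simp add: homothety_mid mult.commute)
  also have "\<dots> = r \<odot>\<^bsub>V\<^esub> v \<oplus>\<^bsub>V\<^esub> r \<odot>\<^bsub>V\<^esub> w"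
    using tk rk ab by (simp add: v smult_q[OF t(1) t1 _ k(1,2)] add_q)
  finally show "r \<odot>\<^bsub>V\<^esub> (v \<oplus>\<^bsub>V\<^esub> w) = r \<odot>\<^bsub>V\<^esub> v \<oplus>\<^bsub>V\<^esub> r \<odot>\<^bsub>V\<^esub> w" .
  have "(r + s) \<odot>\<^bsub>V\<^esub> v = q (1/2 * (t / k), homothety (1/2) (homothety ((r + s) / k) a))"
    using q_shift[of "t / k" "homothety ((r + s) / k) a" "1/2"] tk rk ab
    by (simp add: v smult_q[OF t(1) t1 _ k(1,4)])
  also have "homothety (1/2) (homothety ((r + s) / k) a) = mid (homothety (r / k) a) (homothety (s / k) a)"
    using mid_homothety[OF ab(1) rk(1,2)] homothety_homothety[OF ab(1) _ rk(3), of "1/2"]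
    by (simp add: add_divide_distrib[symmetric] mult.commute)
  also have "q (1/2 * (t / k), \<dots>) = r \<odot>\<^bsub>V\<^esub> v \<oplus>\<^bsub>V\<^esub> s \<odot>\<^bsub>V\<^esub> v"
    using tk rk ab by (simp add: v smult_q[OF t(1) t1 _ k(1,2)] smult_q[OF t(1) t1 _ k(1,3)] add_q mult.commute)
  finally show "(r \<oplus>\<^bsub>real_scalars\<^esub> s) \<odot>\<^bsub>V\<^esub> v = r \<odot>\<^bsub>V\<^esub> v \<oplus>\<^bsub>V\<^esub> s \<odot>\<^bsub>V\<^esub> v"
    by (simp add: real_scalars_def)
  have "r \<odot>\<^bsub>V\<^esub> (s \<odot>\<^bsub>V\<^esub> v) = q (t / k / k, homothety (r / k * (s / k)) a)"
    using tk rk ab k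
    by (simp add: v smult_q[OF t(1) t1 _ k(1,3)] smult_q[where k = k] homothety_homothety)
  also have "\<dots> = q (t / (k * k), homothety (r * s / (k * k)) a)" by simp
  also have "\<dots> = (r * s) \<odot>\<^bsub>V\<^esub> v"
  proof -
    have "1 \<le> k * k" "\<bar>r * s\<bar> \<le> k * k"
      using mult_mono[of 1 k 1 k] mult_mono[of "\<bar>r\<bar>" k "\<bar>s\<bar>" k] k by (simp_all add: abs_mult)
    then show ?thesis using t ab by (simp add: v smult_q[where k = "k * k"])
  qed
  finally show "(r \<otimes>\<^bsub>real_scalars\<^esub> s) \<odot>\<^bsub>V\<^esub> v = r \<odot>\<^bsub>V\<^esub> (s \<odot>\<^bsub>V\<^esub> v)"
    by (simp add: real_scalars_def)
  show "\<one>\<^bsub>real_scalars\<^esub> \<odot>\<^bsub>V\<^esub> v = v"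
    using t ab by (simp add: v smult_q[where k = 1] homothety_1 real_scalars_def)
qed

end

text \<open>The complement of the sum is what separates \<open>y\<close> from the complement of
  \<open>x\<close>. Definedness thus becomes a statement about the order, which order-reflecting
  maps can transport back.\<close>

lemma (in effmod) osum_defined_iff:
  assumes x: "x \<in> carrier E" and y: "y \<in> carrier E"
  shows "osum E x y \<noteq> None \<longleftrightarrow> y \<sqsubseteq> ortho E x"
proof
  assume "osum E x y \<noteq> None"
  then obtain c where c: "Some x \<boxplus> Some y = Some c" "c \<in> carrier E"
    using effect_algebra_closed[OF effect_algebra x y] x y by (auto simp: pl_Some)
  have eq: "Some x \<boxplus> (Some y \<boxplus> Some (ortho E c)) = Some e1"
    using pl_ortho[OF c(2)] unfolding c(1)[symmetric] by (simp only: pl.assoc)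
  then obtain w where w: "Some y \<boxplus> Some (ortho E c) = Some w" "w \<in> carrier E" by (rule pl_SomeD)
  from eq[unfolded w(1)] have "w = ortho E x" using pl_eq_one_iff[OF x w(2)] by simp
  then show "y \<sqsubseteq> ortho E x" unfolding ele_iff[OF y]
    using w(1) ortho_closed[OF c(2)] by (intro bexI[of _ "ortho E c"]) simp_all
next
  assume "y \<sqsubseteq> ortho E x"
  then obtain w where w: "Some (ortho E x) = Some y \<boxplus> Some w" unfolding ele_iff[OF y] by blast
  have "(Some x \<boxplus> Some y) \<boxplus> Some w = Some e1"
    using pl_ortho[OF x] unfolding w by (simp only: pl.assoc)
  then obtain d where "Some x \<boxplus> Some y = Some d" by (rule pl_SomeD)
  then show "osum E x y \<noteq> None" using x y by (simp add: pl_Some)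
qed

section \<open>Order axioms of the space and the identification of its interval with the
  module\<close>

context effmod_quotient
begin

lemma unit_V: "unit V = q (1/2, e1)"
  by (simp add: V_def)

lemma order_unit_space_V:
  assumes "archimedean E"
  shows "order_unit_space V"
  unfolding order_unit_space_def
proof (intro conjI ballI allI impI module_V)
  fix v w z assume "v \<in> carrier V" "w \<in> carrier V" "z \<in> carrier V"
  then obtain t a b c where t: "0 < t" "t \<le> 1/2" and abc: "a \<in> carrier E" "b \<in> carrier E" "c \<in> carrier E"
    and v: "v = q (t, a)" "w = q (t, b)" "z = q (t, c)" by (rule carrier3E)
  then have t1: "t \<le> 1" by simp
  note leq = leq_q[OF t(1) t1]
  show "leq V v v" using abc by (simp add: v leq)
  show "v = w" if "leq V v w" "leq V w v"
    using that le_antisym[of a b] abc by (simp add: v leq)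
  show "leq V v z" if "leq V v w" "leq V w z"
    using that le_trans[of a b c] abc by (simp add: v leq)
  show "leq V (v \<oplus>\<^bsub>V\<^esub> z) (w \<oplus>\<^bsub>V\<^esub> z)" if "leq V v w"
    using that cc_mono[of a b c "1/2" "1/2"] abc t by (simp add: v leq add_q leq_q)
next
  fix r :: real and v w assume r: "0 \<le> r" and vw: "v \<in> carrier V" "w \<in> carrier V"
  from carrier3E[OF vw vw(1)] obtain t a b where t: "0 < t" "t \<le> 1/2" and ab: "a \<in> carrier E" "b \<in> carrier E"
    and v: "v = q (t, a)" "w = q (t, b)" by metis
  define k where "k = 1 + r"
  have k: "1 \<le> k" "\<bar>r\<bar> \<le> k" "0 \<le> r / k" "r / k \<le> 1" "0 < t / k" "t / k \<le> 1"
    using r t by (auto simp: k_def divide_le_eq)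
  show "leq V (r \<odot>\<^bsub>V\<^esub> v) (r \<odot>\<^bsub>V\<^esub> w)" if "leq V v w"
    using that homothety_mono[of a b "r / k"] ab t k by (simp add: v leq_q smult_q[where k = k])
next
  fix v assume "v \<in> carrier V"
  then obtain t a where t: "0 < t" "t \<le> 1" and a: "a \<in> carrier E" and v: "v = q (t, a)" by (rule carrierE)
  \<comment> \<open>With this \<open>n\<close>, the vector can be expanded to denominator
    \<open>1 / (2 n)\<close>, over which the \<open>n\<close>-fold unit is represented by the top
    element \<open>e1\<close>.\<close>
  obtain n :: nat where n: "max 1 (1 / (2 * t)) \<le> real n" using real_arch_simple by blast
  define l where "l = 1 / (2 * real n * t)"
  have l: "0 < l" "l \<le> 1" using n t by (auto simp: l_def field_simps)
  have n': "1 \<le> real n" "0 < 1 / 2 / real n" "1 / 2 / real n \<le> 1" using n by (auto simp: field_simps)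
  have "v = q (1 / 2 / real n, homothety l a)"
    using q_shift[OF t a l] n' t by (simp add: v l_def)
  moreover have "real n \<odot>\<^bsub>V\<^esub> unit V = q (1 / 2 / real n, e1)"
    using smult_q[of "1/2" e1 "real n" "real n"] n' by (simp add: unit_V homothety_1)
  ultimately show "\<exists>n::nat. leq V v (real n \<odot>\<^bsub>V\<^esub> unit V)"
    using leq_q[OF n'(2,3)] le_one[of "homothety l a"] l a by (intro exI[of _ n]) simp
next
  fix v assume "v \<in> carrier V" and le: "\<forall>r>0. leq V v (r \<odot>\<^bsub>V\<^esub> unit V)"
  from carrier3E[OF this(1,1,1)] obtain t a where t: "0 < t" "t \<le> 1/2" and a: "a \<in> carrier E" and v: "v = q (t, a)"
    by metis
  have "a \<sqsubseteq> centre"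
  proof (rule assms[unfolded archimedean_def, rule_format, OF a centre_closed])
    fix r :: real assume r: "r \<in> {0<..1}"
    \<comment> \<open>Over the denominator \<open>t\<close>, the vector
      \<open>r \<odot> unit V\<close> is represented by the homothety of 1 with ratio
      \<open>p\<close>, which is \<open>(1 + p) / 2\<close> times 1. As \<open>t\<close> is at most
      1/2, \<open>p\<close> is at most \<open>r\<close>, and halving yields the bound of
      \<open>half_le\<close> at the centre.\<close>
    define p where "p = 2 * t * r"
    have p_le: "p \<le> r" using mult_right_mono[of "2 * t" 1 r] t r by (simp add: p_def)
    have p_ge: "0 \<le> p" using t r by (simp add: p_def)
    have "p \<le> 1" using p_le r by simp
    note p = p_ge p_le this
    have "r \<odot>\<^bsub>V\<^esub> unit V = q (1/2, homothety r e1)"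
      using smult_q[of "1/2" e1 1 r] r by (simp add: unit_V)
    also have "\<dots> = q (t, homothety p e1)"
      using q_shift[of "1/2" "homothety r e1" "2 * t"] t r by (simp add: homothety_homothety p_def)
    finally have "a \<sqsubseteq> homothety p e1"
      using le[rule_format, of r] r t a p by (simp add: v leq_q)
    also have "homothety p e1 = escale E ((1 + p) / 2) e1"
      using Some_homothety_nonneg[of e1 p] sc_add[of e1 p "(1 - p) / 2"] p
      by (simp add: sc_Some field_simps)
    finally have "escale E (1/2) a \<sqsubseteq> escale E (1/2) (escale E ((1 + p) / 2) e1)"
      using a p by (intro scale_mono) auto
    also have "\<dots> = escale E ((1 + p) / 4) e1" using p by (simp add: scale_scale)
    finally have 1: "escale E (1/2) a \<sqsubseteq> escale E ((1 + p) / 4) e1" .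
    have "escale E ((1 + p) / 4) e1 \<sqsubseteq> escale E (1/4 + r / 2) e1"
      using p r by (intro scale_unit_mono) auto
    from le_trans[OF 1 this] have "escale E (1/2) a \<sqsubseteq> escale E (1/4 + r / 2) e1"
      using a by (simp add: scale_closed)
    moreover have "osum E (escale E (1/2) centre) (escale E (r / 2) e1) = Some (escale E (1/4 + r / 2) e1)"
      using scale_add[of e1 "1/4" "r / 2"] r by (simp add: centre_def scale_scale)
    ultimately show "half_le E r a centre" by (auto simp: half_le_def)
  qed
  then show "leq V v \<zero>\<^bsub>V\<^esub>" using t a by (simp add: v zero_q[of t] leq_q)
next
  show "unit V \<in> carrier V" by (simp add: unit_V)
  have "leq V (q (1/2, centre)) (q (1/2, e1))" using le_one by (subst leq_q) auto
  then show "leq V \<zero>\<^bsub>V\<^esub> (unit V)" using zero_q[of "1/2"] by (simp add: unit_q[of "1/2"] homothety_1)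
qed

text \<open>The midpoint with 1 is half of \<open>x\<close> plus the centre; subtracting the centre
  and dividing by 1/2 returns \<open>x\<close>.\<close>

definition emb :: "'a \<Rightarrow> 'a" where
  "emb = restrict (\<lambda>x. q (1/2, mid x e1)) (carrier E)"

lemma sc_half_centre: "sc r centre = sc (r / 2) e1" if "0 \<le> r" "r \<le> 1"
  using that by (simp add: centre_def sc_scale)

lemma mid_e1_reflect:
  assumes x: "x \<in> carrier E" and y: "y \<in> carrier E"
  shows "mid x e1 \<sqsubseteq> mid y e1 \<longleftrightarrow> x \<sqsubseteq> y"
proof
  assume le: "mid x e1 \<sqsubseteq> mid y e1"
  have "Some (escale E (1/2) v) \<boxplus> sc (1/2) e1 = Some (mid v e1)" if "v \<in> carrier E" for v
    using Some_cc[OF that one_closed, of "1/2" "1/2"] that by (simp add: sc_Some)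
  from le_cancel[OF this[OF x] this[OF y] le] show "x \<sqsubseteq> y" by (rule half_scale_reflect[OF x y])
qed (use assms in \<open>auto intro: cc_mono\<close>)

text \<open>Writing \<open>y\<close> as twice \<open>z\<close> plus \<open>w\<close> shows that the
  double of \<open>z\<close> is defined and below \<open>y\<close>.\<close>

lemma half_double:
  assumes z: "z \<in> carrier E" and y: "y \<in> carrier E" and le: "z \<sqsubseteq> escale E (1/2) y"
  obtains z' where "z' \<in> carrier E" "z' \<sqsubseteq> y" "escale E (1/2) z' = z"
proof -
  obtain w where w: "w \<in> carrier E" "Some (escale E (1/2) y) = Some z \<boxplus> Some w" using le z ele_iff by blast
  have "Some y = Some (escale E (1/2) y) \<boxplus> Some (escale E (1/2) y)"
    using sc_add[OF y, of "1/2" "1/2"] y by (simp add: sc_Some scale_one)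
  then have eq: "(Some z \<boxplus> Some z) \<boxplus> (Some w \<boxplus> Some w) = Some y" by (simp add: w(2) pl_ac)
  then obtain z' w' where z': "Some z \<boxplus> Some z = Some z'" "z' \<in> carrier E"
    and w': "Some w \<boxplus> Some w = Some w'" "w' \<in> carrier E" by (rule pl_SomeD)
  have "Some y = Some z' \<boxplus> Some w'" using eq z'(1) w'(1) by simp
  then have le': "z' \<sqsubseteq> y" using ele_iff[OF z'(2)] w'(2) by blast
  have "sc (1/2) z' = sc (1/2) z \<boxplus> sc (1/2) z" 
    by (rule sc_pl) (use z'(1) in simp_all)
  then have "sc (1/2) z' = Some z" using sc_add[OF z, of "1/2" "1/2"] sc_one[OF z] by simp
  then have "escale E (1/2) z' = z" using sc_Some[OF z'(2), of "1/2"] by simp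
  then show ?thesis by (rule that[OF z'(2) le'])
qed

text \<open>Division of small elements by a power of two, by repeated doubling; it supplies the
  preimages for \<open>emb_surj\<close>.\<close>

lemma power_half_divide:
  "z \<in> carrier E \<Longrightarrow> z \<sqsubseteq> escale E ((1/2) ^ n) e1 \<Longrightarrow> \<exists>x \<in> carrier E. escale E ((1/2) ^ n) x = z"
proof (induction n arbitrary: z)
  case 0
  then show ?case by (auto simp: scale_one)
next
  case (Suc n)
  have p: "0 \<le> (1/2 :: real) ^ n" "(1/2 :: real) ^ n \<le> 1" by (simp_all add: power_le_one)
  have "z \<sqsubseteq> escale E (1/2) (escale E ((1/2) ^ n) e1)" using Suc.prems p by (simp add: scale_scale)
  then obtain z' where z': "z' \<in> carrier E" "z' \<sqsubseteq> escale E ((1/2) ^ n) e1" "escale E (1/2) z' = z"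
    using half_double[OF Suc.prems(1) scale_closed[OF one_closed p]] by blast
  then obtain x where "x \<in> carrier E" "escale E ((1/2) ^ n) x = z'" using Suc.IH by blast
  then show ?case using z' p by (intro bexI[of _ x]) (auto simp: scale_scale)
qed

lemma emb_eq: "x \<in> carrier E \<Longrightarrow> emb x = q (1/2, mid x e1)"
  by (simp add: emb_def)

lemma emb_add:
  assumes "x \<in> carrier E" "y \<in> carrier E" "Some z = Some x \<boxplus> Some y"
  shows "emb x \<oplus>\<^bsub>V\<^esub> emb y = emb z"
proof -
  have "Some x \<boxplus> Some y = Some z" using assms by simp
  then have z: "z \<in> carrier E" by (rule pl_SomeD)
  have q: "sc (1/4) z = sc (1/4) x \<boxplus> sc (1/4) y" by (rule sc_pl[OF assms(3)]) auto
  \<comment> \<open>Both sides are a quarter of \<open>z\<close> plus half of 1; the centre pads the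
    right one to denominator 1/4.\<close>
  have "Some (mid (mid x e1) (mid y e1)) = Some (mid (mid z e1) centre)"
    using assms z by (simp add: Some_cc sc_cc sc_half_centre q pl_ac)
  then have "mid (mid x e1) (mid y e1) = homothety (1/2) (mid z e1)" using z by (simp add: mid_centre)
  moreover have "emb z = q (1/4, homothety (1/2) (mid z e1))"
    using q_shift[of "1/2" "mid z e1" "1/2"] z by (simp add: emb_eq)
  ultimately show ?thesis using assms z by (simp add: emb_eq add_q)
qed

lemma emb_scale:
  assumes x: "x \<in> carrier E" and r: "0 \<le> r" "r \<le> 1"
  shows "emb (escale E r x) = r \<odot>\<^bsub>V\<^esub> emb x"
proof -
  have e: "sc (r / 2) e1 \<boxplus> sc ((1 - r) / 2) e1 = sc (1/2) e1"
    using sc_add[of e1 "r / 2" "(1 - r) / 2"] r by (simp add: field_simps)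
  have "Some (homothety r (mid x e1)) = sc (r / 2) x \<boxplus> (sc (r / 2) e1 \<boxplus> sc ((1 - r) / 2) e1)"
    using Some_homothety_nonneg[of "mid x e1" r] x r by (simp add: sc_cc pl.assoc)
  also have "\<dots> = Some (mid (escale E r x) e1)"
    unfolding e using x r by (simp add: Some_cc scale_closed sc_scale)
  finally show ?thesis using x r by (simp add: emb_eq scale_closed smult_q[where k = 1])
qed

lemma emb_leq_iff: "x \<in> carrier E \<Longrightarrow> y \<in> carrier E \<Longrightarrow> leq V (emb x) (emb y) \<longleftrightarrow> x \<sqsubseteq> y"
  by (simp add: emb_eq leq_q mid_e1_reflect)

lemma mid_e1_e1: "mid e1 e1 = e1"
  using Some_cc[of e1 e1 "1/2" "1/2"] sc_add[of e1 "1/2" "1/2"] by (simp add: sc_one)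

lemma emb_closed:
  assumes "ous V" and x: "x \<in> carrier E"
  shows "emb x \<in> carrier (unit_interval V)"
proof -
  interpret V: ous V by fact
  have "Some (mid x e1) = Some centre \<boxplus> Some (escale E (1/2) x)"
    using Some_cc[of x e1 "1/2" "1/2"] x by (simp add: sc_Some centre_def pl.commute)
  then have "centre \<sqsubseteq> mid x e1" using ele_iff[of centre] x scale_closed[of x "1/2"] by auto
  moreover have "mid x e1 \<sqsubseteq> e1" using le_one x by simp
  ultimately show ?thesis
    using x by (simp add: V.carrier_unit_interval emb_eq unit_V zero_q[of "1/2"] leq_q)
qed

text \<open>Over a dyadic denominator \<open>t\<close>, the numerator lies between the centre and
  the centre plus the multiple of 1 by \<open>t\<close>. Its excess \<open>z\<close> over the centre
  is then \<open>t\<close> times some \<open>x\<close>, the preimage.\<close>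

lemma emb_surj:
  assumes "ous V" and v: "v \<in> carrier (unit_interval V)"
  obtains x where "x \<in> carrier E" "emb x = v"
proof -
  interpret V: ous V by fact
  have "v \<in> carrier V" and v0: "leq V \<zero>\<^bsub>V\<^esub> v" and v1: "leq V v (unit V)"
    using v by (auto simp: V.carrier_unit_interval)
  from this(1) obtain s b where s: "0 < s" "s \<le> 1" and b: "b \<in> carrier E" and vb: "v = q (s, b)" by (rule carrierE)
  obtain n where n: "(1/2) ^ n < s" using real_arch_pow_inv[OF s(1), of "1/2"] by auto
  \<comment> \<open>A power of 1/2 for the division by \<open>t\<close>, below \<open>s\<close> for
    expanding the fraction, and at most 1/2 by the extra factor, for writing the unit over
    \<open>t\<close>.\<close>
  define t where "t = (1/2 :: real) ^ Suc n"
  have p: "(1/2 :: real) ^ n \<le> 1" by (simp add: power_le_one)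
  then have t: "0 < t" "t \<le> 1/2" "t \<le> 1" "t \<le> s" using n s by (auto simp: t_def)
  define y where "y = homothety (t / s) b"
  have y: "y \<in> carrier E" using t s b by (simp add: y_def)
  have vy: "v = q (t, y)" using q_shift[OF s b, of "t / s"] t s by (simp add: vb y_def)
  have "centre \<sqsubseteq> y" using v0 t y by (simp add: vy zero_q[of t] leq_q)
  then obtain z where z: "z \<in> carrier E" "Some y = Some centre \<boxplus> Some z" using ele_iff by auto
  have yl: "y \<sqsubseteq> homothety (2 * t) e1" using v1 t y by (simp add: vy unit_q[of t] leq_q)
  have hh: "Some (homothety (2 * t) e1) = Some (escale E t e1) \<boxplus> Some centre"
  proof -
    have "sc (2 * t) e1 \<boxplus> sc ((1 - 2 * t) / 2) e1 = sc (1/2 + t) e1"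
      using sc_add[of e1 "2 * t" "(1 - 2 * t) / 2"] t by (simp add: field_simps)
    also have "\<dots> = sc t e1 \<boxplus> sc (1/2) e1" using sc_add[of e1 t "1/2"] t by (simp add: add.commute)
    finally show ?thesis using Some_homothety_nonneg[of e1 "2 * t"] t by (simp add: sc_Some centre_def)
  qed
  have "z \<sqsubseteq> escale E t e1"
    by (rule le_cancel[OF _ hh[symmetric] yl]) (simp add: z(2) pl.commute)
  then obtain x where x: "x \<in> carrier E" "escale E t x = z"
    using power_half_divide[OF z(1), of "Suc n"] by (auto simp: t_def)
  have e: "sc t e1 \<boxplus> sc ((1 - 2 * t) / 2) e1 = Some centre"
    using sc_add[of e1 t "(1 - 2 * t) / 2"] t by (simp add: field_simps centre_def sc_Some)
  have "Some (homothety (2 * t) (mid x e1)) = sc t x \<boxplus> (sc t e1 \<boxplus> sc ((1 - 2 * t) / 2) e1)"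
    using Some_homothety_nonneg[of "mid x e1" "2 * t"] x t by (simp add: sc_cc pl.assoc)
  also have "\<dots> = Some y" unfolding e using x t z(2) by (simp add: sc_Some pl.commute)
  finally have "emb x = v"
    using q_shift[of "1/2" "mid x e1" "2 * t"] x t by (simp add: emb_eq vy)
  with x(1) show ?thesis by (rule that)
qed

end

text \<open>The inverse must send defined sums to defined sums. By \<open>osum_defined_iff\<close>
  this is an inequality with a complement, which \<open>i\<close> preserves as a sum to 1 and which
  \<open>reflect\<close> brings back to \<open>E\<close>.\<close>

lemma is_iso_AEMod_inv:
  assumes E: "effect_module E" and F: "effect_module F" and i: "i \<in> emod_hom E F"
    and bij: "bij_betw i (carrier E) (carrier F)"
    and reflect: "\<And>x y. x \<in> carrier E \<Longrightarrow> y \<in> carrier E \<Longrightarrow> ele F (i x) (i y) \<Longrightarrow> ele E x y"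
  shows "is_iso AEMod F E (restrict (inv_into (carrier E) i) (carrier F))"
proof -
  interpret E: effmod E + F: effmod F using E F by (simp_all add: effmod_def)
  define j where "j = restrict (inv_into (carrier E) i) (carrier F)"
  note i' = emod_homD[OF i]
  have ji: "j (i x) = x" if "x \<in> carrier E" for x
    using that i'(2) bij by (simp add: j_def bij_betw_inv_into_left)
  have ij: "i (j y) = y" if "y \<in> carrier F" for y
    using that bij by (simp add: j_def bij_betw_inv_into_right)
  have jc: "j y \<in> carrier E" if "y \<in> carrier F" for y
    using that bij inv_into_into[of y i "carrier E"] by (simp add: j_def bij_betw_def)
  have j: "j \<in> emod_hom F E"
    unfolding emod_hom_def
  proof (intro CollectI conjI ballI allI impI)
    show "j \<in> carrier F \<rightarrow>\<^sub>E carrier E" using jc by (auto simp: j_def)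
    show "j (eone F) = eone E" using ji[OF E.one_closed] i'(3) by simp
  next
    fix a b c assume ab: "a \<in> carrier F" "b \<in> carrier F" and c: "osum F a b = Some c"
    note ja = jc[OF ab(1)] and jb = jc[OF ab(2)]
    have "osum E (j a) (ortho E (j a)) = Some (eone E)"
      using E.osum_eq_one_iff[OF ja E.ortho_closed[OF ja]] by simp
    from i'(4)[OF ja E.ortho_closed[OF ja] this]
    have "osum F a (i (ortho E (j a))) = Some (eone F)" by (simp only: i'(3) ij[OF ab(1)])
    then have "ortho F a = i (ortho E (j a))"
      using F.osum_eq_one_iff[OF ab(1) i'(2)[OF E.ortho_closed[OF ja]]] by simp
    moreover have "ele F b (ortho F a)" using F.osum_defined_iff[OF ab] c by simp
    ultimately have "ele F (i (j b)) (i (ortho E (j a)))" by (simp only: ij[OF ab(2)])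
    then have "ele E (j b) (ortho E (j a))" by (rule reflect[OF jb E.ortho_closed[OF ja]])
    then have "osum E (j a) (j b) \<noteq> None" using E.osum_defined_iff[OF ja jb] by simp
    then obtain d where d': "osum E (j a) (j b) = Some d" by auto
    have d: "d \<in> carrier E" by (rule effect_algebra_closed[OF E.effect_algebra ja jb d'])
    have "osum F a b = Some (i d)" using i'(4)[OF ja jb d'] by (simp only: ij[OF ab(1)] ij[OF ab(2)])
    then have "j c = d" using c ji[OF d] by simp
    then show "osum E (j a) (j b) = Some (j c)" using d' by simp
  next
    fix r :: real and a assume r: "r \<in> {0..1}" and a: "a \<in> carrier F"
    have "i (escale E r (j a)) = escale F r a" using i'(5)[of r "j a"] r jc[OF a] ij[OF a] by simp
    then show "j (escale F r a) = escale E r (j a)"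
      using ji[OF E.scale_closed[OF jc[OF a], of r]] r by simp
  qed
  have 1: "compose (carrier F) i j = restrict (\<lambda>x. x) (carrier F)"
    by (rule ext) (simp add: compose_def ij)
  have 2: "compose (carrier E) j i = restrict (\<lambda>x. x) (carrier E)"
    by (rule ext) (simp add: compose_def ji)
  show ?thesis
    unfolding j_def[symmetric] is_iso_def Hom_AEMod Comp_AEMod Ident_AEMod by (intro conjI bexI[of _ i] i j 1 2)
qed

text \<open>The isomorphism is the inverse of \<open>emb\<close>, in the direction of the counit of
  the equivalence.\<close>

lemma ex_unit_interval_iso:
  fixes E :: "'a effect_structure"
  assumes "effect_module E" "archimedean E"
  shows "\<exists>(V :: 'a ordered_space) e. order_unit_space V \<and> is_iso AEMod (unit_interval V) E e"
proof -
  interpret effmod E using assms by (simp add: effmod_def)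
  obtain q :: "real \<times> 'a \<Rightarrow> 'a" where "\<forall>p \<in> pairs. \<forall>p' \<in> pairs. q p = q p' \<longleftrightarrow> lep p p' \<and> lep p' p"
    using ex_quotient_map by blast
  then interpret effmod_quotient E q by unfold_locales blast
  have V: "order_unit_space V" by (rule order_unit_space_V[OF assms(2)])
  then interpret V: ous V by (simp add: ous_def)
  note closed = emb_closed[OF V.ous_axioms]
  have "emb \<in> emod_hom E (unit_interval V)"
    unfolding emod_hom_def
  proof (intro CollectI conjI ballI allI impI)
    show "emb \<in> carrier E \<rightarrow>\<^sub>E carrier (unit_interval V)" using closed by (auto simp: emb_def)
    show "emb e1 = eone (unit_interval V)" by (simp add: V.eone_unit_interval unit_V emb_eq mid_e1_e1)
  next
    fix x y z assume xy: "x \<in> carrier E" "y \<in> carrier E" and z: "osum E x y = Some z"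
    then have "emb x \<oplus>\<^bsub>V\<^esub> emb y = emb z" by (intro emb_add) (simp_all add: pl_Some)
    moreover have "leq V (emb z) (unit V)"
      using closed[OF effect_algebra_closed[OF effect_algebra xy z]] by (simp add: V.carrier_unit_interval)
    ultimately show "osum (unit_interval V) (emb x) (emb y) = Some (emb z)"
      by (simp add: V.osum_unit_interval)
  next
    fix r :: real and x assume "r \<in> {0..1}" "x \<in> carrier E"
    then show "emb (escale E r x) = escale (unit_interval V) r (emb x)"
      by (simp add: emb_scale V.escale_unit_interval)
  qed
  moreover have "bij_betw emb (carrier E) (carrier (unit_interval V))"
  proof (rule bij_betwI')
    show "emb x = emb y \<longleftrightarrow> x = y" if "x \<in> carrier E" "y \<in> carrier E" for x y
    proof
      assume "emb x = emb y"
      then have "leq V (emb x) (emb y)" "leq V (emb y) (emb x)"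
        using closed[OF that(1)] by (simp_all add: V.carrier_unit_interval)
      then show "x = y" using emb_leq_iff that le_antisym by simp
    qed simp
    show "\<exists>x \<in> carrier E. v = emb x" if "v \<in> carrier (unit_interval V)" for v
      using emb_surj[OF V.ous_axioms that] by metis
  qed (rule closed)
  moreover have "ele E x y" if "x \<in> carrier E" "y \<in> carrier E" "ele (unit_interval V) (emb x) (emb y)" for x y
    using that emb_leq_iff V.unit_interval_ele closed by simp
  ultimately have "is_iso AEMod (unit_interval V) E (restrict (inv_into (carrier E) emb) (carrier (unit_interval V)))"
    by (rule is_iso_AEMod_inv[OF effect_module V.effect_module_unit_interval])
  with V show ?thesis by blast
qed

text \<open>The relation \<open>half_le\<close> is built from sums, scalars and 1, all of which
  morphisms preserve; applied to both directions of an isomorphism it gives equal distances.\<close>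

lemma emod_hom_half_le:
  assumes E: "effect_module E" and F: "effect_module F" and f: "f \<in> emod_hom E F"
    and xy: "x \<in> carrier E" "y \<in> carrier E" and r: "0 \<le> r" "r \<le> 1" and le: "half_le E r x y"
  shows "half_le F r (f x) (f y)"
proof -
  interpret E: effmod E using E by (simp add: effmod_def)
  note f' = emod_homD[OF f]
  obtain w z where w: "osum E (escale E (1/2) y) (escale E (r/2) (eone E)) = Some w"
    and z: "z \<in> carrier E" "osum E (escale E (1/2) x) z = Some w"
    using le by (auto simp: half_le_def ele_def)
  have c: "escale E (1/2) x \<in> carrier E" "escale E (1/2) y \<in> carrier E" "escale E (r/2) (eone E) \<in> carrier E"
    using xy r by (auto intro: E.scale_closed)
  have "osum F (escale F (1/2) (f y)) (escale F (r/2) (eone F)) = Some (f w)"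
    using f'(4)[OF c(2,3) w] f'(5)[of "1/2" y] f'(5)[of "r/2" "eone E"] f'(3) xy r by simp
  moreover have "osum F (escale F (1/2) (f x)) (f z) = Some (f w)"
    using f'(4)[OF c(1) z] f'(5)[of "1/2" x] xy by simp
  ultimately show ?thesis using f'(2)[OF z(1)] by (auto simp: half_le_def ele_def)
qed

text \<open>The metric axioms for \<open>edist\<close> are available on intervals, the role of
  \<open>F\<close> here; they are carried over to \<open>E\<close> along the isometry before
  completeness is carried back.\<close>

lemma banach_effect_module_iso:
  assumes E: "effect_module E" and F: "effect_module F" and iso: "is_iso AEMod F E e"
    and metric: "Metric_space (carrier F) (edist F)"
  shows "banach_effect_module E \<Longrightarrow> banach_effect_module F"
proof -
  obtain g where e: "e \<in> emod_hom F E" and g: "g \<in> emod_hom E F"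
    and ge: "compose (carrier F) g e = restrict (\<lambda>x. x) (carrier F)"
    and eg: "compose (carrier E) e g = restrict (\<lambda>x. x) (carrier E)"
    using iso unfolding is_iso_def Hom_AEMod Comp_AEMod Ident_AEMod by auto
  have ge': "g (e x) = x" if "x \<in> carrier F" for x
    using fun_cong[OF ge, of x] that by (simp add: compose_def)
  have eg': "e (g x) = x" if "x \<in> carrier E" for x
    using fun_cong[OF eg, of x] that by (simp add: compose_def)
  have bij: "bij_betw e (carrier F) (carrier E)"
    by (rule bij_betw_byWitness[where f' = g])
      (use ge' eg' emod_homD(2)[OF e] emod_homD(2)[OF g] in auto)
  have bij': "bij_betw g (carrier E) (carrier F)"
    by (rule bij_betw_byWitness[where f' = e])
      (use ge' eg' emod_homD(2)[OF e] emod_homD(2)[OF g] in auto)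
  have half: "half_le F r x y \<longleftrightarrow> half_le E r (e x) (e y)"
    if "x \<in> carrier F" "y \<in> carrier F" "r \<in> {0<..1}" for r x y
    using emod_hom_half_le[OF F E e that(1,2), of r]
      emod_hom_half_le[OF E F g emod_homD(2)[OF e that(1)] emod_homD(2)[OF e that(2)], of r] that ge' by auto
  have dist: "edist F x y = edist E (e x) (e y)" if "x \<in> carrier F" "y \<in> carrier F" for x y
  proof -
    have "{r \<in> {0<..1}. half_le F r a b} = {r \<in> {0<..1}. half_le E r (e a) (e b)}"
      if "a \<in> carrier F" "b \<in> carrier F" for a b
      using half[OF that] by blast
    then show ?thesis using that emod_homD(2)[OF e] by (simp add: edist_def)
  qed
  have dist': "edist E x y = edist F (g x) (g y)" if "x \<in> carrier E" "y \<in> carrier E" for x y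
    using dist[of "g x" "g y"] that eg' emod_homD(2)[OF g] by simp
  have E_metric: "Metric_space (carrier E) (edist E)"
    by (rule Metric_space_isometric[OF metric bij_betw_imp_inj_on[OF bij'] _ dist'])
      (auto simp: bij_betw_imp_surj_on[OF bij'] edist_def)
  assume "banach_effect_module E"
  then have complete: "Metric_space.mcomplete (carrier E) (edist E)" by (simp only: banach_effect_module_def)
  show "banach_effect_module F"
    unfolding banach_effect_module_def
    by (rule mcomplete_isometric[OF E_metric bij dist _ complete]) (auto simp: edist_def)
qed

theorem proposition11:
  shows "\<exists>(G :: ('a effect_structure, 'a \<Rightarrow> 'a, 'a ordered_space, 'a \<Rightarrow> 'a) functor_data) \<eta> \<epsilon>.
     is_equivalence OUS AEMod unit_interval_functor G \<eta> \<epsilon> \<and>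
     is_equivalence BOUS BEMod unit_interval_functor G \<eta> \<epsilon>"
proof -
  \<comment> \<open>The condition on \<open>E\<close> stands under the existential quantifiers, so
    that choice gives functions on the whole type.\<close>
  have "\<forall>E :: 'a effect_structure. \<exists>V :: 'a ordered_space. \<exists>e. E \<in> Obj AEMod \<longrightarrow>
      order_unit_space V \<and> is_iso AEMod (unit_interval V) E e"
    using ex_unit_interval_iso by (metis Obj_AEMod)
  then obtain G0 :: "'a effect_structure \<Rightarrow> 'a ordered_space" and \<epsilon>
    where G0: "\<And>E. E \<in> Obj AEMod \<Longrightarrow> order_unit_space (G0 E)"
      and \<epsilon>: "\<And>E. E \<in> Obj AEMod \<Longrightarrow> is_iso AEMod (unit_interval (G0 E)) E (\<epsilon> E)"
    by metis
  have "\<exists>G \<eta>. OMap G = G0 \<and> is_equivalence OUS AEMod unit_interval_functor G \<eta> \<epsilon>"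
  proof (rule fully_faithful_imp_equivalence[OF is_functor_unit_interval])
    fix V W :: "'a ordered_space" assume "V \<in> Obj OUS" "W \<in> Obj OUS"
    then show "bij_betw (MMap unit_interval_functor V W) (Hom OUS V W)
        (Hom AEMod (OMap unit_interval_functor V) (OMap unit_interval_functor W))"
      using bij_betw_unit_interval[of V W] by (simp add: OUS_def unit_interval_functor_def Hom_AEMod)
  qed (use G0 \<epsilon> in \<open>simp_all add: OUS_def unit_interval_functor_def\<close>)
  then obtain G \<eta> where G: "OMap G = G0" and eq: "is_equivalence OUS AEMod unit_interval_functor G \<eta> \<epsilon>"
    by blast
  have "is_equivalence BOUS BEMod unit_interval_functor G \<eta> \<epsilon>"
    unfolding BOUS_def BEMod_def
  proof (rule is_equivalence_full_subcategory[OF eq])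
    fix V :: "'a ordered_space" assume "V \<in> Obj OUS" "banach_space V"
    then show "banach_effect_module (OMap unit_interval_functor V)"
      using ous.banach_iff[of V] by (simp add: OUS_def ous_def unit_interval_functor_def)
  next
    fix E :: "'a effect_structure" assume E: "E \<in> Obj AEMod" "banach_effect_module E"
    then interpret V: ous "G0 E" using G0 by (simp add: ous_def)
    \<comment> \<open>Completeness goes from \<open>E\<close> to the isomorphic interval along the
      counit component, and from the interval to its space by \<open>banach_iff\<close>.\<close>
    have "banach_effect_module (unit_interval (G0 E))"
      using banach_effect_module_iso[OF _ V.effect_module_unit_interval \<epsilon>[OF E(1)]
          V.Metric_space_edist_unit_interval] E by (simp add: Obj_AEMod)
    then show "banach_space (OMap G E)" using V.banach_iff G by simp
  qed
  with eq show ?thesis by blast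
qed

end
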